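(* (i) Let $\mathcal A$ be an alphabet with $2$ letters and let $\boldsymbol\tau=(\tau_n:\mathcal A^*\to\mathcal A^* )_{n\ge0}$ be a sequence of non-erasing morphisms such that the $\mathcal S$-adic subshift $(X_{\boldsymbol\tau},S)$ generated by $\boldsymbol\tau$ is aperiodic and minimal. Then $(X_{\boldsymbol\tau},S)$ has at most two asymptotic components. (ii) Let $(X,T)$ be a minimal Cantor system of topological rank $2$. Then $(X,T)$ has a unique asymptotic component.
   Context: $S$ is the shift map. The $\mathcal S$-adic subshift $X_{\boldsymbol\tau}$ is the set of $x\in\mathcal A^{\mathbb Z}$ all of whose finite factors occur in $\tau_0\circ\cdots\circ\tau_{N-1}(a)$ for some $N\ge1$, $a\in\mathcal A$. A system is aperiodic if all its orbits are infinite, and minimal if all its orbits are dense. Asymptotic components. In a system $(X,T)$ ($T$ a homeomorphism of a compact metric space), $x,y$ are (left) asymptotic if $\lim_{n\to+\infty}\mathrm{dist}(T^{-n}x,T^{-n}y)=0$. Two orbits are asymptotic if they contain points $x'$, $y'$ (one in each orbit) which are asymptotic; this is an equivalence relation on the set of orbits. An asymptotic component is an equivalence class of orbits containing at least two distinct orbits. Topological rank. Let $(X,T)$ be a minimal Cantor system (minimal homeomorphism of a Cantor set). A clopen Kakutani-Rohlin (CKR) partition of $X$ is a partition $\mathcal T=\{T^{-j}B(k):1\le k\le d,\ 0\le j<h(k)\}$ of $X$, where $B(1),\dots,B(d)$ are clopen, $h(k)\geq 1$ and $\bigcup_k T^{-h(k)}B(k)=\bigcup_k B(k)$; its base is $B(\mathcal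 T)=\bigcup_k B(k)$, and it has $d$ towers $\mathcal T(k)=\{T^{-j}B(k):0\le j<h(k)\}$. A sequence $(\mathcal T_n)_{n\ge0}$ of CKR partitions, $\mathcal T_n=\{T^{-j}B_n(k):1\le k\le d_n,0\le j<h_n(k)\}$, $\mathcal T_0=\{X\}$, is nested if for all $n$: $B(\mathcal T_{n+1})\subseteq B(\mathcal T_n)$; $\mathcal T_{n+1}$ refines $\mathcal T_n$; $\bigcap_n B(\mathcal T_n)$ is a single point; and the partitions $\mathcal T_n$ span the topology of $X$. It is primitive if for every $n\ge1$ there is $N>n$ such that every tower of $\mathcal T_N$ crosses every tower of $\mathcal T_n$ (i.e. the points of each $T^{-(h_N(k)-1)}B_N(k)$, iterated by $T$ until reaching $B_N(k)$, completely cross all towers of $\mathcal T_n$). The system has finite topological rank if it admits a primitive nested sequence of CKR partitions with $d_n\le d$ for all $n$, for some $d$ (equivalently, a Bratteli-Vershik representation with at most $d$ vertices per level); the minimum such $d$ is its topological rank. *)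

theory Defs
  imports
    "HOL-Analysis.Analysis"
    "HOL-Library.Sublist"
    "HOL-Library.Disjoint_Sets"
    "HOL-Library.Extended_Nat"
begin

section \<open>Topological dynamical systems\<close>

text \<open>
  A system is given by a carrier \<open>X\<close>, a metric \<open>d\<close> on it and a map \<open>T\<close>; only the values of
  \<open>T\<close> on \<open>X\<close> matter.
\<close>

definition compact_system :: "'x set \<Rightarrow> ('x \<Rightarrow> 'x \<Rightarrow> real) \<Rightarrow> ('x \<Rightarrow> 'x) \<Rightarrow> bool" where
  "compact_system X d T \<longleftrightarrow>
     Metric_space X d \<and>
     compact_space (Metric_space.mtopology X d) \<and>
     homeomorphic_map (Metric_space.mtopology X d) (Metric_space.mtopology X d) T"

definition int_iter :: "'x set \<Rightarrow> ('x \<Rightarrow> 'x) \<Rightarrow> int \<Rightarrow> 'x \<Rightarrow> 'x" where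
  "int_iter X T k =
     (if k \<ge> 0 then T ^^ nat k else inv_into X T ^^ nat (- k))"

definition orbit :: "'x set \<Rightarrow> ('x \<Rightarrow> 'x) \<Rightarrow> 'x \<Rightarrow> 'x set" where
  "orbit X T x = range (\<lambda>k. int_iter X T k x)"

definition aperiodic_system :: "'x set \<Rightarrow> ('x \<Rightarrow> 'x) \<Rightarrow> bool" where
  "aperiodic_system X T \<longleftrightarrow> (\<forall>x\<in>X. infinite (orbit X T x))"

definition minimal_system :: "'x set \<Rightarrow> ('x \<Rightarrow> 'x \<Rightarrow> real) \<Rightarrow> ('x \<Rightarrow> 'x) \<Rightarrow> bool" where
  "minimal_system X d T \<longleftrightarrow>
     (\<forall>x\<in>X. Metric_space.mtopology X d closure_of orbit X T x = X)"

section \<open>Asymptotic components\<close>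

definition asymptotic ::
    "'x set \<Rightarrow> ('x \<Rightarrow> 'x \<Rightarrow> real) \<Rightarrow> ('x \<Rightarrow> 'x) \<Rightarrow> 'x \<Rightarrow> 'x \<Rightarrow> bool" where
  "asymptotic X d T x y \<longleftrightarrow>
     (\<lambda>n. d (int_iter X T (- int n) x) (int_iter X T (- int n) y)) \<longlonglongrightarrow> 0"

definition orbits :: "'x set \<Rightarrow> ('x \<Rightarrow> 'x) \<Rightarrow> 'x set set" where
  "orbits X T = orbit X T ` X"

definition asymptotic_orbits ::
    "'x set \<Rightarrow> ('x \<Rightarrow> 'x \<Rightarrow> real) \<Rightarrow> ('x \<Rightarrow> 'x) \<Rightarrow> ('x set \<times> 'x set) set" where
  "asymptotic_orbits X d T =
     {(P, Q). P \<in> orbits X T \<and> Q \<in> orbits X T \<and>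
              (\<exists>x\<in>P. \<exists>y\<in>Q. asymptotic X d T x y)}"

definition asymptotic_components ::
    "'x set \<Rightarrow> ('x \<Rightarrow> 'x \<Rightarrow> real) \<Rightarrow> ('x \<Rightarrow> 'x) \<Rightarrow> 'x set set set" where
  "asymptotic_components X d T =
     {C \<in> orbits X T // asymptotic_orbits X d T. \<exists>P\<in>C. \<exists>Q\<in>C. P \<noteq> Q}"

section \<open>Morphisms and S-adic subshifts\<close>

definition nonerasing_morphism :: "('a list \<Rightarrow> 'b list) \<Rightarrow> bool" where
  "nonerasing_morphism \<sigma> \<longleftrightarrow>
     (\<forall>u v. \<sigma> (u @ v) = \<sigma> u @ \<sigma> v) \<and> (\<forall>a. \<sigma> [a] \<noteq> [])"

text \<open>\<open>compose_upto \<tau> N\<close> is \<open>\<tau>\<^sub>0 \<circ> \<dots> \<circ> \<tau>\<^bsub>N-1\<^esub>\<close>.\<close>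

primrec compose_upto :: "(nat \<Rightarrow> 'b \<Rightarrow> 'b) \<Rightarrow> nat \<Rightarrow> 'b \<Rightarrow> 'b" where
  "compose_upto \<tau> 0 = id"
| "compose_upto \<tau> (Suc N) = compose_upto \<tau> N \<circ> \<tau> N"

definition shift :: "(int \<Rightarrow> 'a) \<Rightarrow> int \<Rightarrow> 'a" where
  "shift x = (\<lambda>n. x (n + 1))"

text \<open>\<open>map x [i..j]\<close> is the factor \<open>x\<^sub>i \<dots> x\<^sub>j\<close> (empty if \<open>j < i\<close>).\<close>

definition sadic_subshift :: "(nat \<Rightarrow> 'a list \<Rightarrow> 'a list) \<Rightarrow> (int \<Rightarrow> 'a) set" where
  "sadic_subshift \<tau> =
     {x. \<forall>i j. \<exists>N\<ge>1. \<exists>a. sublist (map x [i..j]) (compose_upto \<tau> N [a])}"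

text \<open>
  The usual metric on two-sided sequences: \<open>2\<^bsup>-n\<^esup>\<close>, where \<open>n\<close> is least such that the
  sequences differ at \<open>n\<close> or at \<open>-n\<close>. It induces the product of the discrete topologies
  (lemma \<open>mtopology_shift_dist\<close>).
\<close>

definition shift_dist :: "(int \<Rightarrow> 'a) \<Rightarrow> (int \<Rightarrow> 'a) \<Rightarrow> real" where
  "shift_dist x y =
     (if x = y then 0
      else (1 / 2) ^ (LEAST n. x (int n) \<noteq> y (int n) \<or> x (- int n) \<noteq> y (- int n)))"

section \<open>Cantor systems and topological rank\<close>

definition cantor_space :: "'x topology \<Rightarrow> bool" where
  "cantor_space X \<longleftrightarrow>
     X homeomorphic_space
       product_topology (\<lambda>_ :: nat. discrete_topology (UNIV :: bool set)) UNIV"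

definition minimal_cantor_system ::
    "'x set \<Rightarrow> ('x \<Rightarrow> 'x \<Rightarrow> real) \<Rightarrow> ('x \<Rightarrow> 'x) \<Rightarrow> bool" where
  "minimal_cantor_system X d T \<longleftrightarrow>
     compact_system X d T \<and> cantor_space (Metric_space.mtopology X d) \<and>
     minimal_system X d T"

text \<open>
  The combinatorial data of a Kakutani-Rohlin partition: the number of towers and, for each
  tower \<open>k \<in> {1..towers P}\<close>, its height and its base.
\<close>

record 'x kr =
  towers :: nat
  height :: "nat \<Rightarrow> nat"
  base :: "nat \<Rightarrow> 'x set"

text \<open>The set \<open>T\<^bsup>-j\<^esup> B\<close>.\<close>

definition pull :: "'x set \<Rightarrow> ('x \<Rightarrow> 'x) \<Rightarrow> nat \<Rightarrow> 'x set \<Rightarrow> 'x set" where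
  "pull X T j B = {x \<in> X. (T ^^ j) x \<in> B}"

definition kr_index :: "'x kr \<Rightarrow> (nat \<times> nat) set" where
  "kr_index P = (SIGMA k:{1..towers P}. {..<height P k})"

definition kr_level :: "'x set \<Rightarrow> ('x \<Rightarrow> 'x) \<Rightarrow> 'x kr \<Rightarrow> nat \<times> nat \<Rightarrow> 'x set" where
  "kr_level X T P = (\<lambda>(k, j). pull X T j (base P k))"

definition kr_levels :: "'x set \<Rightarrow> ('x \<Rightarrow> 'x) \<Rightarrow> 'x kr \<Rightarrow> 'x set set" where
  "kr_levels X T P = kr_level X T P ` kr_index P"

definition kr_base :: "'x kr \<Rightarrow> 'x set" where
  "kr_base P = (\<Union>k\<in>{1..towers P}. base P k)"

text \<open>
  Disjointness is required of the indexed family, so that levels with different indices are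
  different atoms of the partition.
\<close>

definition ckr_partition ::
    "'x set \<Rightarrow> ('x \<Rightarrow> 'x \<Rightarrow> real) \<Rightarrow> ('x \<Rightarrow> 'x) \<Rightarrow> 'x kr \<Rightarrow> bool" where
  "ckr_partition X d T P \<longleftrightarrow>
     (\<forall>k\<in>{1..towers P}.
        openin (Metric_space.mtopology X d) (base P k) \<and>
        closedin (Metric_space.mtopology X d) (base P k) \<and>
        height P k \<ge> 1) \<and>
     disjoint_family_on (kr_level X T P) (kr_index P) \<and>
     partition_on X (kr_levels X T P) \<and>
     (\<Union>k\<in>{1..towers P}. pull X T (height P k) (base P k)) = kr_base P"

definition nested_ckr ::
    "'x set \<Rightarrow> ('x \<Rightarrow> 'x \<Rightarrow> real) \<Rightarrow> ('x \<Rightarrow> 'x) \<Rightarrow> (nat \<Rightarrow> 'x kr) \<Rightarrow> bool" where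
  "nested_ckr X d T P \<longleftrightarrow>
     (\<forall>n. ckr_partition X d T (P n)) \<and>
     kr_levels X T (P 0) = {X} \<and>
     (\<forall>n. kr_base (P (Suc n)) \<subseteq> kr_base (P n)) \<and>
     (\<forall>n. refines X (kr_levels X T (P (Suc n))) (kr_levels X T (P n))) \<and>
     (\<exists>x. (\<Inter>n. kr_base (P n)) = {x}) \<and>
     topology_generated_by (\<Union>n. kr_levels X T (P n)) = Metric_space.mtopology X d"

text \<open>
  Tower \<open>k\<close> of \<open>Q\<close> crosses tower \<open>l\<close> of \<open>P\<close>: every point \<open>x\<close> of the level furthest from the
  base of the former has, during its stay \<open>x, T x, \<dots>, T\<^bsup>height Q k - 1\<^esup> x\<close> in that tower,
  a complete passage \<open>T\<^bsup>i\<^esup> x, \<dots>, T\<^bsup>i + height P l - 1\<^esup> x\<close> through the levels of the latter,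
  from the level furthest from the base down to the base.
\<close>

definition crosses ::
    "'x set \<Rightarrow> ('x \<Rightarrow> 'x) \<Rightarrow> 'x kr \<Rightarrow> nat \<Rightarrow> 'x kr \<Rightarrow> nat \<Rightarrow> bool" where
  "crosses X T Q k P l \<longleftrightarrow>
     (\<forall>x\<in>pull X T (height Q k - 1) (base Q k).
        \<exists>i. i + height P l \<le> height Q k \<and>
            (\<forall>j<height P l.
               (T ^^ (i + j)) x \<in> pull X T (height P l - 1 - j) (base P l)))"

definition primitive_ckr :: "'x set \<Rightarrow> ('x \<Rightarrow> 'x) \<Rightarrow> (nat \<Rightarrow> 'x kr) \<Rightarrow> bool" where
  "primitive_ckr X T P \<longleftrightarrow>
     (\<forall>n\<ge>1. \<exists>N>n. \<forall>k\<in>{1..towers (P N)}. \<forall>l\<in>{1..towers (P n)}.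
        crosses X T (P N) k (P n) l)"

definition topological_rank_le ::
    "'x set \<Rightarrow> ('x \<Rightarrow> 'x \<Rightarrow> real) \<Rightarrow> ('x \<Rightarrow> 'x) \<Rightarrow> nat \<Rightarrow> bool" where
  "topological_rank_le X d T r \<longleftrightarrow>
     (\<exists>P. nested_ckr X d T P \<and> primitive_ckr X T P \<and> (\<forall>n. towers (P n) \<le> r))"

text \<open>
  The infimum is a minimum if the system has finite topological rank, and \<open>\<infinity>\<close> otherwise.
\<close>

definition topological_rank ::
    "'x set \<Rightarrow> ('x \<Rightarrow> 'x \<Rightarrow> real) \<Rightarrow> ('x \<Rightarrow> 'x) \<Rightarrow> enat" where
  "topological_rank X d T = Inf {enat r | r. topological_rank_le X d T r}"

section \<open>S-adic subshifts are compact systems\<close>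

lemma shift_dist_less_iff:
  "shift_dist x y < (1 / 2) ^ n \<longleftrightarrow> (\<forall>k. \<bar>k\<bar> \<le> int n \<longrightarrow> x k = y k)"
proof (cases "x = y")
  case False
  let ?P = "\<lambda>n. x (int n) \<noteq> y (int n) \<or> x (- int n) \<noteq> y (- int n)"
  obtain k where k: "x k \<noteq> y k" using False by auto
  have "?P (nat \<bar>k\<bar>)" using k by (cases "k \<ge> 0") auto
  then have L: "?P (LEAST n. ?P n)" by (rule LeastI)
  have "shift_dist x y < (1 / 2) ^ n \<longleftrightarrow> n < (LEAST n. ?P n)"
    using False by (simp add: shift_dist_def power_strict_decreasing_iff)
  also have "\<dots> \<longleftrightarrow> (\<forall>m\<le>n. \<not> ?P m)"
  proof
    assume "\<forall>m\<le>n. \<not> ?P m"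
    with L show "n < (LEAST n. ?P n)" using not_le by blast
  qed (metis (mono_tags, lifting) le_less_trans not_less_Least)
  also have "\<dots> \<longleftrightarrow> (\<forall>k. \<bar>k\<bar> \<le> int n \<longrightarrow> x k = y k)"
  proof
    assume *: "\<forall>m\<le>n. \<not> ?P m"
    show "\<forall>k. \<bar>k\<bar> \<le> int n \<longrightarrow> x k = y k"
    proof (intro allI impI)
      fix k :: int assume "\<bar>k\<bar> \<le> int n"
      then have "\<not> ?P (nat \<bar>k\<bar>)" using *[rule_format, of "nat \<bar>k\<bar>"] by simp
      then show "x k = y k" by (cases "k \<ge> 0") auto
    qed
  qed auto
  finally show ?thesis .
qed (simp add: shift_dist_def)

lemma Metric_space_shift_dist: "Metric_space X shift_dist"
proof
  fix x y z :: "int \<Rightarrow> 'a"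
  show nonneg: "0 \<le> shift_dist x y" for x y :: "int \<Rightarrow> 'a" by (simp add: shift_dist_def)
  show "shift_dist x y = shift_dist y x"
  proof -
    have "(\<lambda>n. x (int n) \<noteq> y (int n) \<or> x (- int n) \<noteq> y (- int n)) =
          (\<lambda>n. y (int n) \<noteq> x (int n) \<or> y (- int n) \<noteq> x (- int n))" by auto
    then show ?thesis by (simp only: shift_dist_def eq_commute[of x y])
  qed
  show "shift_dist x y = 0 \<longleftrightarrow> x = y" by (simp add: shift_dist_def)
  show "shift_dist x z \<le> shift_dist x y + shift_dist y z"
  proof (cases "x = z")
    case False
    then obtain N where N: "shift_dist x z = (1 / 2) ^ N" by (auto simp: shift_dist_def)
    have "\<not> shift_dist x z < (1 / 2) ^ N" by (simp add: N)
    then have "\<not> (shift_dist x y < (1 / 2) ^ N \<and> shift_dist y z < (1 / 2) ^ N)"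
      unfolding shift_dist_less_iff by metis
    then show ?thesis using nonneg[of x y] nonneg[of y z] N by linarith
  qed (use nonneg[of x y] nonneg[of y z] in \<open>simp add: shift_dist_def\<close>)
qed

lemma mtopology_shift_dist:
  "Metric_space.mtopology UNIV shift_dist =
     product_topology (\<lambda>_ :: int. discrete_topology (UNIV :: 'a set)) UNIV"
    (is "?M = ?P")
proof -
  interpret Metric_space "UNIV :: (int \<Rightarrow> 'a) set" shift_dist
    by (rule Metric_space_shift_dist)
  have "openin ?M U \<longleftrightarrow> openin ?P U" for U
  proof
    assume U: "openin ?M U"
    show "openin ?P U"
      unfolding openin_product_topology_alt
    proof (intro ballI)
      fix x assume "x \<in> U"
      then obtain r where r: "r > 0" "mball x r \<subseteq> U"
        using U by (auto simp: openin_mtopology)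
      obtain n where n: "(1 / 2 :: real) ^ n < r"
        using real_arch_pow_inv[of r "1/2"] r by auto
      let ?V = "\<lambda>k :: int. if \<bar>k\<bar> \<le> int n then {x k} else UNIV"
      have "{k. ?V k \<noteq> UNIV} \<subseteq> {- int n..int n}" by auto
      then have "finite {k. ?V k \<noteq> UNIV}" using finite_subset by blast
      moreover have "PiE UNIV ?V \<subseteq> U"
      proof
        fix y assume y: "y \<in> PiE UNIV ?V"
        have "x k = y k" if "\<bar>k\<bar> \<le> int n" for k
          using PiE_mem[OF y, of k] that by simp
        then have "shift_dist x y < (1 / 2) ^ n" by (simp add: shift_dist_less_iff)
        then show "y \<in> U" using r n by (auto simp: mball_def)
      qed
      ultimately show "\<exists>V. finite {i \<in> UNIV. V i \<noteq> topspace (discrete_topology (UNIV :: 'a set))} \<and>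
          (\<forall>i\<in>UNIV. openin (discrete_topology UNIV) (V i)) \<and>
          x \<in> PiE UNIV V \<and> PiE UNIV V \<subseteq> U"
        by (intro exI[of _ ?V]) auto
    qed
  next
    assume U: "openin ?P U"
    show "openin ?M U"
      unfolding openin_mtopology
    proof (intro conjI allI impI)
      fix x assume "x \<in> U"
      then obtain V where V: "finite {i. V i \<noteq> (UNIV :: 'a set)}" "x \<in> PiE UNIV V"
          "PiE UNIV V \<subseteq> U"
        using U unfolding openin_product_topology_alt by auto
      obtain n where n: "nat \<bar>k\<bar> \<le> n" if "V k \<noteq> UNIV" for k
        using V(1) finite_nat_set_iff_bounded_le[of "(\<lambda>k. nat \<bar>k\<bar>) ` {i. V i \<noteq> UNIV}"]
        by auto
      have "mball x ((1 / 2) ^ n) \<subseteq> U"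
      proof
        fix y assume "y \<in> mball x ((1 / 2) ^ n)"
        then have "\<And>k. \<bar>k\<bar> \<le> int n \<Longrightarrow> x k = y k"
          by (auto simp: mball_def shift_dist_less_iff)
        then have "y k \<in> V k" for k
          using n[of k] PiE_mem[OF V(2), of k]
          by (cases "V k = UNIV") (auto simp: nat_le_iff)
        then show "y \<in> U" using V(3) by auto
      qed
      then show "\<exists>r>0. mball x r \<subseteq> U" by (intro exI[of _ "(1 / 2) ^ n"]) auto
    qed auto
  qed
  then show ?thesis by (simp add: topology_eq)
qed

lemma shift_in_sadic_subshift_iff: "shift x \<in> sadic_subshift \<tau> \<longleftrightarrow> x \<in> sadic_subshift \<tau>"
proof -
  have m: "map (shift x) [i..j] = map x [i + 1..j + 1]" for i j
    by (rule nth_equalityI) (auto simp: shift_def algebra_simps)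
  have "(\<forall>i j. Q [i + 1..j + 1]) \<longleftrightarrow> (\<forall>i j. Q [i..j])" for Q :: "int list \<Rightarrow> bool"
    by (metis diff_add_cancel)
  from this[of "\<lambda>u. \<exists>N\<ge>1. \<exists>a. sublist (map x u) (compose_upto \<tau> N [a])"]
  show ?thesis by (simp add: sadic_subshift_def m)
qed

lemma compact_system_sadic_subshift:
  fixes \<tau> :: "nat \<Rightarrow> 'a::finite list \<Rightarrow> 'a list"
  shows "compact_system (sadic_subshift \<tau>) shift_dist shift"
proof -
  let ?X = "sadic_subshift \<tau>"
  interpret Metric_space "UNIV :: (int \<Rightarrow> 'a) set" shift_dist
    by (rule Metric_space_shift_dist)
  have sub: "Metric_space.mtopology ?X shift_dist = subtopology mtopology ?X"
    by (intro Submetric.mtopology_submetric Submetric.intro Submetric_axioms.intro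
        Metric_space_axioms) auto
  have comp: "compact_space mtopology"
    unfolding mtopology_shift_dist
    by (simp add: compact_space_product_topology compact_space_discrete_topology)
  have "closedin mtopology ?X"
    unfolding closedin_metric
  proof (intro conjI allI impI)
    fix x assume "x \<in> UNIV - ?X"
    then obtain i j where ij: "\<not> (\<exists>N\<ge>1. \<exists>a. sublist (map x [i..j]) (compose_upto \<tau> N [a]))"
      by (auto simp: sadic_subshift_def)
    define n where "n = nat (\<bar>i\<bar> + \<bar>j\<bar>)"
    have "disjnt ?X (mball x ((1 / 2) ^ n))"
      unfolding disjnt_iff
    proof (intro allI notI)
      fix y assume y: "y \<in> ?X \<and> y \<in> mball x ((1 / 2) ^ n)"
      then have xy: "\<And>k. \<bar>k\<bar> \<le> int n \<Longrightarrow> x k = y k"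
        by (auto simp: mball_def shift_dist_less_iff)
      have "x k = y k" if "i \<le> k" "k \<le> j" for k
        by (rule xy) (use that in \<open>simp add: n_def\<close>)
      then have eq: "map x [i..j] = map y [i..j]" by simp
      have "\<exists>N\<ge>1. \<exists>a. sublist (map y [i..j]) (compose_upto \<tau> N [a])"
        using y unfolding sadic_subshift_def by blast
      then show False using ij unfolding eq by contradiction
    qed
    then show "\<exists>r>0. disjnt ?X (mball x r)" by (intro exI[of _ "(1 / 2) ^ n"]) auto
  qed auto
  then have "compactin mtopology ?X"
    using comp by (rule closedin_compact_space[rotated])
  then have c: "compact_space (Metric_space.mtopology ?X shift_dist)"
    by (simp add: sub compact_space_subtopology)
  let ?S = "\<lambda>(x :: int \<Rightarrow> 'a) n. x (n - 1)"
  have "homeomorphic_maps mtopology mtopology shift ?S"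
    unfolding homeomorphic_maps_def mtopology_shift_dist
    by (auto simp: shift_def continuous_map_componentwise_UNIV
        intro!: continuous_map_product_projection)
  then have h: "homeomorphic_map mtopology mtopology shift"
    using homeomorphic_maps_map by blast
  have "shift x \<in> UNIV \<inter> ?X \<longleftrightarrow> x \<in> UNIV \<inter> ?X" for x
    by (simp add: shift_in_sadic_subshift_iff)
  then have "homeomorphic_map (subtopology mtopology ?X) (subtopology mtopology ?X) shift"
    using homeomorphic_map_subtopologies_alt[OF h, of ?X ?X]
    by (auto simp: shift_in_sadic_subshift_iff)
  then show ?thesis
    using c by (simp add: compact_system_def sub Metric_space_shift_dist)
qed

end

theory Submission
  imports Defs
begin

text \<open>
  If two words \<open>u\<close>, \<open>v\<close> do not commute, there is a word \<open>z\<close> such that every long enough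
  concatenation of \<open>u\<close>'s and \<open>v\<close>'s has prefix \<open>z\<close>, and its next letter tells whether it starts
  with \<open>u\<close> or with \<open>v\<close>. Hence two points that are parsed by \<open>u\<close> and \<open>v\<close>, have a common past
  and a synchronized parse of it, diverge exactly \<open>|z|\<close> letters after a cut.

  In (i) this applies to the images of the two letters under \<open>\<tau>\<^sub>0 \<circ> \<dots> \<circ> \<tau>\<^bsub>N-1\<^esub>\<close>: two parses of
  the same past without common cuts would make long factors periodic. So all right special
  pasts end with \<open>z\<close> preceded by one of two blocks; if both blocks are long, among three such
  pasts two coincide. If one block stays short, its runs and \<open>z\<close> are of bounded length, and all
  special pasts agree up to a bounded shift.

  In (ii) the cuts are given by the partitions, and the past of a cut at level \<open>n\<close> is determined
  up to a distance that grows with \<open>n\<close>, because the bases shrink to a point. So any two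
  asymptotic pairs are asymptotic to each other after a shift, and a limit of pairs that
  diverge at a cut of level \<open>n\<close> is asymptotic. If the words of the two towers commute at
  arbitrarily high levels, all levels are periodic and the system has rank one.
\<close>

section \<open>Parses by two words\<close>

text \<open>Nothing makes the parses of (i) unique: a parse by the words \<open>W N l\<close> is
  only a compactness limit of parses of windows, and two points with a common past may be parsed out
  of phase. Therefore \<open>common_cut\<close> works with arbitrary parses, and takes from
  aperiodicity only a bound, uniform over \<open>X\<close>, on the length of factors of small
  period. The same bound limits the runs of a short block. In (ii) the cuts are read off the points
  themselves. The difficulty there is that the level-\<open>n\<close> cut of a diverging pair may
  move to the left with \<open>n\<close>. Normalizing the first level-\<open>m0\<close> difference
  to time \<open>0\<close> puts this cut at \<open>- \<zeta> m0 n\<close>, and the additivity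
  \<open>\<zeta>_add\<close> keeps the divergence at each fixed level \<open>m\<close> at
  \<open>- \<zeta> m0 m\<close>, whatever \<open>n\<close> is; so limits over \<open>n\<close> can
  be taken. When every level is periodic the system is an odometer, and the points in phase with a
  fixed point form the base of a single tower.\<close>

definition marks :: "'b list \<Rightarrow> 'b \<Rightarrow> 'b \<Rightarrow> 'b list \<Rightarrow> 'b list \<Rightarrow> bool" where
  "marks z \<alpha> \<beta> u v \<longleftrightarrow> \<alpha> \<noteq> \<beta> \<and> prefix (z @ [\<alpha>]) (u @ z) \<and> prefix (z @ [\<beta>]) (v @ z)"

lemma marks_sym: "marks z \<alpha> \<beta> u v \<Longrightarrow> marks z \<beta> \<alpha> v u"
  by (auto simp: marks_def)

text \<open>A step of Euclid's algorithm read backwards: cancelling the common prefix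
  \<open>u\<close> of \<open>u\<close> and \<open>u @ v\<close> leaves the pair \<open>u\<close>,
  \<open>v\<close>, and the marker grows by exactly this prefix.\<close>

lemma marks_extend:
  assumes "marks z \<alpha> \<beta> u v"
  shows "marks (u @ z) \<alpha> \<beta> u (u @ v)"
proof -
  obtain r where r: "u @ z = z @ [\<alpha>] @ r" using assms by (auto simp: marks_def prefix_def)
  obtain r' where r': "v @ z = z @ [\<beta>] @ r'" using assms by (auto simp: marks_def prefix_def)
  obtain r'' where r'': "v @ u @ z = z @ [\<beta>] @ r''"
    using r' r by (metis append_assoc)
  have "u @ u @ z = (u @ z) @ [\<alpha>] @ r" "(u @ v) @ u @ z = (u @ z) @ [\<beta>] @ r''"
    using r r'' by simp_all
  then show ?thesis using assms unfolding marks_def prefix_def by (metis append_assoc)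
qed

text \<open>Euclid's algorithm on words: as long as one word is a prefix of the other, it is
  stripped off. Commutation is neither created nor lost, so the process stops at two words that
  differ at some letter; their common prefix is the initial marker.\<close>

lemma ex_marks:
  assumes "u @ v \<noteq> v @ u"
  shows "\<exists>z \<alpha> \<beta>. marks z \<alpha> \<beta> u v"
  using assms
proof (induction "length u + length v" arbitrary: u v rule: less_induct)
  case less
  consider "u \<parallel> v" | v' where "v = u @ v'" | u' where "u = v @ u'"
    by (auto simp: prefix_def parallel_def)
  then show ?case
  proof cases
    case 1
    then obtain as b bs c cs where "b \<noteq> c" "u = as @ b # bs" "v = as @ c # cs"
      using parallel_decomp by blast
    then have "marks as b c u v" by (auto simp: marks_def)
    then show ?thesis by blast
  next
    case 2
    \<comment> \<open>The stripped word is nonempty because the empty word commutes with every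
      word.\<close>
    then have "length u + length v' < length u + length v" "u @ v' \<noteq> v' @ u"
      using less.prems by (cases u; auto)+
    from less.hyps[OF this] obtain z \<alpha> \<beta> where "marks z \<alpha> \<beta> u v'" by blast
    from marks_extend[OF this] show ?thesis unfolding 2 by blast
  next
    case 3
    then have "length v + length u' < length u + length v" "v @ u' \<noteq> u' @ v"
      using less.prems by (cases v; auto)+
    from less.hyps[OF this] obtain z \<alpha> \<beta> where "marks z \<alpha> \<beta> v u'" by blast
    from marks_sym[OF marks_extend[OF this]] show ?thesis unfolding 3 by blast
  qed
qed

text \<open>\<open>g c = Some l\<close> says that a block \<open>W l\<close> starts at position \<open>c\<close> of \<open>s\<close>.\<close>

definition parse :: "('l \<Rightarrow> 'b list) \<Rightarrow> (int \<Rightarrow> 'b) \<Rightarrow> (int \<Rightarrow> 'l option) \<Rightarrow> bool" where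
  "parse W s g \<longleftrightarrow>
     (\<forall>c l. g c = Some l \<longrightarrow> W l \<noteq> [] \<and> (\<forall>j<length (W l). s (c + int j) = W l ! j) \<and>
            g (c + int (length (W l))) \<noteq> None)"

lemma marks_nth:
  assumes "marks z \<alpha> \<beta> u v" "w = u \<or> w = v" "j < length z"
  shows "z ! j = (w @ z) ! j"
  using assms unfolding marks_def prefix_def
  by (metis append_assoc nth_append)

lemma marks_nth_length:
  assumes "marks z \<alpha> \<beta> u v"
  shows "(u @ z) ! length z = \<alpha>" "(v @ z) ! length z = \<beta>"
  using assms unfolding marks_def prefix_def
  by (metis append_assoc nth_append_length append_Cons)+

text \<open>The marker may be longer than the following block. It is a prefix of every block
  followed by the marker, so the induction on the offset hands the rest of it over to the next
  cut.\<close>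

lemma parse_nth:
  assumes p: "parse W s g" and m: "marks z \<alpha> \<beta> (W a) (W b)" and r: "ran g \<subseteq> {a, b}"
  shows "g c = Some l \<Longrightarrow> j < length (W l) + length z \<Longrightarrow> s (c + int j) = (W l @ z) ! j"
proof (induction j arbitrary: c l rule: less_induct)
  case (less j)
  show ?case
  proof (cases "j < length (W l)")
    case True
    then show ?thesis using p less.prems by (auto simp: parse_def nth_append)
  next
    case False
    obtain l' where l': "g (c + int (length (W l))) = Some l'"
      using p less.prems(1) unfolding parse_def by blast
    have "W l \<noteq> []" using p less.prems by (auto simp: parse_def)
    then have "s (c + int (length (W l)) + int (j - length (W l))) = (W l' @ z) ! (j - length (W l))"
      using False less.prems by (intro less.IH[OF _ l']) (auto, cases "W l", auto)
    moreover have "W l' = W a \<or> W l' = W b" using l' r by (auto simp: ran_def)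
    then have "z ! (j - length (W l)) = (W l' @ z) ! (j - length (W l))"
      using False less.prems by (intro marks_nth[OF m]) auto
    ultimately show ?thesis using False by (simp add: nth_append of_nat_diff)
  qed
qed

lemma parse_marker:
  assumes p: "parse W s g" and m: "marks z \<alpha> \<beta> (W a) (W b)" and r: "ran g \<subseteq> {a, b}"
    and c: "g c \<noteq> None"
  shows "j < length z \<Longrightarrow> s (c + int j) = z ! j"
    and "s (c + int (length z)) = (if g c = Some a then \<alpha> else \<beta>)"
proof -
  obtain l where l: "g c = Some l" using c by auto
  have n: "W l \<noteq> []" using p l by (auto simp: parse_def)
  have l': "l = a \<or> l = b" using l r by (auto simp: ran_def)
  show "s (c + int j) = z ! j" if "j < length z"
    using parse_nth[OF p m r l, of j] marks_nth[OF m, of "W l" j] that l' by auto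
  have "s (c + int (length z)) = (W l @ z) ! length z"
    using parse_nth[OF p m r l, of "length z"] n by simp
  then show "s (c + int (length z)) = (if g c = Some a then \<alpha> else \<beta>)"
    using marks_nth_length[OF m] l l' by auto
qed

lemma nth_concat_replicate:
  "j < m * length w \<Longrightarrow> concat (replicate m w) ! j = w ! (j mod length w)"
proof (induction m arbitrary: j)
  case (Suc m)
  show ?case
  proof (cases "j < length w")
    case False
    then show ?thesis using Suc by (simp add: nth_append le_mod_geq)
  qed (simp add: nth_append)
qed simp

text \<open>Commuting words are powers of one word, so from any cut on a parse reads a power of that
  word. The period depends only on \<open>W\<close>, which gives one period for all points of a
  system.\<close>

lemma parse_commuting_periodic:
  assumes "W a @ W b = W b @ W a" "W a \<noteq> []" "W b \<noteq> []"
  shows "\<exists>h\<ge>1. \<forall>s g c. parse W s g \<longrightarrow> ran g \<subseteq> {a, b} \<longrightarrow> g c \<noteq> None \<longrightarrow>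
           (\<forall>i\<ge>c. s (i + int h) = s i)"
proof -
  obtain m n w where w: "concat (replicate m w) = W a" "concat (replicate n w) = W b"
    using comm_append_are_replicate[OF assms(1)] by blast
  have w0: "w \<noteq> []" using w(1) assms(2) by auto
  have *: "s (c + int j) = w ! (j mod length w)"
    if p: "parse W s g" and r: "ran g \<subseteq> {a, b}" and "g c \<noteq> None" for s g c j
    using that(3)
  proof (induction j arbitrary: c rule: less_induct)
    case (less j)
    then obtain l where l: "g c = Some l" by auto
    have "l = a \<or> l = b" using r ranI[of g c l] l by blast
    then obtain k where k: "W l = concat (replicate k w)" using w by metis
    have len: "length (W l) = k * length w"
      unfolding k by (induction k) auto
    have pl: "W l \<noteq> []" "\<And>j. j < length (W l) \<Longrightarrow> s (c + int j) = W l ! j"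
      "g (c + int (length (W l))) \<noteq> None"
      using p l unfolding parse_def by blast+
    show ?case
    proof (cases "j < length (W l)")
      case True
      then show ?thesis using pl(2)[OF True] nth_concat_replicate[of j k w] len k by simp
    next
      case False
      have "s (c + int (length (W l)) + int (j - length (W l))) = w ! ((j - length (W l)) mod length w)"
        using pl False by (intro less.IH) (auto, cases "W l", auto)
      moreover have "(j - length (W l)) mod length w = j mod length w"
        using False unfolding len by (metis add_diff_inverse_nat mod_mult_self2 add.commute mult.commute)
      ultimately show ?thesis using False by simp
    qed
  qed
  have "s (i + int (length w)) = s i"
    if "parse W s g" "ran g \<subseteq> {a, b}" "g c \<noteq> None" "i \<ge> c" for s g c i
    using *[OF that(1-3), of "nat (i - c)"] *[OF that(1-3), of "nat (i - c) + length w"] that(4)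
    by (simp add: algebra_simps)
  then show ?thesis using w0 by (intro exI[of _ "length w"]) (auto simp: Suc_le_eq)
qed

section \<open>Two-sided iteration and asymptotic components\<close>

locale bijective_system =
  fixes X :: "'x set" and d :: "'x \<Rightarrow> 'x \<Rightarrow> real" and T :: "'x \<Rightarrow> 'x"
  assumes metric: "Metric_space X d" and bij: "bij_betw T X X"
begin

abbreviation itr :: "int \<Rightarrow> 'x \<Rightarrow> 'x" where "itr \<equiv> int_iter X T"

lemma T_in [simp]: "x \<in> X \<Longrightarrow> T x \<in> X"
  using bij by (auto simp: bij_betw_def)

lemma inv_T_in: "x \<in> X \<Longrightarrow> inv_into X T x \<in> X"
  using bij by (metis bij_betw_def inv_into_into)

lemma T_inv_T: "x \<in> X \<Longrightarrow> T (inv_into X T x) = x"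
  using bij by (metis bij_betw_def f_inv_into_f)

lemma T_eq_iff: "x \<in> X \<Longrightarrow> y \<in> X \<Longrightarrow> T x = T y \<longleftrightarrow> x = y"
  using bij by (auto simp: bij_betw_def inj_on_def)

lemma funpow_in: "x \<in> X \<Longrightarrow> (T ^^ n) x \<in> X"
  by (induction n) auto

lemma inv_funpow_in: "x \<in> X \<Longrightarrow> (inv_into X T ^^ n) x \<in> X"
  by (induction n) (auto intro: inv_T_in)

lemma itr_in [simp]: "x \<in> X \<Longrightarrow> itr k x \<in> X"
  by (simp add: int_iter_def funpow_in inv_funpow_in)

lemma itr_0 [simp]: "itr 0 x = x"
  by (simp add: int_iter_def)

lemma T_itr: assumes "x \<in> X" shows "T (itr k x) = itr (k + 1) x"
proof (cases "k \<ge> 0")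
  case True
  then show ?thesis by (simp add: int_iter_def nat_add_distrib)
next
  case False
  define n where "n = nat (- k - 1)"
  have k: "k = - int (Suc n)" using False by (simp add: n_def)
  have "T (itr k x) = (inv_into X T ^^ n) x"
    using assms by (simp add: k int_iter_def T_inv_T inv_funpow_in nat_add_distrib)
  also have "\<dots> = itr (k + 1) x"
    by (cases n) (simp_all add: int_iter_def k nat_add_distrib)
  finally show ?thesis .
qed

lemma itr_add: assumes "x \<in> X" shows "itr (i + j) x = itr i (itr j x)"
proof (induction i rule: int_induct[where k = 0])
  case (step1 i)
  then show ?case
    using T_itr[OF assms, of "i + j"] T_itr[of "itr j x" i] assms by (simp add: algebra_simps)
next
  case (step2 i)
  have "T (itr (i - 1 + j) x) = T (itr (i - 1) (itr j x))"
    using T_itr[OF assms, of "i - 1 + j"] T_itr[of "itr j x" "i - 1"] assms step2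
    by (simp add: algebra_simps)
  then show ?case using assms by (simp add: T_eq_iff)
qed simp

lemma itr_of_nat: "itr (int n) x = (T ^^ n) x"
  by (simp add: int_iter_def)

lemma itr_minus_itr [simp]: "x \<in> X \<Longrightarrow> itr (- k) (itr k x) = x"
  using itr_add[of x "- k" k] by simp

lemma itr_itr_minus [simp]: "x \<in> X \<Longrightarrow> itr k (itr (- k) x) = x"
  using itr_add[of x k "- k"] by simp

lemma orbit_itr: assumes "x \<in> X" shows "orbit X T (itr k x) = orbit X T x"
proof -
  have "(\<lambda>i. itr i (itr k x)) = (\<lambda>j. itr j x) \<circ> (\<lambda>i. i + k)"
    by (simp add: fun_eq_iff itr_add[OF assms])
  then have "orbit X T (itr k x) = (\<lambda>j. itr j x) ` range (\<lambda>i. i + k)"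
    by (simp only: orbit_def image_comp)
  also have "range (\<lambda>i. i + k) = UNIV"
    by (metis surj_def diff_add_cancel)
  finally show ?thesis by (simp add: orbit_def)
qed

lemma self_in_orbit: "x \<in> orbit X T x"
  unfolding orbit_def by (rule range_eqI[of _ _ 0]) simp

text \<open>The sequence of distances is only reindexed: a positive \<open>k\<close> prepends terms,
  a negative one drops terms.\<close>

lemma asymptotic_itr:
  assumes "x \<in> X" "y \<in> X" "asymptotic X d T x y"
  shows "asymptotic X d T (itr k x) (itr k y)"
proof -
  let ?f = "\<lambda>n. d (itr (- int n) x) (itr (- int n) y)"
  let ?g = "\<lambda>n. d (itr (- int n) (itr k x)) (itr (- int n) (itr k y))"
  have f: "?f \<longlonglongrightarrow> 0" using assms by (simp add: asymptotic_def)
  have g: "?g n = d (itr (k - int n) x) (itr (k - int n) y)" for n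
    using assms by (simp add: itr_add[symmetric] algebra_simps)
  show ?thesis
  proof (cases "k \<ge> 0")
    case True
    have "?g (n + nat k) = ?f n" for n using True unfolding g by simp
    then show ?thesis unfolding asymptotic_def
      using f LIMSEQ_offset[of ?g "nat k"] by simp
  next
    case False
    have "?f (n + nat (- k)) = ?g n" for n using False unfolding g by simp
    then show ?thesis unfolding asymptotic_def
      using f LIMSEQ_ignore_initial_segment[of ?f 0 "nat (- k)"] by simp
  qed
qed

lemma asymptotic_sym: "asymptotic X d T x y \<Longrightarrow> asymptotic X d T y x"
  using Metric_space.commute[OF metric] by (simp add: asymptotic_def)

lemma asymptotic_refl: "x \<in> X \<Longrightarrow> asymptotic X d T x x"
  using Metric_space.mdist_zero[OF metric] by (simp add: asymptotic_def)

lemma asymptotic_trans: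
  assumes "x \<in> X" "y \<in> X" "z \<in> X" "asymptotic X d T x y" "asymptotic X d T y z"
  shows "asymptotic X d T x z"
proof -
  interpret Metric_space X d by (rule metric)
  have "(\<lambda>n. d (itr (- int n) x) (itr (- int n) y) + d (itr (- int n) y) (itr (- int n) z))
      \<longlonglongrightarrow> 0 + 0"
    using assms unfolding asymptotic_def by (intro tendsto_add) auto
  then have "(\<lambda>n. d (itr (- int n) x) (itr (- int n) y) + d (itr (- int n) y) (itr (- int n) z))
      \<longlonglongrightarrow> 0" by simp
  then show ?thesis unfolding asymptotic_def
    by (rule tendsto_sandwich[OF _ _ tendsto_const, rotated 2]) (use assms triangle in auto)
qed

text \<open>By \<open>asymptotic_itr\<close> a common iterate can be undone, so only a relative
  shift remains.\<close>

lemma asymptotic_orbits_iff: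
  assumes "x \<in> X" "y \<in> X"
  shows "(orbit X T x, orbit X T y) \<in> asymptotic_orbits X d T \<longleftrightarrow>
         (\<exists>k. asymptotic X d T x (itr k y))"
proof
  assume "(orbit X T x, orbit X T y) \<in> asymptotic_orbits X d T"
  then obtain i j where "asymptotic X d T (itr i x) (itr j y)"
    by (auto simp: asymptotic_orbits_def orbit_def)
  from asymptotic_itr[OF _ _ this, of "- i"]
  have "asymptotic X d T x (itr (- i + j) y)"
    using assms by (simp add: itr_add[symmetric])
  then show "\<exists>k. asymptotic X d T x (itr k y)" by blast
next
  assume "\<exists>k. asymptotic X d T x (itr k y)"
  then obtain k where "asymptotic X d T x (itr k y)" by blast
  then have "\<exists>x'\<in>orbit X T x. \<exists>y'\<in>orbit X T y. asymptotic X d T x' y'"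
    using self_in_orbit[of x] by (intro bexI[of _ x] bexI[of _ "itr k y"]) (auto simp: orbit_def)
  then show "(orbit X T x, orbit X T y) \<in> asymptotic_orbits X d T"
    using assms by (simp add: asymptotic_orbits_def orbits_def)
qed

lemma equiv_asymptotic_orbits: "equiv (orbits X T) (asymptotic_orbits X d T)"
proof (rule equivI)
  show "asymptotic_orbits X d T \<subseteq> orbits X T \<times> orbits X T"
    by (auto simp: asymptotic_orbits_def)
  show "refl_on (orbits X T) (asymptotic_orbits X d T)"
  proof (rule refl_onI)
    fix P assume "P \<in> orbits X T"
    then obtain x where "x \<in> X" "P = orbit X T x" by (auto simp: orbits_def)
    then show "(P, P) \<in> asymptotic_orbits X d T"
      using asymptotic_refl[of x] by (auto simp: asymptotic_orbits_iff intro!: exI[of _ 0])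
  qed
  show "sym (asymptotic_orbits X d T)"
    by (rule symI) (auto simp: asymptotic_orbits_def dest: asymptotic_sym)
  show "trans (asymptotic_orbits X d T)"
  proof (rule transI)
    fix P Q R
    assume PQ: "(P, Q) \<in> asymptotic_orbits X d T" and QR: "(Q, R) \<in> asymptotic_orbits X d T"
    then obtain x y z where eq: "P = orbit X T x" "Q = orbit X T y" "R = orbit X T z"
      and X: "x \<in> X" "y \<in> X" "z \<in> X"
      by (auto simp: asymptotic_orbits_def orbits_def)
    obtain i j where xy: "asymptotic X d T x (itr i y)" and yz: "asymptotic X d T y (itr j z)"
      using PQ QR X unfolding eq by (auto simp: asymptotic_orbits_iff)
    have "asymptotic X d T x (itr i (itr j z))"
      using asymptotic_trans[OF _ _ _ xy asymptotic_itr[OF _ _ yz, of i]] X by simp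
    then have "asymptotic X d T x (itr (i + j) z)"
      using X by (simp add: itr_add)
    then show "(P, R) \<in> asymptotic_orbits X d T"
      using X unfolding eq by (auto simp: asymptotic_orbits_iff)
  qed
qed

lemma asymptotic_componentE:
  assumes "C \<in> asymptotic_components X d T"
  obtains x y where "x \<in> X" "y \<in> X" "x \<noteq> y" "asymptotic X d T x y" "orbit X T x \<in> C"
proof -
  obtain P Q where PQ: "P \<in> C" "Q \<in> C" "P \<noteq> Q" and C: "C \<in> orbits X T // asymptotic_orbits X d T"
    using assms by (auto simp: asymptotic_components_def)
  have r: "(P, Q) \<in> asymptotic_orbits X d T"
    using quotient_eq_iff[OF equiv_asymptotic_orbits C C PQ(1,2)] by simp
  then obtain x y where eq: "P = orbit X T x" "Q = orbit X T y" and X: "x \<in> X" "y \<in> X"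
    by (auto simp: asymptotic_orbits_def orbits_def)
  obtain k where k: "asymptotic X d T x (itr k y)"
    using r X unfolding eq by (auto simp: asymptotic_orbits_iff)
  have "x \<noteq> itr k y"
    using PQ(3) orbit_itr[OF X(2), of k] unfolding eq by auto
  then show ?thesis using that[OF X(1) _ _ k] X PQ(1) by (simp add: eq)
qed

lemma asymptotic_component_eqI:
  assumes C: "C \<in> asymptotic_components X d T" "D \<in> asymptotic_components X d T"
    and x: "x \<in> X" "orbit X T x \<in> C" and y: "y \<in> X" "orbit X T y \<in> D"
    and xy: "asymptotic X d T (itr i x) (itr j y)"
  shows "C = D"
proof -
  have "(orbit X T (itr i x), orbit X T (itr j y)) \<in> asymptotic_orbits X d T"
    using x y xy by (subst asymptotic_orbits_iff) (auto intro!: exI[of _ 0])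
  then have "(orbit X T x, orbit X T y) \<in> asymptotic_orbits X d T"
    using x y by (simp add: orbit_itr)
  moreover have "C \<in> orbits X T // asymptotic_orbits X d T" "D \<in> orbits X T // asymptotic_orbits X d T"
    using C by (auto simp: asymptotic_components_def)
  ultimately show ?thesis
    using quotient_eqI[OF equiv_asymptotic_orbits] x y by blast
qed

lemma asymptotic_componentI:
  assumes "x \<in> X" "y \<in> X" "asymptotic X d T x y" "orbit X T x \<noteq> orbit X T y"
  shows "asymptotic_orbits X d T `` {orbit X T x} \<in> asymptotic_components X d T"
proof -
  have "(orbit X T x, orbit X T z) \<in> asymptotic_orbits X d T" if "z = x \<or> z = y" for z
    using that assms(1-3) asymptotic_refl[OF assms(1)] asymptotic_orbits_iff[of x z]
    by (metis itr_0)
  then have "orbit X T x \<in> asymptotic_orbits X d T `` {orbit X T x}"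
    "orbit X T y \<in> asymptotic_orbits X d T `` {orbit X T x}" by auto
  moreover have "asymptotic_orbits X d T `` {orbit X T x} \<in> orbits X T // asymptotic_orbits X d T"
    using assms by (intro quotientI) (simp add: orbits_def)
  ultimately show ?thesis
    using assms(4) unfolding asymptotic_components_def by blast
qed

end

lemma bijective_system_if_compact_system:
  assumes "compact_system X d T"
  shows "bijective_system X d T"
proof -
  interpret Metric_space X d using assms by (simp add: compact_system_def)
  have "homeomorphic_map mtopology mtopology T" using assms by (simp add: compact_system_def)
  then show ?thesis
    by unfold_locales (metis bij_betw_def homeomorphic_imp_injective_map
        homeomorphic_imp_surjective_map topspace_mtopology)
qed

section \<open>Synchronization of parses\<close>

text \<open>\<open>parse\<close> propagates cuts to the right only. Propagation to the left is a
  separate notion because the tower cuts of (ii) are followed to the right only.\<close>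

definition left_extends :: "('l \<Rightarrow> 'b list) \<Rightarrow> (int \<Rightarrow> 'l option) \<Rightarrow> bool" where
  "left_extends W g \<longleftrightarrow> (\<forall>c. g c \<noteq> None \<longrightarrow> (\<exists>b. g (c - int (length (W b))) = Some b))"

text \<open>Cuts reach arbitrarily far to the left; the block at the last cut up to \<open>p\<close>
  must end after \<open>p\<close>, so this cut is within one block length of
  \<open>p\<close>.\<close>

lemma parse_cut_near:
  assumes p: "parse W s g" and e: "left_extends W g" and c: "g c0 \<noteq> None"
    and m: "\<And>l. length (W l) \<le> m"
  shows "\<exists>c. p - int m < c \<and> c \<le> p \<and> g c \<noteq> None"
proof -
  have low: "\<exists>c. c \<le> c0 - int k \<and> g c \<noteq> None" for k
  proof (induction k)
    case (Suc k)
    then obtain c where ck: "c \<le> c0 - int k" "g c \<noteq> None" by auto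
    then obtain b where b: "g (c - int (length (W b))) = Some b"
      using e by (auto simp: left_extends_def)
    then have "W b \<noteq> []" using p by (auto simp: parse_def)
    then have "0 < length (W b)" by simp
    then have "c - int (length (W b)) \<le> c0 - int (Suc k)" using ck(1) by linarith
    then show ?case using b by (intro exI[of _ "c - int (length (W b))"]) auto
  qed (use c in auto)
  have "c0 - int (nat (c0 - p)) \<le> p" by simp
  then obtain c1 where c1: "c1 \<le> p" "g c1 \<noteq> None"
    using low[of "nat (c0 - p)"] order_trans by blast
  define S where "S = {c. c1 \<le> c \<and> c \<le> p \<and> g c \<noteq> None}"
  have "finite S" by (rule finite_subset[of _ "{c1..p}"]) (auto simp: S_def)
  moreover have "c1 \<in> S" using c1 by (simp add: S_def)
  ultimately have M: "Max S \<in> S" "\<And>c. c \<in> S \<Longrightarrow> c \<le> Max S" by (auto intro: Max_in)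
  then obtain l where l: "g (Max S) = Some l" by (auto simp: S_def)
  have nx: "W l \<noteq> []" "g (Max S + int (length (W l))) \<noteq> None"
    using p l unfolding parse_def by blast+
  have "\<not> Max S + int (length (W l)) \<le> p"
  proof
    assume "Max S + int (length (W l)) \<le> p"
    then have "Max S + int (length (W l)) \<in> S" using nx M(1) by (auto simp: S_def)
    from M(2)[OF this] show False using nx(1) by simp
  qed
  then show ?thesis
    using M(1) m[of l] by (intro exI[of _ "Max S"]) (auto simp: S_def)
qed

text \<open>The letter after the marker decides the label. So a single letter of period
  \<open>q\<close>, seen from two cuts at distance \<open>q\<close>, forces a whole block and its
  marker to have period \<open>q\<close>.\<close>

lemma parse_period_step:
  assumes p: "parse W s g" and m: "marks z \<alpha> \<beta> (W a) (W b)" and r: "ran g \<subseteq> {a, b}"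
    and c: "g c = Some l" "g (c + q) \<noteq> None"
    and per: "s (c + int (length z)) = s (c + int (length z) + q)"
  shows "g (c + q) = Some l"
    and "c \<le> k \<Longrightarrow> k < c + int (length (W l)) + int (length z) \<Longrightarrow> s (k + q) = s k"
proof -
  obtain l' where l': "g (c + q) = Some l'" using c by auto
  have ab: "l \<in> {a, b}" "l' \<in> {a, b}" using c(1) l' r by (auto simp: ran_def)
  have "\<alpha> \<noteq> \<beta>" using m by (simp add: marks_def)
  then have "(l = a) = (l' = a)"
    using parse_marker(2)[OF p m r, of c] parse_marker(2)[OF p m r, of "c + q"] c l' per
    by (auto simp: algebra_simps split: if_splits)
  then show q: "g (c + q) = Some l" using ab l' by auto
  assume k: "c \<le> k" "k < c + int (length (W l)) + int (length z)"
  then show "s (k + q) = s k"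
    using parse_nth[OF p m r c(1), of "nat (k - c)"] parse_nth[OF p m r q, of "nat (k - c)"]
    by (simp add: algebra_simps nat_less_iff)
qed

text \<open>
  If the two parses had no common cut, the block at the lagging cut would be read off the
  letters already covered by the leading one, so the pair of parses would evolve
  deterministically and \<open>s\<close> would have a long factor of bounded period.
\<close>

lemma common_cut:
  fixes s t :: "int \<Rightarrow> 'b::finite" and g h :: "int \<Rightarrow> 'l::finite option"
  assumes p: "parse W s g" "left_extends W g" "ran g \<subseteq> {a, b}" "g c0 \<noteq> None"
    and p': "parse W t h" "left_extends W h" "ran h \<subseteq> {a, b}" "h d0 \<noteq> None"
    and m: "marks z \<alpha> \<beta> (W a) (W b)"
    and st: "\<And>i. i < 0 \<Longrightarrow> s i = t i"
    and np: "\<And>Q. \<exists>n. \<forall>i q. 1 \<le> q \<longrightarrow> q \<le> Q \<longrightarrow> (\<exists>j<n. s (i + int j) \<noteq> s (i + int j + int q))"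
  shows "\<exists>c\<le>e. g c \<noteq> None \<and> h c \<noteq> None"
proof (rule ccontr)
  assume no0: "\<not> ?thesis"
  define M where "M = Max (range (\<lambda>l. length (W l)))"
  have M: "length (W l) \<le> M" for l unfolding M_def by (intro Max_ge) auto
  define Z where "Z = int (length z)"
  \<comment> \<open>This margin puts every block and marker that is read below at negative
    positions, where \<open>t\<close> equals \<open>s\<close>; so the periodicity of
    \<open>s\<close> also serves the parse \<open>h\<close>.\<close>
  define e' where "e' = min e (- int M - Z - 1)"
  have no: "\<not> (g c \<noteq> None \<and> h c \<noteq> None)" if "c \<le> e'" for c
    using that no0 by (auto simp: e'_def)
  \<comment> \<open>The radius covers a nearest cut of each parse, less than \<open>M\<close> to the
    left of \<open>i\<close>, and the markers after these cuts.\<close>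
  define R where "R = int M + Z + 1"
  define st where "st = (\<lambda>i. map (\<lambda>k. (s k, g k, h k)) [i - R..i + R])"
  define F where "F = {xs :: ('b \<times> 'l option \<times> 'l option) list. set xs \<subseteq> UNIV \<and> length xs = nat (2 * R + 1)}"
  have fF: "finite F" unfolding F_def by (rule finite_lists_length_eq) simp
  define Q where "Q = card F"
  obtain n where n: "\<And>i q. 1 \<le> q \<Longrightarrow> q \<le> Q \<Longrightarrow> \<exists>j<n. s (i + int j) \<noteq> s (i + int j + int q)"
    using np[of Q] by blast
  \<comment> \<open>Room for the repetition within \<open>Q\<close> positions, for \<open>n\<close>
    periodic letters after it and for a further translation by \<open>q \<le> Q\<close>, all to the
    left of \<open>e'\<close>.\<close>
  define i0 where "i0 = e' - int n - 2 * int Q - 1"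
  have "st ` {i0..i0 + int Q} \<subseteq> F" by (auto simp: st_def F_def)
  then have "card (st ` {i0..i0 + int Q}) \<le> Q" unfolding Q_def by (rule card_mono[OF fF])
  \<comment> \<open>There are \<open>Q + 1\<close> positions and at most \<open>Q\<close>
    windows.\<close>
  then have "\<not> inj_on st {i0..i0 + int Q}" by (intro pigeonhole) simp
  then obtain i i' where ii: "i0 \<le> i" "i < i'" "i' \<le> i0 + int Q" "st i = st i'"
    unfolding inj_on_def by (metis atLeastAtMost_iff linorder_neqE)
  define q where "q = nat (i' - i)"
  have q: "1 \<le> q" "q \<le> Q" "i' = i + int q" using ii by (auto simp: q_def)
  have win: "(s k, g k, h k) = (s (k + int q), g (k + int q), h (k + int q))"
    if "i - R \<le> k" "k \<le> i + R" for k
  proof -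
    have "st i ! nat (k - (i - R)) = st i' ! nat (k - (i - R))" using ii(4) by simp
    then show ?thesis using that q(3) by (simp add: st_def nth_map algebra_simps)
  qed
  obtain c1 where c1: "i - int M < c1" "c1 \<le> i" "g c1 \<noteq> None"
    using parse_cut_near[OF p(1,2,4) M] by blast
  obtain d1 where d1: "i - int M < d1" "d1 \<le> i" "h d1 \<noteq> None"
    using parse_cut_near[OF p'(1,2,4) M] by blast
  have Z0: "Z \<ge> 0" by (simp add: Z_def)
  \<comment> \<open>The invariant of the evolution: both cuts recur after \<open>q\<close> letters,
    and \<open>s\<close> has period \<open>q\<close> up to the end of the marker at the leading
    cut.\<close>
  define good where "good = (\<lambda>c d. g c \<noteq> None \<and> g (c + int q) \<noteq> None \<and> h d \<noteq> None \<and>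
      h (d + int q) \<noteq> None \<and> i - int M < c \<and> i - int M < d \<and>
      (\<forall>k. i - int M \<le> k \<longrightarrow> k < max c d + Z \<longrightarrow> s (k + int q) = s k))"
  have step: "\<exists>c' d'. good c' d' \<and> c + d < c' + d'"
    if cd: "good c d" and le: "max c d + int q \<le> e'" for c d
  proof -
    have "c \<noteq> d" using no[of c] cd le q(1) by (auto simp: good_def)
    then consider "c < d" | "d < c" by linarith
    then show ?thesis
    proof cases
      case 1
      obtain l where l: "g c = Some l" using cd by (auto simp: good_def)
      \<comment> \<open>The deciding letter of the lagging cut \<open>c\<close> lies before the end
        of the marker at \<open>d\<close>, hence in the part known to be periodic.\<close>
      have per: "s (c + int (length z)) = s (c + int (length z) + int q)"
        using cd 1 Z0 by (auto simp: good_def Z_def)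
      note st = parse_period_step[OF p(1) m p(3) l _ per]
      have cq: "g (c + int q) \<noteq> None" using cd by (simp add: good_def)
      have W: "W l \<noteq> []" "g (c + int (length (W l))) \<noteq> None"
        "g (c + int q + int (length (W l))) \<noteq> None"
        using p(1) l st(1)[OF cq] unfolding parse_def by blast+
      have "good (c + int (length (W l))) d"
        using cd W 1 st(2)[OF cq] Z0 unfolding good_def Z_def[symmetric]
        by (auto simp: algebra_simps max_def split: if_splits)
      then show ?thesis using W(1) by (intro exI[of _ "c + int (length (W l))"] exI[of _ d]) auto
    next
      case 2
      obtain l where l: "h d = Some l" using cd by (auto simp: good_def)
      have neg: "t k = s k" "t (k + int q) = s (k + int q)" if "k \<le> d + int M + Z" for k
        using that 2 le Z0 by (intro st[symmetric]; simp add: e'_def)+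
      have per: "t (d + int (length z)) = t (d + int (length z) + int q)"
        using cd 2 Z0 neg[of "d + Z"] by (auto simp: good_def Z_def)
      note st = parse_period_step[OF p'(1) m p'(3) l _ per]
      have dq: "h (d + int q) \<noteq> None" using cd by (simp add: good_def)
      have W: "W l \<noteq> []" "h (d + int (length (W l))) \<noteq> None"
        "h (d + int q + int (length (W l))) \<noteq> None"
        using p'(1) l st(1)[OF dq] unfolding parse_def by blast+
      have sq: "s (k + int q) = s k" if "d \<le> k" "k < d + int (length (W l)) + Z" for k
        using st(2)[OF dq, of k] neg[of k] that M[of l] by (simp add: Z_def)
      have "good c (d + int (length (W l)))"
        using cd W 2 sq Z0 unfolding good_def
        by (auto simp: algebra_simps max_def split: if_splits)
      then show ?thesis using W(1) by (intro exI[of _ c] exI[of _ "d + int (length (W l))"]) auto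
    qed
  qed
  \<comment> \<open>Every step advances one of the two cuts by a nonempty block, so their sum
    measures the progress.\<close>
  have "\<exists>c d. good c d \<and> (max c d + int q > e' \<or> c + d \<ge> c1 + d1 + int K)" for K
  proof (induction K)
    case 0
    have "good c1 d1"
      using c1 d1 win Z0 unfolding good_def R_def by auto
    then show ?case by auto
  next
    case (Suc K)
    then obtain c d where "good c d" "max c d + int q > e' \<or> c + d \<ge> c1 + d1 + int K" by blast
    then show ?case using step[of c d]
      by (cases "max c d + int q > e'") (blast, force)
  qed
  \<comment> \<open>After this many steps \<open>c + d\<close> exceeds twice the absolute value of
    \<open>e'\<close>, so the larger cut is beyond \<open>e'\<close>.\<close>
  from this[of "nat (2 * \<bar>e'\<bar> + \<bar>c1\<bar> + \<bar>d1\<bar> + 1)"]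
  obtain c d where cd: "good c d" "max c d + int q > e'" using q(1) by fastforce
  have "s (i + int j + int q) = s (i + int j)" if "j < n" for j
    using cd that ii Z0 q unfolding good_def i0_def by auto
  then show False using n[OF q(1,2), of i] by metis
qed

text \<open>At the last common cut up to \<open>- |z|\<close> the labels differ, because equal
  labels would make the points agree at \<open>0\<close>. Different labels make the points differ
  \<open>|z|\<close> letters after that cut, which cannot happen before \<open>0\<close>.\<close>

lemma common_cut_diverges:
  assumes p: "parse W s g" "ran g \<subseteq> {a, b}" and p': "parse W t h" "ran h \<subseteq> {a, b}"
    and m: "marks z \<alpha> \<beta> (W a) (W b)"
    and st: "\<And>i. i < 0 \<Longrightarrow> s i = t i" and ne: "s 0 \<noteq> t 0"
    and c: "c \<le> - int (length z)" "g c \<noteq> None" "h c \<noteq> None"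
  shows "g (- int (length z)) \<noteq> None"
proof -
  define S where "S = {c'. c \<le> c' \<and> c' \<le> - int (length z) \<and> g c' \<noteq> None \<and> h c' \<noteq> None}"
  have "finite S" by (rule finite_subset[of _ "{c..- int (length z)}"]) (auto simp: S_def)
  moreover have "c \<in> S" using c by (simp add: S_def)
  ultimately have M: "Max S \<in> S" "\<And>c. c \<in> S \<Longrightarrow> c \<le> Max S" by (auto intro: Max_in)
  define e where "e = Max S"
  have e: "g e \<noteq> None" "h e \<noteq> None" "e \<le> - int (length z)" "c \<le> e"
    using M(1) by (auto simp: S_def e_def)
  then obtain l l' where l: "g e = Some l" and l': "h e = Some l'" by auto
  have pl: "W l \<noteq> []" "g (e + int (length (W l))) \<noteq> None"
    "\<And>j. j < length (W l) \<Longrightarrow> s (e + int j) = W l ! j"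
    using p(1) l unfolding parse_def by blast+
  have pl': "h (e + int (length (W l'))) \<noteq> None"
    "\<And>j. j < length (W l') \<Longrightarrow> t (e + int j) = W l' ! j"
    using p'(1) l' unfolding parse_def by blast+
  have "l \<noteq> l'"
  proof
    assume eq: "l = l'"
    define c' where "c' = e + int (length (W l))"
    have "c' \<notin> S" using M(2)[of c'] pl(1) by (auto simp: c'_def e_def)
    then have c': "- int (length z) < c'" using e pl pl' by (auto simp: S_def c'_def eq)
    show False
    proof (cases "c' \<le> 0")
      \<comment> \<open>Position \<open>0\<close> lies in the marker after the common cut
        \<open>c'\<close>.\<close>
      case True
      then have "nat (- c') < length z" using c' by linarith
      moreover have "g c' \<noteq> None" "h c' \<noteq> None" using pl(2) pl'(1) by (simp_all add: c'_def eq)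
      ultimately have "s (c' + int (nat (- c'))) = t (c' + int (nat (- c')))"
        using parse_marker(1)[OF p(1) m p(2), of c'] parse_marker(1)[OF p'(1) m p'(2), of c']
        by metis
      then show False using True ne by simp
    next
      \<comment> \<open>Position \<open>0\<close> lies in the common block that starts at
        \<open>e\<close>.\<close>
      case False
      then have "nat (- e) < length (W l)" using e(3) by (simp add: c'_def)
      then have "s (e + int (nat (- e))) = t (e + int (nat (- e)))"
        using pl(3) pl'(2) unfolding eq by metis
      then show False using e(3) ne by simp
    qed
  qed
  moreover have "\<alpha> \<noteq> \<beta>" using m by (simp add: marks_def)
  moreover have "l \<in> {a, b}" "l' \<in> {a, b}" using p(2) p'(2) l l' by (auto simp: ran_def)
  ultimately have "s (e + int (length z)) \<noteq> t (e + int (length z))"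
    using parse_marker(2)[OF p(1) m p(2) e(1)] parse_marker(2)[OF p'(1) m p'(2) e(2)] l l' by auto
  then have "e + int (length z) \<ge> 0" using st[of "e + int (length z)"] by linarith
  then have "e = - int (length z)" using e(3) by linarith
  then show ?thesis using e(1) by simp
qed

section \<open>Subshifts\<close>

text \<open>Compactness of a full shift, stated by windows. It is applied to points and also to
  parses, whose alphabet consists of optional labels.\<close>

lemma finite_alphabet_limit:
  fixes s :: "nat \<Rightarrow> int \<Rightarrow> 'f::finite"
  shows "\<exists>g. \<forall>m k0. \<exists>k\<ge>k0. \<forall>i. \<bar>i\<bar> \<le> int m \<longrightarrow> s k i = g i"
proof -
  interpret Metric_space "UNIV :: (int \<Rightarrow> 'f) set" shift_dist
    by (rule Metric_space_shift_dist)
  have "compact_space mtopology"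
    unfolding mtopology_shift_dist
    by (simp add: compact_space_product_topology compact_space_discrete_topology)
  then obtain g r where r: "strict_mono r" and lim: "limitin mtopology (s \<circ> r) g sequentially"
    unfolding compact_space_sequentially by (metis subset_UNIV)
  have "\<exists>k\<ge>k0. \<forall>i. \<bar>i\<bar> \<le> int m \<longrightarrow> s k i = g i" for m k0 :: nat
  proof -
    have "(1 / 2 :: real) ^ m > 0" by simp
    then obtain N where "\<And>n. n \<ge> N \<Longrightarrow> shift_dist (s (r n)) g < (1 / 2) ^ m"
      using lim unfolding limit_metric_sequentially by (metis comp_apply)
    then have "shift_dist (s (r (max N k0))) g < (1 / 2) ^ m" by simp
    moreover have "k0 \<le> r (max N k0)"
      using strict_mono_imp_increasing[OF r, of "max N k0"] by simp
    ultimately show ?thesis unfolding shift_dist_less_iff by blast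
  qed
  then show ?thesis by blast
qed

text \<open>Closedness and shift invariance in one condition: the place \<open>t\<close> at which
  the window of \<open>y\<close> occurs is free.\<close>

definition subshift :: "(int \<Rightarrow> 'a) set \<Rightarrow> bool" where
  "subshift X \<longleftrightarrow> (\<forall>y. (\<forall>n. \<exists>x\<in>X. \<exists>t. \<forall>i. \<bar>i\<bar> \<le> int n \<longrightarrow> x (i + t) = y i) \<longrightarrow> y \<in> X)"

lemma subshift_sadic_subshift: "subshift (sadic_subshift \<tau>)"
  unfolding subshift_def
proof (intro allI impI)
  fix y assume y: "\<forall>n. \<exists>x\<in>sadic_subshift \<tau>. \<exists>t. \<forall>i. \<bar>i\<bar> \<le> int n \<longrightarrow> x (i + t) = y i"
  have "\<exists>N\<ge>1. \<exists>a. sublist (map y [i..j]) (compose_upto \<tau> N [a])" for i j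
  proof -
    obtain x t where x: "x \<in> sadic_subshift \<tau>"
      and xy: "\<And>k. \<bar>k\<bar> \<le> int (nat (\<bar>i\<bar> + \<bar>j\<bar>)) \<Longrightarrow> x (k + t) = y k"
      using y by meson
    have "map y [i..j] = map x [i + t..j + t]"
      by (rule nth_equalityI) (auto simp: xy[symmetric] algebra_simps)
    then show ?thesis using x unfolding sadic_subshift_def by auto
  qed
  then show "y \<in> sadic_subshift \<tau>" by (simp add: sadic_subshift_def)
qed

lemma shift_int_iter:
  assumes "bijective_system X shift_dist shift" "x \<in> X"
  shows "int_iter X shift k x = (\<lambda>i. x (i + k))"
proof -
  interpret bijective_system X shift_dist shift by fact
  show ?thesis
  proof (induction k rule: int_induct[where k = 0])
    case (step1 k)
    have "int_iter X shift (k + 1) x = shift (\<lambda>i. x (i + k))"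
      using T_itr[OF assms(2), of k] step1(2) by simp
    also have "\<dots> = (\<lambda>i. x (i + (k + 1)))" by (simp add: shift_def algebra_simps)
    finally show ?case .
  next
    case (step2 k)
    then have "shift (int_iter X shift (k - 1) x) = (\<lambda>i. x (i + k))"
      using T_itr[OF assms(2), of "k - 1"] by simp
    then have "int_iter X shift (k - 1) x (i - 1 + 1) = x (i - 1 + k)" for i
      unfolding shift_def by meson
    then show ?case by (simp add: fun_eq_iff algebra_simps)
  qed simp
qed

lemma shift_asymptotic_iff:
  assumes "bijective_system X shift_dist shift" "x \<in> X" "y \<in> X"
  shows "asymptotic X shift_dist shift x y \<longleftrightarrow> (\<exists>c. \<forall>i\<le>c. x i = y i)"
proof -
  let ?f = "\<lambda>n. shift_dist (\<lambda>i. x (i - int n)) (\<lambda>i. y (i - int n))"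
  have nonneg: "0 \<le> shift_dist x y" for x y :: "int \<Rightarrow> 'a" by (simp add: shift_dist_def)
  have as: "asymptotic X shift_dist shift x y \<longleftrightarrow> ?f \<longlonglongrightarrow> 0"
    using assms by (simp add: asymptotic_def shift_int_iter)
  show ?thesis
  proof
    assume "asymptotic X shift_dist shift x y"
    \<comment> \<open>A distance below \<open>1\<close> means agreement at coordinate
      \<open>0\<close>, which after \<open>n\<close> backward shifts is coordinate \<open>-n\<close>
      of the original points.\<close>
    then have "\<forall>\<^sub>F n in sequentially. ?f n < (1 / 2) ^ 0"
      unfolding as by (rule order_tendstoD) simp
    then obtain N where N: "\<And>n. n \<ge> N \<Longrightarrow> ?f n < (1 / 2) ^ 0"
      by (auto simp: eventually_sequentially)
    have "x i = y i" if "i \<le> - int N" for i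
      using N[of "nat (- i)"] that unfolding shift_dist_less_iff by auto
    then show "\<exists>c. \<forall>i\<le>c. x i = y i" by blast
  next
    assume "\<exists>c. \<forall>i\<le>c. x i = y i"
    then obtain c where c: "\<And>i. i \<le> c \<Longrightarrow> x i = y i" by blast
    have "\<forall>\<^sub>F n in sequentially. ?f n < r" if "r > 0" for r
    proof -
      obtain m where m: "(1 / 2 :: real) ^ m < r"
        using real_arch_pow_inv[of r "1/2"] \<open>r > 0\<close> by auto
      have "?f n < r" if "n \<ge> m + nat (- c)" for n
      proof -
        have "?f n < (1 / 2) ^ m"
          unfolding shift_dist_less_iff using that by (auto intro!: c)
        then show ?thesis using m by simp
      qed
      then show ?thesis by (auto simp: eventually_sequentially)
    qed
    then show "asymptotic X shift_dist shift x y"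
      unfolding as by (intro order_tendstoI) (auto intro: always_eventually less_le_trans[OF _ nonneg])
  qed
qed

text \<open>Ever longer windows of period \<open>q\<close>, moved to the origin, would accumulate at
  a point of \<open>X\<close> with period \<open>q\<close>, and its orbit would be finite.\<close>

lemma no_periodic_window:
  fixes X :: "(int \<Rightarrow> 'a::finite) set"
  assumes bs: "bijective_system X shift_dist shift" and X: "subshift X"
    and ap: "aperiodic_system X shift" and q: "1 \<le> q"
  shows "\<exists>n. \<forall>x\<in>X. \<forall>i. \<exists>j<n. x (i + int j) \<noteq> x (i + int j + int q)"
proof (rule ccontr)
  assume "\<not> ?thesis"
  then have "\<forall>n. \<exists>x i. x \<in> X \<and> (\<forall>j<2 * n + 1. x (i + int j) = x (i + int j + int q))" by meson
  then obtain x i where x: "\<And>n. x n \<in> X"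
    and per: "\<And>n j. j < 2 * n + 1 \<Longrightarrow> x n (i n + int j) = x n (i n + int j + int q)" by metis
  \<comment> \<open>The origin becomes the centre of the periodic window of length
    \<open>2 * n + 1\<close>.\<close>
  define s where "s = (\<lambda>n k. x n (k + (i n + int n)))"
  obtain g where g: "\<And>m k0. \<exists>k\<ge>k0. \<forall>i. \<bar>i\<bar> \<le> int m \<longrightarrow> s k i = g i"
    using finite_alphabet_limit[of s] by blast
  have "g \<in> X"
    using X x g unfolding subshift_def s_def by metis
  have gq: "g (k + int q) = g k" for k
  proof -
    define m where "m = nat \<bar>k\<bar> + q"
    obtain n where n: "n \<ge> m" "\<And>i. \<bar>i\<bar> \<le> int m \<Longrightarrow> s n i = g i" using g by metis
    have k: "k + int n \<ge> 0" "k \<le> int n" using n(1) by (auto simp: m_def)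
    then have "s n k = s n (k + int q)"
      using per[of "nat (k + int n)" n] by (simp add: s_def algebra_simps)
    then show ?thesis using n(2)[of k] n(2)[of "k + int q"] by (simp add: m_def)
  qed
  have gmod: "g (k + j * int q) = g k" for k j
  proof (induction j rule: int_induct[where k = 0])
    case (step1 j) then show ?case using gq[of "k + j * int q"] by (simp add: algebra_simps)
  next
    case (step2 j) then show ?case using gq[of "k + (j - 1) * int q"] by (simp add: algebra_simps)
  qed simp
  have "orbit X shift g \<subseteq> (\<lambda>k i. g (i + k)) ` {0..<int q}"
  proof
    fix y assume "y \<in> orbit X shift g"
    then obtain k where "y = (\<lambda>i. g (i + k))"
      using shift_int_iter[OF bs \<open>g \<in> X\<close>] by (auto simp: orbit_def)
    moreover have "g (i + k) = g (i + k mod int q)" for i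
      using gmod[of "i + k mod int q" "k div int q"] by (simp add: algebra_simps)
    ultimately show "y \<in> (\<lambda>k i. g (i + k)) ` {0..<int q}"
      using q by (intro image_eqI[of _ _ "k mod int q"]) auto
  qed
  then have "finite (orbit X shift g)" by (rule finite_subset) simp
  then show False using ap \<open>g \<in> X\<close> by (simp add: aperiodic_system_def)
qed

text \<open>One length for all periods up to \<open>Q\<close>: in \<open>common_cut\<close> the
  period comes from a pigeonhole argument and only its bound is known.\<close>

lemma no_periodic_windows:
  fixes X :: "(int \<Rightarrow> 'a::finite) set"
  assumes "bijective_system X shift_dist shift" "subshift X" "aperiodic_system X shift"
  shows "\<exists>n. \<forall>x\<in>X. \<forall>i q. 1 \<le> q \<longrightarrow> q \<le> Q \<longrightarrow> (\<exists>j<n. x (i + int j) \<noteq> x (i + int j + int q))"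
proof (induction Q)
  case (Suc Q)
  then obtain n where n: "\<forall>x\<in>X. \<forall>i q. 1 \<le> q \<longrightarrow> q \<le> Q \<longrightarrow>
      (\<exists>j<n. x (i + int j) \<noteq> x (i + int j + int q))" by blast
  obtain n' where n': "\<forall>x\<in>X. \<forall>i. \<exists>j<n'. x (i + int j) \<noteq> x (i + int j + int (Suc Q))"
    using no_periodic_window[OF assms, of "Suc Q"] by auto
  have "\<exists>j<max n n'. x (i + int j) \<noteq> x (i + int j + int q)"
    if "x \<in> X" "1 \<le> q" "q \<le> Suc Q" for x i q
    using that n n' by (metis le_Suc_eq less_max_iff_disj)
  then show ?case by blast
qed auto

section \<open>Parsing points of an S-adic subshift\<close>

lemma nonerasing_compose_upto:
  assumes "\<forall>n. nonerasing_morphism (\<tau> n)"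
  shows "nonerasing_morphism (compose_upto \<tau> N)"
proof (induction N)
  case 0
  then show ?case by (simp add: nonerasing_morphism_def)
next
  case (Suc N)
  have "compose_upto \<tau> N w \<noteq> []" if "w \<noteq> []" for w
  proof (cases w)
    case (Cons a w')
    then have "compose_upto \<tau> N w = compose_upto \<tau> N [a] @ compose_upto \<tau> N w'"
      using Suc by (metis append_Cons append_Nil nonerasing_morphism_def)
    then show ?thesis using Suc by (simp add: nonerasing_morphism_def)
  qed (use that in simp)
  then show ?case using Suc assms by (simp add: nonerasing_morphism_def)
qed

lemma compose_upto_add:
  "compose_upto \<tau> (N + k) = compose_upto \<tau> N \<circ> compose_upto (\<lambda>n. \<tau> (N + n)) k"
  by (induction k) (simp_all add: o_assoc)

text \<open>The window might occur only in words of a level \<open>M < N\<close>. Enlarging it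
  beyond the length of all those words forces \<open>M \<ge> N\<close>, and such a word is an image
  under the composition of the first \<open>N\<close> morphisms.\<close>

lemma sadic_window_word:
  fixes \<tau> :: "nat \<Rightarrow> 'a::finite list \<Rightarrow> 'a list"
  assumes x: "x \<in> sadic_subshift \<tau>"
  shows "\<exists>w. sublist (map x [i..j]) (compose_upto \<tau> N w)"
proof -
  define L where "L = Max ((\<lambda>(M, a). length (compose_upto \<tau> M [a])) ` ({..<N} \<times> UNIV))"
  have L: "length (compose_upto \<tau> M [a]) \<le> L" if "M < N" for M a
    unfolding L_def using that by (intro Max_ge) (auto intro!: image_eqI[of _ _ "(M, a)"])
  obtain M a where M: "sublist (map x [i - int L - 1..max i j]) (compose_upto \<tau> M [a])"
    using x unfolding sadic_subshift_def by blast
  have "\<not> M < N"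
    using sublist_length_le[OF M] L[of M a] by auto
  then have "compose_upto \<tau> M [a] = compose_upto \<tau> N (compose_upto (\<lambda>n. \<tau> (N + n)) (M - N) [a])"
    using compose_upto_add[of \<tau> N "M - N"] by simp
  moreover have "sublist (map x [i..j]) (map x [i - int L - 1..max i j])"
  proof (cases "i \<le> j")
    case True
    have "[i - int L - 1..j] = [i - int L - 1..i - 1] @ [i..j]"
      using True upto_split1[of "i - int L - 1" i j] by simp
    then show ?thesis using True by (auto simp: max_def sublist_def intro: exI[of _ "[]"])
  qed simp
  ultimately show ?thesis using M sublist_order.order.trans by metis
qed

lemma morphism_concat:
  assumes "nonerasing_morphism \<sigma>"
  shows "\<sigma> w = concat (map (\<lambda>a. \<sigma> [a]) w)"
proof (induction w)
  case Nil
  have "\<sigma> [] = \<sigma> [] @ \<sigma> []"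
    using assms by (metis append_Nil nonerasing_morphism_def)
  then show ?case by simp
next
  case (Cons a w)
  have "\<sigma> (a # w) = \<sigma> [a] @ \<sigma> w"
    using assms by (metis append_Cons append_Nil nonerasing_morphism_def)
  then show ?case using Cons by simp
qed

text \<open>A factorization of a word around the window gives a parse that can be trusted only
  inside the window. The cut near the origin, at a distance bounded independently of
  \<open>n\<close>, ensures that a limit of such parses has a cut.\<close>

lemma window_parse:
  fixes W :: "'l::finite \<Rightarrow> 'b list"
  assumes ne: "\<And>l. W l \<noteq> []" and m: "\<And>l. length (W l) \<le> m"
    and sub: "sublist (map x [- int n..int n]) (concat (map W w))"
  shows "\<exists>g. (\<forall>c l. g c = Some l \<longrightarrow> - int n \<le> c \<longrightarrow> c + int (length (W l)) \<le> int n \<longrightarrow>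
               (\<forall>j<length (W l). x (c + int j) = W l ! j) \<and> g (c + int (length (W l))) \<noteq> None) \<and>
             (\<forall>c. g c \<noteq> None \<longrightarrow> - int n < c \<longrightarrow> c \<le> int n \<longrightarrow>
               (\<exists>b. g (c - int (length (W b))) = Some b)) \<and>
             (\<exists>c. - int m \<le> c \<and> c \<le> 0 \<and> g c \<noteq> None)"
proof -
  define pos where "pos = (\<lambda>i. length (concat (map W (take i w))))"
  obtain p s where ps: "concat (map W w) = p @ map x [- int n..int n] @ s"
    using sub by (auto simp: sublist_def)
  \<comment> \<open>The index in the concatenation of the letter at coordinate
    \<open>0\<close>.\<close>
  define off where "off = int n + int (length p)"
  have posS: "pos (Suc i) = pos i + length (W (w ! i))" if "i < length w" for i
    using that by (simp add: pos_def take_Suc_conv_app_nth)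
  have len: "length (W l) > 0" for l using ne[of l] by simp
  have mono: "pos i < pos j" if "i < j" "j \<le> length w" for i j
    using that
  proof (induction j)
    case (Suc j)
    then show ?case using posS[of j] len[of "w ! j"] by (cases "i = j") auto
  qed simp
  \<comment> \<open>Blocks are nonempty, so a position determines its block and the
    \<open>SOME\<close> in \<open>g\<close> is unambiguous.\<close>
  have inj: "i = j" if "pos i = pos j" "i < length w" "j < length w" for i j
    using mono[of i j] mono[of j i] that by (metis less_imp_le less_irrefl linorder_neqE_nat)
  define g where "g = (\<lambda>c. if \<exists>i<length w. int (pos i) = c + off
      then Some (w ! (SOME i. i < length w \<and> int (pos i) = c + off)) else None)"
  have gD: "\<exists>i<length w. int (pos i) = c + off \<and> g c = Some (w ! i)" if "g c \<noteq> None" for c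
  proof -
    have ex: "\<exists>i. i < length w \<and> int (pos i) = c + off" using that by (auto simp: g_def split: if_splits)
    from someI_ex[OF ex] ex show ?thesis unfolding g_def by auto
  qed
  have gI: "g c = Some (w ! i)" if "i < length w" "int (pos i) = c + off" for c i
  proof -
    have "g c \<noteq> None" using that by (auto simp: g_def)
    from gD[OF this] obtain i' where i': "i' < length w" "int (pos i') = c + off" "g c = Some (w ! i')"
      by blast
    moreover have "pos i = pos i'" using i'(2) that(2) by linarith
    then have "i = i'" using inj that(1) i'(1) by blast
    ultimately show ?thesis by simp
  qed
  have total: "pos (length w) = length p + (2 * n + 1) + length s"
    unfolding pos_def using ps by simp
  have letter: "concat (map W w) ! (pos i + j) = W (w ! i) ! j"
    if "i < length w" "j < length (W (w ! i))" for i j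
  proof -
    have "concat (map W w) = concat (map W (take i w)) @ W (w ! i) @ concat (map W (drop (Suc i) w))"
      by (subst id_take_nth_drop[OF that(1)]) simp
    then show ?thesis using that(2) by (simp add: pos_def nth_append)
  qed
  have "(\<forall>j<length (W l). x (c + int j) = W l ! j) \<and> g (c + int (length (W l))) \<noteq> None"
    if c: "g c = Some l" "- int n \<le> c" "c + int (length (W l)) \<le> int n" for c l
  proof -
    obtain i where i: "i < length w" "int (pos i) = c + off" "l = w ! i" using gD[of c] c(1) by auto
    have 1: "x (c + int j) = W l ! j" if j: "j < length (W l)" for j
    proof -
      have "W l ! j = (p @ map x [- int n..int n] @ s) ! (pos i + j)"
        using letter[of i j] i j by (simp add: ps)
      also have "pos i + j = length p + nat (c + int n + int j)"
        using i(2) c(2) by (simp add: off_def)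
      also have "(p @ map x [- int n..int n] @ s) ! \<dots> = x (c + int j)"
        using c j by (simp add: nth_append)
      finally show ?thesis by simp
    qed
    have "int (pos (Suc i)) = c + int (length (W l)) + off" using i posS[of i] by simp
    \<comment> \<open>The concatenation contains the letter at coordinate \<open>n\<close>, so it
      cannot end at a cut that is at most \<open>n\<close>.\<close>
    moreover have "Suc i \<noteq> length w"
      using calculation total c(3) by (auto simp: off_def)
    ultimately have "g (c + int (length (W l))) = Some (w ! Suc i)"
      using i(1) by (intro gI) auto
    then show ?thesis using 1 by simp
  qed
  moreover have "\<exists>b. g (c - int (length (W b))) = Some b"
    if c: "g c \<noteq> None" "- int n < c" "c \<le> int n" for c
  proof -
    obtain i where i: "i < length w" "int (pos i) = c + off" using gD[OF c(1)] by auto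
    have "pos 0 = 0" by (simp add: pos_def)
    then have "i \<noteq> 0" using i(2) c(2) off_def by (intro notI) simp
    then obtain k where k: "i = Suc k" by (cases i) auto
    have "g (c - int (length (W (w ! k)))) = Some (w ! k)"
      using i posS[of k] by (intro gI) (auto simp: k)
    then show ?thesis by blast
  qed
  moreover have "\<exists>c. - int m \<le> c \<and> c \<le> 0 \<and> g c \<noteq> None"
  proof -
    \<comment> \<open>Its maximum is the block that covers coordinate \<open>0\<close>.\<close>
    define S where "S = {i. i < length w \<and> int (pos i) \<le> off}"
    have "w \<noteq> []" using ps by auto
    then have "0 \<in> S" by (simp add: S_def pos_def off_def)
    moreover have "finite S" by (rule finite_subset[of _ "{..<length w}"]) (auto simp: S_def)
    ultimately have M: "Max S \<in> S" "\<And>i. i \<in> S \<Longrightarrow> i \<le> Max S" by (auto intro: Max_in)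
    have S: "Max S < length w" "int (pos (Max S)) \<le> off" using M(1) by (auto simp: S_def)
    have "off < int (pos (Suc (Max S)))"
    proof (rule ccontr)
      assume *: "\<not> ?thesis"
      then have "Suc (Max S) \<noteq> length w" using total by (auto simp: off_def)
      then have "Suc (Max S) \<in> S" using * S by (auto simp: S_def)
      then show False using M(2) by fastforce
    qed
    then have "off - int m \<le> int (pos (Max S))" using posS[OF S(1)] m[of "w ! Max S"] by simp
    moreover have "g (int (pos (Max S)) - off) = Some (w ! Max S)"
      using S by (intro gI) auto
    ultimately show ?thesis using S(2) by (intro exI[of _ "int (pos (Max S)) - off"]) auto
  qed
  ultimately show ?thesis by (intro exI[of _ g] conjI) blast+
qed

text \<open>The conditions on a parse at a cut \<open>c\<close> involve only coordinates within one
  block length of \<open>c\<close>, so they pass from the window parses to a limit.\<close>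

lemma ex_parse:
  fixes W :: "'l::finite \<Rightarrow> 'b list"
  assumes ne: "\<And>l. W l \<noteq> []"
    and sub: "\<And>n. \<exists>w. sublist (map x [- int n..int n]) (concat (map W w))"
  shows "\<exists>g c. parse W x g \<and> left_extends W g \<and> g c \<noteq> None"
proof -
  define m where "m = Max (range (\<lambda>l. length (W l)))"
  have m: "length (W l) \<le> m" for l unfolding m_def by (intro Max_ge) auto
  have "\<exists>g. (\<forall>c l. g c = Some l \<longrightarrow> - int n \<le> c \<longrightarrow> c + int (length (W l)) \<le> int n \<longrightarrow>
               (\<forall>j<length (W l). x (c + int j) = W l ! j) \<and> g (c + int (length (W l))) \<noteq> None) \<and>
             (\<forall>c. g c \<noteq> None \<longrightarrow> - int n < c \<longrightarrow> c \<le> int n \<longrightarrow>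
               (\<exists>b. g (c - int (length (W b))) = Some b)) \<and>
             (\<exists>c. - int m \<le> c \<and> c \<le> 0 \<and> g c \<noteq> None)" for n
  proof -
    obtain w where "sublist (map x [- int n..int n]) (concat (map W w))" using sub by blast
    with ne m show ?thesis by (rule window_parse)
  qed
  then obtain G where G1: "\<And>n c l. G n c = Some l \<Longrightarrow> - int n \<le> c \<Longrightarrow>
        c + int (length (W l)) \<le> int n \<Longrightarrow>
        (\<forall>j<length (W l). x (c + int j) = W l ! j) \<and> G n (c + int (length (W l))) \<noteq> None"
    and G2: "\<And>n c. G n c \<noteq> None \<Longrightarrow> - int n < c \<Longrightarrow> c \<le> int n \<Longrightarrow>
        \<exists>b. G n (c - int (length (W b))) = Some b"
    and G3: "\<And>n. \<exists>c. - int m \<le> c \<and> c \<le> 0 \<and> G n c \<noteq> None"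
    by metis
  obtain g where g: "\<And>M k0. \<exists>k\<ge>k0. \<forall>i. \<bar>i\<bar> \<le> int M \<longrightarrow> G k i = g i"
    using finite_alphabet_limit[of G] by blast
  have near: "\<exists>n. \<bar>c\<bar> + int m < int n \<and> (\<forall>i. \<bar>i\<bar> \<le> \<bar>c\<bar> + int m \<longrightarrow> G n i = g i)" for c
  proof -
    obtain n where "n \<ge> Suc (nat \<bar>c\<bar> + m)" "\<forall>i. \<bar>i\<bar> \<le> int (nat \<bar>c\<bar> + m) \<longrightarrow> G n i = g i"
      using g by blast
    then show ?thesis by (intro exI[of _ n]) auto
  qed
  have "(\<forall>j<length (W l). x (c + int j) = W l ! j) \<and> g (c + int (length (W l))) \<noteq> None"
    if c: "g c = Some l" for c l
  proof -
    obtain n where n: "\<bar>c\<bar> + int m < int n" "\<And>i. \<bar>i\<bar> \<le> \<bar>c\<bar> + int m \<Longrightarrow> G n i = g i"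
      using near by blast
    have "G n c = Some l" using n(2)[of c] c by simp
    from G1[OF this] show ?thesis using n(1) n(2)[of "c + int (length (W l))"] m[of l] by auto
  qed
  then have "parse W x g" using ne by (simp add: parse_def)
  moreover have "left_extends W g"
    unfolding left_extends_def
  proof (intro allI impI)
    fix c assume c: "g c \<noteq> None"
    obtain n where n: "\<bar>c\<bar> + int m < int n" "\<And>i. \<bar>i\<bar> \<le> \<bar>c\<bar> + int m \<Longrightarrow> G n i = g i"
      using near by blast
    have "G n c \<noteq> None" using n(2)[of c] c by simp
    moreover have "- int n < c" "c \<le> int n" using n(1) by auto
    ultimately obtain b where "G n (c - int (length (W b))) = Some b" using G2 by blast
    then show "\<exists>b. g (c - int (length (W b))) = Some b"
      using n(2)[of "c - int (length (W b))"] m[of b] by auto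
  qed
  moreover have "\<exists>c. g c \<noteq> None"
  proof -
    obtain n where n: "\<And>i. \<bar>i\<bar> \<le> \<bar>0::int\<bar> + int m \<Longrightarrow> G n i = g i"
      using near[of 0] by blast
    obtain c where c: "- int m \<le> c" "c \<le> 0" "G n c \<noteq> None" using G3 by blast
    then show ?thesis using n[of c] by auto
  qed
  ultimately show ?thesis by blast
qed

lemma sadic_parse:
  fixes \<tau> :: "nat \<Rightarrow> 'a::finite list \<Rightarrow> 'a list"
  assumes "\<forall>n. nonerasing_morphism (\<tau> n)" "x \<in> sadic_subshift \<tau>"
  shows "\<exists>g c. parse (\<lambda>a. compose_upto \<tau> N [a]) x g \<and>
           left_extends (\<lambda>a. compose_upto \<tau> N [a]) g \<and> g c \<noteq> None"
proof (rule ex_parse)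
  note \<sigma> = nonerasing_compose_upto[OF assms(1), of N]
  show "compose_upto \<tau> N [l] \<noteq> []" for l using \<sigma> by (simp add: nonerasing_morphism_def)
  show "\<exists>w. sublist (map x [- int n..int n]) (concat (map (\<lambda>a. compose_upto \<tau> N [a]) w))" for n
    using sadic_window_word[OF assms(2)] morphism_concat[OF \<sigma>] by metis
qed

section \<open>Binary S-adic subshifts\<close>

text \<open>
  The marker \<open>z\<close> follows every cut, so a run of blocks \<open>W a\<close> before a cut, together with the
  marker after it, has period \<open>length (W a)\<close>.
\<close>

lemma run_periodic:
  assumes p: "parse W s g" "ran g \<subseteq> {a, b}" and m: "marks z \<alpha> \<beta> (W a) (W b)"
    and c: "g c \<noteq> None"
  shows "\<forall>i<k. g (c - int (Suc i) * int (length (W a))) = Some a \<Longrightarrow>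
         c - int k * int (length (W a)) \<le> j \<Longrightarrow> j + int (length (W a)) < c + int (length z) \<Longrightarrow>
         s (j + int (length (W a))) = s j"
proof (induction k arbitrary: j)
  case 0
  define i where "i = nat (j - c)"
  have j: "j = c + int i" using 0 by (simp add: i_def)
  have "i + length (W a) < length z" using 0 by (simp add: j)
  moreover have "z ! (i + length (W a)) = (W a @ z) ! (i + length (W a))"
    by (rule marks_nth[OF m]) (use calculation in auto)
  ultimately show ?case
    using parse_marker(1)[OF p(1) m p(2) c, of i]
      parse_marker(1)[OF p(1) m p(2) c, of "i + length (W a)"]
    by (simp add: j nth_append add_ac)
next
  case (Suc k)
  let ?c = "c - int k * int (length (W a))"
  show ?case
  proof (cases "?c \<le> j")
    case False
    define i where "i = nat (j - (c - int (Suc k) * int (length (W a))))"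
    have j: "j = c - int (Suc k) * int (length (W a)) + int i" using Suc.prems by (simp add: i_def)
    have i: "i < length (W a)" using False by (simp add: j algebra_simps)
    have "g (c - int (Suc k) * int (length (W a))) = Some a" using Suc.prems(1) by blast
    then have sj: "s j = (W a @ z) ! i"
      unfolding j using i by (intro parse_nth[OF p(1) m p(2)]) auto
    have "s (?c + int i) = (W a @ z) ! i"
    proof (cases k)
      case 0
      then have "i < length z" using Suc.prems(3) by (simp add: j)
      then show ?thesis
        using parse_marker(1)[OF p(1) m p(2) c, of i] marks_nth[OF m, of "W a" i] 0 by simp
    next
      case (Suc k')
      then have "g ?c = Some a" using Suc.prems(1)[rule_format, of k'] by simp
      then show ?thesis using i by (intro parse_nth[OF p(1) m p(2)]) auto
    qed
    then show ?thesis using sj by (simp add: j algebra_simps)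
  qed (use Suc in auto)
qed

text \<open>A run of \<open>W a\<close> followed by the marker is periodic and therefore shorter
  than \<open>n\<close> plus one period; so it stops on the left, at a block \<open>W b\<close>. The
  same bound limits the length of the marker.\<close>

lemma block_before_run:
  assumes p: "parse W s g" "left_extends W g" "ran g \<subseteq> {a, b}"
    and m: "marks z \<alpha> \<beta> (W a) (W b)" and ne: "W a \<noteq> []"
    and c: "g c \<noteq> None"
    and np: "\<And>i. \<exists>j<n. s (i + int j) \<noteq> s (i + int j + int (length (W a)))"
  shows "\<exists>k. g (c - int k * int (length (W a)) - int (length (W b))) = Some b \<and>
             k * length (W a) + length z < n + length (W a)"
proof -
  let ?A = "\<lambda>i. g (c - int (Suc i) * int (length (W a))) = Some a"
  have short: "k * length (W a) + length z < n + length (W a)" if "\<forall>i<k. ?A i" for k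
  proof (rule ccontr)
    assume "\<not> ?thesis"
    then have *: "n + length (W a) \<le> k * length (W a) + length z" by simp
    then have *: "int n + int (length (W a)) \<le> int k * int (length (W a)) + int (length z)"
      by (metis of_nat_add of_nat_mult of_nat_mono)
    have "s (c - int k * int (length (W a)) + int j + int (length (W a))) =
        s (c - int k * int (length (W a)) + int j)" if "j < n" for j
      using that * by (intro run_periodic[OF p(1,3) m c \<open>\<forall>i<k. ?A i\<close>]) auto
    then show False using np by metis
  qed
  have "\<exists>k. \<not> ?A k"
  proof (rule ccontr)
    assume "\<not> ?thesis"
    \<comment> \<open>An endless run would contain \<open>n + length (W a)\<close> blocks, each of
      at least one letter.\<close>
    then have "(n + length (W a)) * length (W a) + length z < n + length (W a)"
      by (intro short) auto
    moreover have "n + length (W a) \<le> (n + length (W a)) * length (W a)" using ne by (cases "W a") auto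
    ultimately show False by simp
  qed
  then obtain k where k: "\<not> ?A k" "\<forall>i<k. ?A i" using exists_least_iff[of "\<lambda>k. \<not> ?A k"] by auto
  have "g (c - int k * int (length (W a))) \<noteq> None"
  proof (cases k)
    case (Suc k')
    then have "?A k'" using k(2) by blast
    then show ?thesis by (simp add: Suc)
  qed (use c in simp)
  then obtain l where l: "g (c - int k * int (length (W a)) - int (length (W l))) = Some l"
    using p(2) by (auto simp: left_extends_def)
  have "l = a \<or> l = b" using l p(3) by (auto simp: ran_def)
  moreover have "l \<noteq> a" using k(1) l by (auto simp: algebra_simps)
  ultimately show ?thesis using l short[OF k(2)] by blast
qed

lemma card_le_2I:
  assumes "\<And>a b c. a \<in> S \<Longrightarrow> b \<in> S \<Longrightarrow> c \<in> S \<Longrightarrow> a = b \<or> b = c \<or> a = c"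
  shows "finite S \<and> card S \<le> 2"
proof (rule ccontr)
  assume *: "\<not> ?thesis"
  have "\<exists>B\<subseteq>S. card B = 3"
  proof (cases "finite S")
    case True
    then show ?thesis using * obtain_subset_with_card_n[of 3 S] by auto
  next
    case False
    then show ?thesis using infinite_arbitrarily_large[of S 3] by blast
  qed
  then obtain B where "B \<subseteq> S" "card B = 3" by blast
  then show False using assms unfolding card_3_iff by blast
qed

locale binary_sadic =
  fixes \<tau> :: "nat \<Rightarrow> 'a::finite list \<Rightarrow> 'a list" and a b :: 'a
  assumes ab: "a \<noteq> b" "(UNIV :: 'a set) = {a, b}"
    and morph: "\<forall>n. nonerasing_morphism (\<tau> n)"
    and aper: "aperiodic_system (sadic_subshift \<tau>) shift"
begin

abbreviation X :: "(int \<Rightarrow> 'a) set" where "X \<equiv> sadic_subshift \<tau>"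

abbreviation W :: "nat \<Rightarrow> 'a \<Rightarrow> 'a list" where "W N l \<equiv> compose_upto \<tau> N [l]"

lemma bs: "bijective_system X shift_dist shift"
  by (rule bijective_system_if_compact_system[OF compact_system_sadic_subshift])

sublocale bijective_system X shift_dist shift by (rule bs)

lemmas np = no_periodic_windows[OF bs subshift_sadic_subshift aper]

lemma W_nonempty: "W N l \<noteq> []"
  using nonerasing_compose_upto[OF morph] by (simp add: nonerasing_morphism_def)

lemma labels: "l = a \<or> l = b" "ran g \<subseteq> {a, b}"
  using ab by auto

lemma itr_eq: "x \<in> X \<Longrightarrow> itr k x = (\<lambda>i. x (i + k))"
  by (rule shift_int_iter[OF bs])

section \<open>Right special pasts and their cuts\<close>

lemma component_special:
  assumes "C \<in> asymptotic_components X shift_dist shift"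
  shows "\<exists>x\<in>X. \<exists>y\<in>X. orbit X shift x \<in> C \<and> (\<forall>i<0. x i = y i) \<and> x 0 \<noteq> y 0"
proof -
  obtain x y where X: "x \<in> X" "y \<in> X" and ne: "x \<noteq> y"
    and as: "asymptotic X shift_dist shift x y" and C: "orbit X shift x \<in> C"
    using asymptotic_componentE[OF assms] by blast
  obtain c where c: "\<And>i. i \<le> c \<Longrightarrow> x i = y i"
    using as shift_asymptotic_iff[OF bs X] by blast
  obtain t where t: "x t \<noteq> y t" using ne by auto
  have ct: "c < t" using c[of t] t by (meson not_le)
  let ?P = "\<lambda>n. x (c + int n) \<noteq> y (c + int n)"
  have "?P (nat (t - c))" using t ct by simp
  then obtain n where n: "?P n" "\<And>k. k < n \<Longrightarrow> \<not> ?P k" using exists_least_iff[of ?P] by blast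
  have "x i = y i" if "i < c + int n" for i
    using c[of i] n(2)[of "nat (i - c)"] that by (cases "i \<le> c") auto
  then have "\<forall>i<0. itr (c + int n) x i = itr (c + int n) y i"
    "itr (c + int n) x 0 \<noteq> itr (c + int n) y 0"
    using n(1) X by (simp_all add: itr_eq)
  moreover have "orbit X shift (itr (c + int n) x) \<in> C" using C X by (simp add: orbit_itr)
  ultimately show ?thesis using X itr_in by blast
qed

lemma component_eqI:
  assumes "C \<in> asymptotic_components X shift_dist shift" "D \<in> asymptotic_components X shift_dist shift"
    and "x \<in> X" "orbit X shift x \<in> C" "y \<in> X" "orbit X shift y \<in> D"
    and "\<And>i. i < 0 \<Longrightarrow> x (i + j) = y (i + k)"
  shows "C = D"
proof (rule asymptotic_component_eqI[OF assms(1-6)])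
  show "asymptotic X shift_dist shift (itr j x) (itr k y)"
    using assms itr_in[OF assms(3), of j] itr_in[OF assms(5), of k]
    by (subst shift_asymptotic_iff[OF bs]) (auto simp: itr_eq intro!: exI[of _ "-1"])
qed

text \<open>Commuting words would make the given point periodic to the right of a cut, against the
  bound on periodic windows.\<close>

lemma ex_marks_W:
  assumes "x \<in> X"
  shows "\<exists>z \<alpha> \<beta>. marks z \<alpha> \<beta> (W N a) (W N b)"
proof (rule ex_marks, rule notI)
  assume "W N a @ W N b = W N b @ W N a"
  from parse_commuting_periodic[of "W N", OF this W_nonempty W_nonempty]
  obtain h where h: "h \<ge> 1" and per: "\<forall>s g c. parse (W N) s g \<longrightarrow> ran g \<subseteq> {a, b} \<longrightarrow> g c \<noteq> None \<longrightarrow>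
      (\<forall>i\<ge>c. s (i + int h) = s i)"
    by (elim exE conjE)
  obtain g c where g: "parse (W N) x g" "g c \<noteq> None"
    using sadic_parse[OF morph assms] by blast
  then have "\<forall>i\<ge>c. x (i + int h) = x i" using per labels(2) by blast
  moreover obtain n where "\<And>i q. 1 \<le> q \<Longrightarrow> q \<le> h \<Longrightarrow> \<exists>j<n. x (i + int j) \<noteq> x (i + int j + int q)"
    using np[of h] assms by blast
  from this[OF h order_refl, of c] obtain j where "x (c + int j) \<noteq> x (c + int j + int h)" by blast
  ultimately show False by simp
qed

text \<open>\<open>common_cut\<close> gives a cut shared by the parses of both points, and
  \<open>common_cut_diverges\<close> carries it forward to the distance \<open>|z|\<close> from the
  divergence.\<close>

lemma special_cut:
  assumes "x \<in> X" "y \<in> X" "\<forall>i<0. x i = y i" "x 0 \<noteq> y 0"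
    and m: "marks z \<alpha> \<beta> (W N a) (W N b)"
  shows "\<exists>g. parse (W N) x g \<and> left_extends (W N) g \<and> g (- int (length z)) \<noteq> None"
proof -
  obtain g c where g: "parse (W N) x g" "left_extends (W N) g" "g c \<noteq> None"
    using sadic_parse[OF morph assms(1)] by blast
  obtain h d where h: "parse (W N) y h" "left_extends (W N) h" "h d \<noteq> None"
    using sadic_parse[OF morph assms(2)] by blast
  have st: "\<And>i. i < 0 \<Longrightarrow> x i = y i" using assms by blast
  have "\<exists>n. \<forall>i q. 1 \<le> q \<longrightarrow> q \<le> Q \<longrightarrow> (\<exists>j<n. x (i + int j) \<noteq> x (i + int j + int q))" for Q
    using np[of Q] assms(1) by blast
  then obtain e where "e \<le> - int (length z)" "g e \<noteq> None" "h e \<noteq> None"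
    using common_cut[OF g(1,2) labels(2) g(3) h(1,2) labels(2) h(3) m st] by blast
  then show ?thesis
    using common_cut_diverges[OF g(1) labels(2) h(1) labels(2) m st assms(4)] g by blast
qed

lemma ex_long:
  assumes "x \<in> X"
  shows "\<exists>N l. M \<le> length (W N l)"
proof -
  obtain N l where "sublist (map x [1..int M]) (W N l)"
    using assms unfolding sadic_subshift_def by blast
  from sublist_length_le[OF this] show ?thesis by auto
qed

text \<open>If \<open>C\<close> and \<open>D\<close> differ, the two pasts differ for each of the
  finitely many pairs of shifts in \<open>{-B..0}\<close>, and all these differences occur within a
  depth \<open>M\<close>. At a level whose long block has at least \<open>M\<close> letters, both
  pasts contain this block ending just before a position of \<open>{-B..0}\<close>, which is a
  contradiction.\<close>

lemma components_eq_if_short_blocks: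
  assumes short: "\<And>N. \<exists>l. length (W N l) < L"
    and C: "C \<in> asymptotic_components X shift_dist shift"
    and D: "D \<in> asymptotic_components X shift_dist shift"
  shows "C = D"
proof (rule ccontr)
  assume CD: "C \<noteq> D"
  obtain x x' where x: "x \<in> X" "x' \<in> X" "orbit X shift x \<in> C" "\<forall>i<0. x i = x' i" "x 0 \<noteq> x' 0"
    using component_special[OF C] by blast
  obtain y y' where y: "y \<in> X" "y' \<in> X" "orbit X shift y \<in> D" "\<forall>i<0. y i = y' i" "y 0 \<noteq> y' 0"
    using component_special[OF D] by blast
  obtain n where n: "\<And>x i q. x \<in> X \<Longrightarrow> 1 \<le> q \<Longrightarrow> q \<le> L \<Longrightarrow>
      \<exists>j<n. x (i + int j) \<noteq> x (i + int j + int q)"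
    using np[of L] by blast
  \<comment> \<open>A run of the short block together with the marker is shorter than
    \<open>n\<close> plus one such block, whose length is below \<open>L\<close>.\<close>
  define B where "B = int n + int L"
  have "\<forall>j k. \<exists>i<0. x (i + j) \<noteq> y (i + k)"
    using component_eqI[OF C D x(1,3) y(1,3)] CD by blast
  then obtain f where f: "\<And>j k. f j k < 0" "\<And>j k. x (f j k + j) \<noteq> y (f j k + k)" by metis
  define M where "M = Max ((\<lambda>(j, k). nat (- f j k)) ` ({-B..0} \<times> {-B..0}))"
  have M: "- f j k \<le> int M" if "j \<in> {-B..0}" "k \<in> {-B..0}" for j k
  proof -
    have "nat (- f j k) \<le> M" unfolding M_def
      using that by (intro Max_ge) (auto intro!: image_eqI[of _ _ "(j, k)"])
    then show ?thesis by simp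
  qed
  \<comment> \<open>\<open>M\<close> makes the block cover all the differences; \<open>L\<close>
    makes its letter different from that of the short block.\<close>
  obtain N v where v: "max M L \<le> length (W N v)" using ex_long[OF x(1)] by blast
  obtain u where u: "length (W N u) < L" using short by blast
  have "u \<noteq> v" using u v by auto
  then have uv: "u = a \<and> v = b \<or> u = b \<and> v = a" using labels(1) by metis
  then have r: "ran g \<subseteq> {u, v}" for g :: "int \<Rightarrow> 'a option" using labels(2) by auto
  obtain z \<alpha> \<beta> where m: "marks z \<alpha> \<beta> (W N a) (W N b)" using ex_marks_W[OF x(1)] by blast
  have "\<exists>\<alpha>' \<beta>'. marks z \<alpha>' \<beta>' (W N u) (W N v)"
    using uv m marks_sym[OF m] by metis
  then obtain \<alpha>' \<beta>' where m': "marks z \<alpha>' \<beta>' (W N u) (W N v)" by blast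
  have block: "\<exists>j\<in>{-B..0}. \<forall>i<length (W N v). s (j - int (length (W N v)) + int i) = W N v ! i"
    if s: "s \<in> X" "t \<in> X" "\<forall>i<0. s i = t i" "s 0 \<noteq> t 0" for s t
  proof -
    obtain g where g: "parse (W N) s g" "left_extends (W N) g" "g (- int (length z)) \<noteq> None"
      using special_cut[OF s m] by blast
    have "\<exists>j<n. s (i + int j) \<noteq> s (i + int j + int (length (W N u)))" for i
      using n[OF s(1), of "length (W N u)"] u W_nonempty[of N u]
      by (simp add: Suc_le_eq)
    from block_before_run[OF g(1,2) r m' W_nonempty g(3) this]
    obtain k where k: "g (- int (length z) - int k * int (length (W N u)) - int (length (W N v))) = Some v"
      "k * length (W N u) + length z < n + length (W N u)" by blast
    have "int k * int (length (W N u)) + int (length z) < int n + int (length (W N u))"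
      using k(2) by (metis of_nat_add of_nat_less_iff of_nat_mult)
    moreover have "0 \<le> int k * int (length (W N u))" by simp
    ultimately have "- int (length z) - int k * int (length (W N u)) \<in> {-B..0}"
      using u unfolding B_def atLeastAtMost_iff by linarith
    moreover have "\<forall>i<length (W N v). s (- int (length z) - int k * int (length (W N u)) -
        int (length (W N v)) + int i) = W N v ! i"
      using g(1) k(1) unfolding parse_def by blast
    ultimately show ?thesis by blast
  qed
  obtain j where j: "j \<in> {-B..0}"
    "\<And>i. i < length (W N v) \<Longrightarrow> x (j - int (length (W N v)) + int i) = W N v ! i"
    using block[OF x(1,2,4,5)] by blast
  obtain k where k: "k \<in> {-B..0}"
    "\<And>i. i < length (W N v) \<Longrightarrow> y (k - int (length (W N v)) + int i) = W N v ! i"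
    using block[OF y(1,2,4,5)] by blast
  define i where "i = nat (int (length (W N v)) + f j k)"
  have "0 \<le> int (length (W N v)) + f j k" using M[OF j(1) k(1)] v by linarith
  then have i: "int i = int (length (W N v)) + f j k" by (simp add: i_def)
  then have "i < length (W N v)" using f(1)[of j k] by linarith
  from j(2)[OF this] k(2)[OF this] show False using f(2)[of j k] i by (simp add: algebra_simps)
qed

text \<open>If all blocks have at least \<open>M\<close> letters, a special past is determined to
  depth \<open>M\<close> by the label of the block before its marker. Two labels cannot distinguish
  three pasts.\<close>

lemma components_eq_if_long_blocks:
  assumes long: "\<And>M. \<exists>N. \<forall>l. M \<le> length (W N l)"
    and C: "\<And>i. i < 3 \<Longrightarrow> C i \<in> asymptotic_components X shift_dist shift"
  shows "\<exists>i j. i < j \<and> j < (3::nat) \<and> C i = C j"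
proof (rule ccontr)
  assume ne: "\<not> ?thesis"
  define P where "P = (\<lambda>i x. x \<in> X \<and> orbit X shift x \<in> C i \<and>
      (\<exists>y\<in>X. (\<forall>k<0. x k = y k) \<and> x 0 \<noteq> y 0))"
  have "\<exists>x. P i x" if "i < 3" for i
    using component_special[OF C[OF that]] unfolding P_def by blast
  then obtain x where "\<And>i. i < 3 \<Longrightarrow> P i (x i)" by metis
  then have x: "x i \<in> X" "orbit X shift (x i) \<in> C i"
    "\<exists>y\<in>X. (\<forall>k<0. x i k = y k) \<and> x i 0 \<noteq> y 0" if "i < 3" for i
    using that unfolding P_def by blast+
  have "\<exists>k<0. x i k \<noteq> x j k" if "i < j" "j < 3" for i j
    using component_eqI[OF C C, of i j "x i" "x j" 0 0] that ne x(1,2) by fastforce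
  then obtain f where f: "f i j < (0::int)" "x i (f i j) \<noteq> x j (f i j)"
    if "i < j" "j < 3" for i j
    by metis
  \<comment> \<open>The values of \<open>f\<close> with \<open>i \<ge> j\<close> are unspecified;
    they can only enlarge \<open>M\<close>.\<close>
  define M where "M = Max ((\<lambda>(i, j). nat (- f i j)) ` ({..<3} \<times> {..<3}))"
  have M: "- f i j \<le> int M" if "i < 3" "j < 3" for i j
  proof -
    have "nat (- f i j) \<le> M" unfolding M_def
      using that by (intro Max_ge) (auto intro!: image_eqI[of _ _ "(i, j)"])
    then show ?thesis by simp
  qed
  obtain N where N: "\<And>l. M \<le> length (W N l)" using long by blast
  obtain z \<alpha> \<beta> where m: "marks z \<alpha> \<beta> (W N a) (W N b)" using ex_marks_W[OF x(1)[of 0], of N] by auto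
  have "\<exists>l. \<forall>k<length (W N l) + length z.
      x i (- int (length z) - int (length (W N l)) + int k) = (W N l @ z) ! k" if i: "i < 3" for i
  proof -
    obtain y where "y \<in> X" "\<forall>k<0. x i k = y k" "x i 0 \<noteq> y 0" using x(3)[OF i] by blast
    from special_cut[OF x(1)[OF i] this m]
    obtain g where g: "parse (W N) (x i) g" "left_extends (W N) g" "g (- int (length z)) \<noteq> None"
      by blast
    then obtain l where l: "g (- int (length z) - int (length (W N l))) = Some l"
      by (auto simp: left_extends_def)
    then show ?thesis using parse_nth[OF g(1) m labels(2) l] by blast
  qed
  then obtain l where l: "\<And>i k. i < 3 \<Longrightarrow> k < length (W N (l i)) + length z \<Longrightarrow>
      x i (- int (length z) - int (length (W N (l i))) + int k) = (W N (l i) @ z) ! k"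
    by metis
  have differ: "l i \<noteq> l j" if ij: "i < j" "j < 3" for i j
  proof
    assume eq: "l i = l j"
    define k where "k = nat (int (length z) + int (length (W N (l i))) + f i j)"
    have "0 \<le> int (length z) + int (length (W N (l i))) + f i j"
      using M[of i j] N[of "l i"] ij by auto
    then have k: "int k = int (length z) + int (length (W N (l i))) + f i j" by (simp add: k_def)
    then have "k < length (W N (l i)) + length z" using f[OF ij] by linarith
    then show False using l[of i k] l[of j k] ij eq k f[OF ij] by auto
  qed
  show False
    using differ[of 0 1] differ[of 1 2] differ[of 0 2] labels(1)[of "l 0"] labels(1)[of "l 1"]
      labels(1)[of "l 2"] by auto
qed

lemma card_components:
  "finite (asymptotic_components X shift_dist shift) \<and>
   card (asymptotic_components X shift_dist shift) \<le> 2"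
proof (rule card_le_2I)
  fix C D E
  assume CDE: "C \<in> asymptotic_components X shift_dist shift"
    "D \<in> asymptotic_components X shift_dist shift" "E \<in> asymptotic_components X shift_dist shift"
  show "C = D \<or> D = E \<or> C = E"
  proof (cases "\<forall>M. \<exists>N. \<forall>l. M \<le> length (W N l)")
    case True
    have "\<exists>i j. i < j \<and> j < (3::nat) \<and> [C, D, E] ! i = [C, D, E] ! j"
      using CDE True
      by (intro components_eq_if_long_blocks) (auto simp: numeral_3_eq_3 less_Suc_eq)
    then show ?thesis by (auto simp: numeral_3_eq_3 less_Suc_eq)
  next
    case False
    \<comment> \<open>Which of the two letters has the short image may depend on
      \<open>N\<close>.\<close>
    then obtain M where "\<And>N. \<exists>l. length (W N l) < M" by (auto simp: not_le)
    then show ?thesis using components_eq_if_short_blocks CDE by blast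
  qed
qed

end

section \<open>Names in a nested sequence of Kakutani-Rohlin partitions\<close>

locale kr_system =
  fixes X :: "'x set" and d :: "'x \<Rightarrow> 'x \<Rightarrow> real" and T :: "'x \<Rightarrow> 'x" and P :: "nat \<Rightarrow> 'x kr"
  assumes compact: "compact_system X d T"
    and minimal: "minimal_system X d T"
    and nested: "nested_ckr X d T P"
    and nonempty: "X \<noteq> {}"
begin

sublocale bijective_system X d T
  by (rule bijective_system_if_compact_system[OF compact])

sublocale M: Metric_space X d
  by (rule metric)

section \<open>Continuity of the iterates and compactness\<close>

lemma T_continuous: "continuous_map M.mtopology M.mtopology T"
  and inv_T_continuous: "continuous_map M.mtopology M.mtopology (inv_into X T)"
proof -
  have "homeomorphic_map M.mtopology M.mtopology T"
    using compact by (simp add: compact_system_def)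
  then obtain g where g: "homeomorphic_maps M.mtopology M.mtopology T g"
    using homeomorphic_map_maps by blast
  then show "continuous_map M.mtopology M.mtopology T"
    by (simp add: homeomorphic_maps_def)
  have "g y = inv_into X T y" if "y \<in> X" for y
  proof -
    have "T (g y) = y" "g y \<in> X"
      using g that by (auto simp: homeomorphic_maps_def continuous_map_def)
    then show ?thesis using T_inv_T[OF that] inv_T_in[OF that] T_eq_iff by metis
  qed
  then show "continuous_map M.mtopology M.mtopology (inv_into X T)"
    using g continuous_map_eq[of M.mtopology M.mtopology g] by (simp add: homeomorphic_maps_def)
qed

lemma funpow_continuous:
  "continuous_map M.mtopology M.mtopology f \<Longrightarrow> continuous_map M.mtopology M.mtopology (f ^^ n)"
proof (induction n)
  case (Suc n)
  then have "continuous_map M.mtopology M.mtopology (f \<circ> f ^^ n)"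
    using continuous_map_compose by blast
  then show ?case by (simp only: funpow.simps)
qed (simp only: funpow.simps continuous_map_id)

lemma itr_continuous: "continuous_map M.mtopology M.mtopology (itr k)"
  by (auto simp: int_iter_def intro: funpow_continuous T_continuous inv_T_continuous)

lemma convergent_subsequence:
  fixes s :: "nat \<Rightarrow> 'x"
  assumes "\<And>n. s n \<in> X"
  obtains l r where "l \<in> X" "strict_mono r" "limitin M.mtopology (s \<circ> r) l sequentially"
proof -
  have "compact_space M.mtopology" using compact by (simp add: compact_system_def)
  note M.compact_space_sequentially[THEN iffD1, OF this, rule_format, of s]
  moreover have "range s \<subseteq> X" using assms by blast
  ultimately have "\<exists>l r. l \<in> X \<and> strict_mono r \<and> limitin M.mtopology (s \<circ> r) l sequentially" .
  then show ?thesis using that by blast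
qed

section \<open>Tower and level of a point\<close>

lemma ckr: "ckr_partition X d T (P n)"
  using nested by (simp add: nested_ckr_def)

definition idx :: "nat \<Rightarrow> 'x \<Rightarrow> nat \<times> nat" where
  "idx n x = (THE p. p \<in> kr_index (P n) \<and> x \<in> kr_level X T (P n) p)"

lemma idx_eqI:
  assumes "p \<in> kr_index (P n)" "x \<in> kr_level X T (P n) p"
  shows "idx n x = p"
  unfolding idx_def
proof (rule the_equality)
  fix q assume q: "q \<in> kr_index (P n) \<and> x \<in> kr_level X T (P n) q"
  have "disjoint_family_on (kr_level X T (P n)) (kr_index (P n))"
    using ckr[of n] by (simp add: ckr_partition_def)
  then show "q = p" using q assms disjoint_family_onD[of _ _ q p] by blast
qed (use assms in auto)

lemma idx_in:
  assumes "x \<in> X"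
  shows "idx n x \<in> kr_index (P n)" "x \<in> kr_level X T (P n) (idx n x)"
proof -
  have "x \<in> \<Union> (kr_levels X T (P n))"
    using ckr[of n] assms by (simp add: ckr_partition_def partition_on_def)
  then obtain p where "p \<in> kr_index (P n)" "x \<in> kr_level X T (P n) p"
    by (auto simp: kr_levels_def)
  then show "idx n x \<in> kr_index (P n)" "x \<in> kr_level X T (P n) (idx n x)"
    using idx_eqI by auto
qed

lemma idx_iff:
  assumes "x \<in> X"
  shows "idx n x = (k, j) \<longleftrightarrow>
         k \<in> {1..towers (P n)} \<and> j < height (P n) k \<and> (T ^^ j) x \<in> base (P n) k"
proof
  assume "idx n x = (k, j)"
  then show "k \<in> {1..towers (P n)} \<and> j < height (P n) k \<and> (T ^^ j) x \<in> base (P n) k"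
    using idx_in[OF assms, of n] by (auto simp: kr_index_def kr_level_def pull_def)
qed (use assms in \<open>intro idx_eqI; auto simp: kr_index_def kr_level_def pull_def\<close>)

lemma height_pos: "k \<in> {1..towers (P n)} \<Longrightarrow> 0 < height (P n) k"
  using ckr[of n] by (force simp: ckr_partition_def)

lemma idx_bounds: "x \<in> X \<Longrightarrow> fst (idx n x) \<in> {1..towers (P n)}"
  using idx_iff[of x n "fst (idx n x)" "snd (idx n x)"] by simp

lemma kr_base_iff: assumes "x \<in> X" shows "x \<in> kr_base (P n) \<longleftrightarrow> snd (idx n x) = 0"
proof
  assume "x \<in> kr_base (P n)"
  then obtain k where "k \<in> {1..towers (P n)}" "x \<in> base (P n) k" by (auto simp: kr_base_def)
  then have "idx n x = (k, 0)" using idx_iff[OF assms] height_pos by auto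
  then show "snd (idx n x) = 0" by simp
next
  assume "snd (idx n x) = 0"
  then have "idx n x = (fst (idx n x), 0)" by (metis prod.collapse)
  then show "x \<in> kr_base (P n)" using idx_iff[OF assms] by (auto simp: kr_base_def)
qed

lemma idx_T: "x \<in> X \<Longrightarrow> idx n x = (k, Suc j) \<Longrightarrow> idx n (T x) = (k, j)"
  by (simp add: idx_iff funpow_swap1)

text \<open>The last condition of a CKR partition, seen from the base: exactly the points of the
  base are sent by \<open>T\<close> to top levels of towers.\<close>

lemma base_iff_pull:
  assumes "x \<in> X"
  shows "x \<in> kr_base (P n) \<longleftrightarrow> (\<exists>k\<in>{1..towers (P n)}. idx n (T x) = (k, height (P n) k - 1))"
proof -
  have "x \<in> kr_base (P n) \<longleftrightarrow> (\<exists>k\<in>{1..towers (P n)}. (T ^^ height (P n) k) x \<in> base (P n) k)"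
    using ckr[of n] assms unfolding ckr_partition_def pull_def by auto
  also have "\<dots> \<longleftrightarrow> (\<exists>k\<in>{1..towers (P n)}. idx n (T x) = (k, height (P n) k - 1))"
  proof (rule bex_cong[OF refl])
    fix k assume k: "k \<in> {1..towers (P n)}"
    have "(T ^^ height (P n) k) x = (T ^^ (height (P n) k - 1)) (T x)"
      using height_pos[OF k] by (metis Suc_diff_1 comp_apply funpow_Suc_right)
    then show "(T ^^ height (P n) k) x \<in> base (P n) k \<longleftrightarrow> idx n (T x) = (k, height (P n) k - 1)"
      using assms k height_pos[OF k] by (simp add: idx_iff)
  qed
  finally show ?thesis .
qed

lemma base_mono: assumes "m \<le> n" shows "kr_base (P n) \<subseteq> kr_base (P m)"
  using assms
proof (induction rule: dec_induct)
  case (step n)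
  have "kr_base (P (Suc n)) \<subseteq> kr_base (P n)" using nested by (simp add: nested_ckr_def)
  then show ?case using step.IH by simp
qed simp

lemma idx_refine:
  assumes "m \<le> n" "x \<in> X" "y \<in> X" "idx n x = idx n y"
  shows "idx m x = idx m y"
  using assms(1,4)
proof (induction rule: dec_induct)
  case (step n)
  have "refines X (kr_levels X T (P (Suc n))) (kr_levels X T (P n))"
    using nested by (simp add: nested_ckr_def)
  moreover have "kr_level X T (P (Suc n)) (idx (Suc n) x) \<in> kr_levels X T (P (Suc n))"
    using idx_in[OF assms(2)] by (auto simp: kr_levels_def)
  ultimately obtain q where "q \<in> kr_index (P n)"
    "kr_level X T (P (Suc n)) (idx (Suc n) x) \<subseteq> kr_level X T (P n) q"
    unfolding refines_def kr_levels_def by blast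
  then have "idx n x = q" "idx n y = q"
    using idx_in[OF assms(2)] idx_in[OF assms(3)] step.prems by (metis idx_eqI subsetD)+
  then show ?case using step by simp
qed simp

lemma openin_level:
  assumes "p \<in> kr_index (P n)"
  shows "openin M.mtopology (kr_level X T (P n) p)"
proof -
  obtain k j where p: "p = (k, j)" "k \<in> {1..towers (P n)}"
    using assms by (auto simp: kr_index_def)
  have "openin M.mtopology (base (P n) k)"
    using ckr[of n] p(2) by (auto simp: ckr_partition_def)
  then have "openin M.mtopology {x \<in> topspace M.mtopology. (T ^^ j) x \<in> base (P n) k}"
    by (rule openin_continuous_map_preimage[OF funpow_continuous[OF T_continuous]])
  then show ?thesis by (simp add: p kr_level_def pull_def)
qed

lemma openin_idx: "openin M.mtopology {x \<in> X. idx n x = p}"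
proof (cases "p \<in> kr_index (P n)")
  case True
  have "kr_level X T (P n) p \<subseteq> X"
    by (auto simp: kr_level_def pull_def split: prod.split)
  then have "{x \<in> X. idx n x = p} = kr_level X T (P n) p"
    using True idx_eqI idx_in by blast
  then show ?thesis using openin_level[OF True] by simp
next
  case False
  then have "{x \<in> X. idx n x = p} = {}" using idx_in by blast
  then show ?thesis by (simp only: openin_empty)
qed

lemma topology_levels: "topology_generated_by (\<Union>n. kr_levels X T (P n)) = M.mtopology"
  using nested by (simp add: nested_ckr_def)

text \<open>Points that lie in the same levels belong to the same sets of the topology generated by
  the levels, and a metric topology is Hausdorff.\<close>

lemma idx_separates:
  assumes "x \<in> X" "y \<in> X" "\<And>n. idx n x = idx n y"
  shows "x = y"
proof (rule ccontr)
  assume "x \<noteq> y"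
  have same: "x \<in> U \<longleftrightarrow> y \<in> U" if "generate_topology_on (\<Union>n. kr_levels X T (P n)) U" for U
    using that
  proof (induction rule: generate_topology_on.induct)
    case (Basis s)
    then obtain n p where s: "p \<in> kr_index (P n)" "s = kr_level X T (P n) p"
      by (auto simp: kr_levels_def)
    then show ?case using idx_eqI[OF s(1)] idx_in(2) assms by metis
  qed auto
  obtain U where "openin M.mtopology U" "x \<in> U" "y \<notin> U"
    using M.Hausdorff_space_mtopology assms \<open>x \<noteq> y\<close>
    by (metis Hausdorff_space_def M.topspace_mtopology disjnt_iff)
  then show False
    using same topology_levels by (metis openin_topology_generated_by_iff)
qed

text \<open>The levels are open, so \<open>idx m\<close> is locally constant.\<close>

lemma idx_limit:
  assumes "limitin M.mtopology s l sequentially"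
  shows "\<forall>\<^sub>F n in sequentially. idx m (itr i (s n)) = idx m (itr i l)"
proof -
  have "limitin M.mtopology (\<lambda>n. itr i (s n)) (itr i l) sequentially"
    using continuous_map_limit[OF itr_continuous assms] by (simp add: comp_def)
  moreover have "itr i l \<in> X" using assms by (auto simp: limitin_def)
  ultimately have "\<forall>\<^sub>F n in sequentially. itr i (s n) \<in> {x \<in> X. idx m x = idx m (itr i l)}"
    using openin_idx[of m "idx m (itr i l)"] unfolding limitin_def by blast
  then show ?thesis by (rule eventually_mono) simp
qed

section \<open>Names and asymptotic pairs\<close>

definition name :: "nat \<Rightarrow> 'x \<Rightarrow> int \<Rightarrow> nat \<times> nat" where
  "name n x i = idx n (itr i x)"

lemma name_itr: "x \<in> X \<Longrightarrow> name n (itr k x) i = name n x (i + k)"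
  by (simp add: name_def itr_add)

lemma name_refine:
  "m \<le> n \<Longrightarrow> x \<in> X \<Longrightarrow> y \<in> X \<Longrightarrow> name n x i = name n y j \<Longrightarrow> name m x i = name m y j"
  unfolding name_def by (rule idx_refine) auto

lemma limitin_dist_tendsto_0:
  assumes "limitin M.mtopology s l sequentially" "limitin M.mtopology t l sequentially"
    and "\<And>n. s n \<in> X" "\<And>n. t n \<in> X"
  shows "(\<lambda>n. d (s n) (t n)) \<longlonglongrightarrow> 0"
proof -
  have l: "l \<in> X" "(\<lambda>n. d (s n) l) \<longlonglongrightarrow> 0" "(\<lambda>n. d (t n) l) \<longlonglongrightarrow> 0"
    using assms by (simp_all add: M.limitin_metric_dist_null)
  have le: "norm (d (s n) (t n)) \<le> d (s n) l + d (t n) l" for n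
    using M.triangle[of "s n" l "t n"] M.commute[of l "t n"] assms l(1) by simp
  have lim: "(\<lambda>n. d (s n) l + d (t n) l) \<longlonglongrightarrow> 0"
    using tendsto_add[OF l(2,3)] by simp
  show ?thesis
    by (rule Lim_null_comparison[OF always_eventually[OF allI[OF le]] lim])
qed

lemma limitin_if_dist_tendsto_0:
  assumes "limitin M.mtopology s l sequentially" "(\<lambda>n. d (s n) (t n)) \<longlonglongrightarrow> 0"
    and "\<And>n. s n \<in> X" "\<And>n. t n \<in> X"
  shows "limitin M.mtopology t l sequentially"
proof -
  have l: "l \<in> X" "(\<lambda>n. d (s n) l) \<longlonglongrightarrow> 0"
    using assms by (simp_all add: M.limitin_metric_dist_null)
  have le: "norm (d (t n) l) \<le> d (s n) (t n) + d (s n) l" for n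
    using M.triangle[of "t n" "s n" l] M.commute[of "t n" "s n"] assms l(1) by simp
  have lim: "(\<lambda>n. d (s n) (t n) + d (s n) l) \<longlonglongrightarrow> 0"
    using tendsto_add[OF assms(2) l(2)] by simp
  have "(\<lambda>n. d (t n) l) \<longlonglongrightarrow> 0"
    by (rule Lim_null_comparison[OF always_eventually[OF allI[OF le]] lim])
  then show ?thesis using l assms(4) by (simp add: M.limitin_metric_dist_null)
qed

text \<open>If the names differed at arbitrarily early times, the two orbits at those times would
  accumulate at one common point, near which \<open>idx n\<close> is constant.\<close>

lemma asymptotic_imp_names:
  assumes X: "x \<in> X" "y \<in> X" and as: "asymptotic X d T x y"
  shows "\<exists>c. \<forall>i\<le>c. name n x i = name n y i"
proof (rule ccontr)
  assume "\<not> ?thesis"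
  then have "\<forall>k. \<exists>i. i \<le> - int k \<and> name n x i \<noteq> name n y i" by blast
  then obtain i where i: "\<And>k. i k \<le> - int k" "\<And>k. name n x (i k) \<noteq> name n y (i k)" by metis
  obtain l r where l: "l \<in> X" "strict_mono r"
    "limitin M.mtopology ((\<lambda>k. itr (i k) x) \<circ> r) l sequentially"
    using convergent_subsequence[of "\<lambda>k. itr (i k) x"] X by auto
  have "k \<le> nat (- i (r k))" for k
    using i(1)[of "r k"] strict_mono_imp_increasing[OF l(2), of k] by linarith
  then have "filterlim (\<lambda>k. nat (- i (r k))) sequentially sequentially"
    by (intro filterlim_at_top_mono[OF filterlim_ident]) auto
  from filterlim_compose[OF as[unfolded asymptotic_def] this]
  have "(\<lambda>k. d (((\<lambda>k. itr (i k) x) \<circ> r) k) (itr (i (r k)) y)) \<longlonglongrightarrow> 0"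
  proof (rule Lim_transform_eventually)
    have "- int (nat (- i k)) = i k" for k using i(1)[of k] by simp
    then show "\<forall>\<^sub>F k in sequentially. d (itr (- int (nat (- i (r k)))) x) (itr (- int (nat (- i (r k)))) y) =
      d (((\<lambda>k. itr (i k) x) \<circ> r) k) (itr (i (r k)) y)" by simp
  qed
  then have ly: "limitin M.mtopology (\<lambda>k. itr (i (r k)) y) l sequentially"
    using X by (intro limitin_if_dist_tendsto_0[OF l(3)]) auto
  have "\<forall>\<^sub>F k in sequentially. idx n (itr (i (r k)) x) = idx n (itr (i (r k)) y)"
    using idx_limit[OF l(3), of n 0] idx_limit[OF ly, of n 0]
    by eventually_elim simp
  then show False using i(2) by (auto simp: name_def eventually_sequentially)
qed

text \<open>If the distances did not tend to \<open>0\<close>, a common subsequence of times with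
  distances bounded below would have limits \<open>a\<close> and \<open>b\<close>; these share their
  indices at all levels, so they coincide.\<close>

lemma names_imp_asymptotic:
  assumes X: "x \<in> X" "y \<in> X" and as: "\<And>n. \<exists>c. \<forall>i\<le>c. name n x i = name n y i"
  shows "asymptotic X d T x y"
  unfolding asymptotic_def
proof (rule ccontr)
  let ?f = "\<lambda>n. d (itr (- int n) x) (itr (- int n) y)"
  assume "\<not> ?f \<longlonglongrightarrow> 0"
  then obtain e where e: "e > 0" "\<forall>N. \<exists>n\<ge>N. \<not> norm (?f n - 0) < e"
    unfolding LIMSEQ_iff by blast
  then obtain s where s: "\<And>N. s N \<ge> N" "\<And>N. \<not> norm (?f (s N) - 0) < e" by metis
  obtain a r where a: "a \<in> X" "strict_mono r"
    "limitin M.mtopology ((\<lambda>k. itr (- int (s k)) x) \<circ> r) a sequentially"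
    using convergent_subsequence[of "\<lambda>k. itr (- int (s k)) x"] X by auto
  obtain b r' where b: "b \<in> X" "strict_mono r'"
    "limitin M.mtopology ((\<lambda>k. itr (- int (s (r k))) y) \<circ> r') b sequentially"
    using convergent_subsequence[of "\<lambda>k. itr (- int (s (r k))) y"] X by auto
  let ?s = "\<lambda>k. s (r (r' k))"
  have la: "limitin M.mtopology (\<lambda>k. itr (- int (?s k)) x) a sequentially"
    using limitin_subsequence[OF b(2) a(3)] by (simp add: o_def)
  have lb: "limitin M.mtopology (\<lambda>k. itr (- int (?s k)) y) b sequentially"
    using b(3) by (simp add: o_def)
  have sk: "k \<le> ?s k" for k
    using s(1)[of "r (r' k)"] strict_mono_imp_increasing[OF a(2), of "r' k"]
      strict_mono_imp_increasing[OF b(2), of k] by linarith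
  have "idx n a = idx n b" for n
  proof -
    obtain c where c: "\<And>i. i \<le> c \<Longrightarrow> name n x i = name n y i" using as by blast
    have "\<forall>\<^sub>F k in sequentially. name n x (- int (?s k)) = name n y (- int (?s k))"
      using eventually_ge_at_top[of "nat (- c)"]
    proof eventually_elim
      case (elim k)
      then show ?case using sk[of k] by (intro c) linarith
    qed
    with idx_limit[OF la, of n 0] idx_limit[OF lb, of n 0]
    have "\<forall>\<^sub>F k in sequentially. idx n a = idx n b"
      by eventually_elim (simp add: name_def)
    then show ?thesis by simp
  qed
  then have "a = b" using a b idx_separates by blast
  then have "(\<lambda>k. ?f (?s k)) \<longlonglongrightarrow> 0"
    using X by (intro limitin_dist_tendsto_0[OF la]) (auto simp: lb)
  then have "\<exists>k. norm (?f (?s k) - 0) < e" using e(1) unfolding LIMSEQ_iff by blast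
  then show False using s(2) by blast
qed

text \<open>Points of deep bases whose names at time \<open>i\<close> differ from that of
  \<open>a\<close> would accumulate at a point of all the bases, which can only be \<open>a\<close>,
  and names are locally constant there.\<close>

lemma bases_shrink:
  obtains a where "a \<in> X"
    "\<And>m i. \<forall>\<^sub>F n in sequentially. \<forall>x\<in>X \<inter> kr_base (P n). name m x i = name m a i"
proof -
  obtain a where a: "(\<Inter>n. kr_base (P n)) = {a}" using nested by (auto simp: nested_ckr_def)
  have "kr_base (P 0) \<subseteq> X"
  proof -
    have "openin M.mtopology (base (P 0) k)" if "k \<in> {1..towers (P 0)}" for k
      using ckr[of 0] that by (simp add: ckr_partition_def)
    then have "base (P 0) k \<subseteq> X" if "k \<in> {1..towers (P 0)}" for k
      using openin_subset that by fastforce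
    then show ?thesis unfolding kr_base_def by blast
  qed
  then have aX: "a \<in> X" using a by blast
  have "\<forall>\<^sub>F n in sequentially. \<forall>x\<in>X \<inter> kr_base (P n). name m x i = name m a i" for m i
  proof (rule ccontr)
    assume "\<not> ?thesis"
    then have "\<forall>N. \<exists>n x. n \<ge> N \<and> x \<in> X \<and> x \<in> kr_base (P n) \<and> name m x i \<noteq> name m a i"
      unfolding eventually_sequentially by blast
    then obtain n x where nx: "\<And>N. n N \<ge> N" "\<And>N. x N \<in> X" "\<And>N. x N \<in> kr_base (P (n N))"
      "\<And>N. name m (x N) i \<noteq> name m a i" by metis
    obtain l r where l: "l \<in> X" "strict_mono r" "limitin M.mtopology (x \<circ> r) l sequentially"
      using convergent_subsequence[of x] nx(2) by blast
    have "l \<in> kr_base (P p)" for p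
    proof -
      have "\<forall>\<^sub>F k in sequentially. (x \<circ> r) k \<in> kr_base (P p)"
        using eventually_ge_at_top[of p]
      proof eventually_elim
        case (elim k)
        then have "p \<le> n (r k)"
          using nx(1)[of "r k"] strict_mono_imp_increasing[OF l(2), of k] by linarith
        then show ?case using nx(3)[of "r k"] base_mono by auto
      qed
      with idx_limit[OF l(3), of p 0] have "\<forall>\<^sub>F k in sequentially. l \<in> kr_base (P p)"
      proof eventually_elim
        case (elim k)
        then show ?case using kr_base_iff[OF l(1)] kr_base_iff[OF nx(2)] by simp
      qed
      then show ?thesis by simp
    qed
    then have "l = a" using a by blast
    then show False using idx_limit[OF l(3), of m i] nx(4)
      by (auto simp: name_def eventually_sequentially)
  qed
  then show ?thesis using that aX by blast
qed

lemma bases_shrink_window: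
  "\<exists>N. \<forall>n\<ge>N. \<forall>x\<in>X \<inter> kr_base (P n). \<forall>y\<in>X \<inter> kr_base (P n). \<forall>i. \<bar>i\<bar> \<le> int s \<longrightarrow>
     name m x i = name m y i"
proof -
  obtain a where a: "\<And>m i. \<forall>\<^sub>F n in sequentially. \<forall>x\<in>X \<inter> kr_base (P n). name m x i = name m a i"
    using bases_shrink by blast
  have "\<forall>\<^sub>F n in sequentially. \<forall>i\<in>{- int s..int s}. \<forall>x\<in>X \<inter> kr_base (P n). name m x i = name m a i"
    by (rule eventually_ball_finite) (use a in auto)
  then obtain N where N: "\<And>n i x. n \<ge> N \<Longrightarrow> i \<in> {- int s..int s} \<Longrightarrow> x \<in> X \<inter> kr_base (P n) \<Longrightarrow>
      name m x i = name m a i"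
    unfolding eventually_sequentially by blast
  have "name m x i = name m y i"
    if "n \<ge> N" "x \<in> X \<inter> kr_base (P n)" "y \<in> X \<inter> kr_base (P n)" "\<bar>i\<bar> \<le> int s" for n x y i
  proof -
    have "i \<in> {- int s..int s}" using that(4) by auto
    then show ?thesis using N[OF that(1) _ that(2)] N[OF that(1) _ that(3)] by simp
  qed
  then show ?thesis by blast
qed

section \<open>Cuts and tower words\<close>

text \<open>
  A crossing of a tower runs from its top level down to its base, so a crossing starts at
  time \<open>i\<close> if and only if the point is in the base at time \<open>i - 1\<close>.
\<close>

definition cut :: "nat \<Rightarrow> 'x \<Rightarrow> int \<Rightarrow> nat option" where
  "cut n x i = (if itr (i - 1) x \<in> kr_base (P n) then Some (fst (name n x i)) else None)"

text \<open>For \<open>m \<le> n\<close> the point chosen by \<open>SOME\<close> does not matter,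
  because \<open>idx m\<close> is constant on the levels of \<open>P n\<close>. The index runs
  downwards because \<open>T\<close> moves from the top level to the base.\<close>

definition tower_word :: "nat \<Rightarrow> nat \<Rightarrow> nat \<Rightarrow> (nat \<times> nat) list" where
  "tower_word m n k =
     map (\<lambda>j. idx m (SOME x. x \<in> X \<and> idx n x = (k, height (P n) k - 1 - j))) [0..<height (P n) k]"

lemma cut_iff_top:
  assumes "x \<in> X"
  shows "cut n x i = Some k \<longleftrightarrow> k \<in> {1..towers (P n)} \<and> name n x i = (k, height (P n) k - 1)"
proof -
  have "T (itr (i - 1) x) = itr i x" using T_itr[OF assms, of "i - 1"] by simp
  then show ?thesis
    using base_iff_pull[of "itr (i - 1) x" n] assms by (auto simp: cut_def name_def)
qed

lemma cut_not_None_iff: "x \<in> X \<Longrightarrow> cut n x i \<noteq> None \<longleftrightarrow> snd (name n x (i - 1)) = 0"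
  by (simp add: cut_def name_def kr_base_iff)

lemma cut_itr: "x \<in> X \<Longrightarrow> cut n (itr k x) i = cut n x (i + k)"
  by (simp add: cut_def name_itr itr_add[symmetric] algebra_simps)

lemma cut_mono: "m \<le> n \<Longrightarrow> cut n x i \<noteq> None \<Longrightarrow> cut m x i \<noteq> None"
  using base_mono by (auto simp: cut_def split: if_splits)

lemma name_after_cut:
  assumes "x \<in> X" "cut n x c = Some k"
  shows "j < height (P n) k \<Longrightarrow> name n x (c + int j) = (k, height (P n) k - 1 - j)"
proof (induction j)
  case 0
  then show ?case using cut_iff_top assms by simp
next
  case (Suc j)
  have "idx n (itr (c + int j) x) = (k, Suc (height (P n) k - 1 - Suc j))"
    using Suc by (simp add: name_def Suc_diff_Suc)
  from idx_T[OF _ this] have "idx n (itr (c + int j + 1) x) = (k, height (P n) k - 1 - Suc j)"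
    using assms T_itr by simp
  then show ?case by (simp add: name_def algebra_simps)
qed

lemma ran_cut: "x \<in> X \<Longrightarrow> ran (cut n x) \<subseteq> {1..towers (P n)}"
  using cut_iff_top by (auto simp: ran_def)

lemma length_tower_word: "length (tower_word m n k) = height (P n) k"
  by (simp add: tower_word_def)

lemma tower_word_nonempty: "k \<in> {1..towers (P n)} \<Longrightarrow> tower_word m n k \<noteq> []"
  using height_pos[of k n] length_tower_word[of m n k] by auto

lemma parse_name:
  assumes "x \<in> X" "m \<le> n"
  shows "parse (tower_word m n) (name m x) (cut n x)"
  unfolding parse_def
proof (intro allI impI conjI)
  fix c k assume c: "cut n x c = Some k"
  have k: "k \<in> {1..towers (P n)}" using c cut_iff_top assms by simp
  show "tower_word m n k \<noteq> []" using tower_word_nonempty[OF k] .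
  show "name m x (c + int j) = tower_word m n k ! j" if "j < length (tower_word m n k)" for j
  proof -
    have j: "j < height (P n) k" using that by (simp add: length_tower_word)
    let ?P = "\<lambda>y. y \<in> X \<and> idx n y = (k, height (P n) k - 1 - j)"
    have "?P (itr (c + int j) x)"
      using name_after_cut[OF assms(1) c j] assms by (simp add: name_def)
    from this someI[of ?P, OF this] have "idx m (itr (c + int j) x) = idx m (SOME y. ?P y)"
      by (intro idx_refine[OF assms(2)]) auto
    then show ?thesis using j by (simp add: name_def tower_word_def)
  qed
  have "name n x (c + int (height (P n) k - 1)) = (k, 0)"
    using name_after_cut[OF assms(1) c, of "height (P n) k - 1"] height_pos[OF k] by simp
  moreover have "c + int (height (P n) k - 1) = c + int (height (P n) k) - 1"
    using height_pos[OF k] by simp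
  ultimately have "snd (name n x (c + int (height (P n) k) - 1)) = 0" by (metis snd_conv)
  then show "cut n x (c + int (length (tower_word m n k))) \<noteq> None"
    using cut_not_None_iff[OF assms(1)] by (simp add: length_tower_word)
qed

text \<open>The cut is the start of the tower passage to which time \<open>0\<close>
  belongs.\<close>

lemma cut_before:
  assumes "x \<in> X"
  shows "\<exists>c\<le>0. cut n x c \<noteq> None"
proof -
  obtain k j where kj: "idx n x = (k, j)" by fastforce
  then have k: "k \<in> {1..towers (P n)}" "j < height (P n) k" "(T ^^ j) x \<in> base (P n) k"
    using idx_iff[OF assms] by auto
  define i where "i = height (P n) k - 1 - j"
  have "(T ^^ (height (P n) k - 1)) (itr (- int i) x) = itr (int (height (P n) k - 1)) (itr (- int i) x)"
    by (simp add: itr_of_nat)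
  also have "\<dots> = itr (int j) x"
    using k(2) assms by (simp add: itr_add[symmetric] i_def)
  also have "\<dots> \<in> base (P n) k" using k by (simp add: itr_of_nat)
  finally have "idx n (itr (- int i) x) = (k, height (P n) k - 1)"
    using assms k by (simp add: idx_iff)
  then have "cut n x (- int i) = Some k" using cut_iff_top[OF assms] k by (simp add: name_def)
  then show ?thesis by (intro exI[of _ "- int i"]) simp
qed

section \<open>Periodic levels\<close>

definition periodic :: "nat \<Rightarrow> bool" where
  "periodic m \<longleftrightarrow> (\<exists>h\<ge>1. \<forall>x\<in>X. idx m (itr (int h) x) = idx m x)"

lemma periodic_mono:
  assumes "m \<le> n" "periodic n"
  shows "periodic m"
proof -
  obtain h where h: "h \<ge> 1" "\<And>x. x \<in> X \<Longrightarrow> idx n (itr (int h) x) = idx n x"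
    using assms(2) by (auto simp: periodic_def)
  have "idx m (itr (int h) x) = idx m x" if "x \<in> X" for x
    by (rule idx_refine[OF assms(1)]) (use that h(2) in auto)
  then show ?thesis using h(1) by (auto simp: periodic_def)
qed

text \<open>The period of \<open>parse_commuting_periodic\<close> is valid after a cut, and
  \<open>cut_before\<close> puts a cut at or before time \<open>0\<close> for every point.\<close>

lemma periodic_if_commuting:
  assumes "m \<le> n" "a \<in> {1..towers (P n)}" "b \<in> {1..towers (P n)}" "{1..towers (P n)} \<subseteq> {a, b}"
    and "tower_word m n a @ tower_word m n b = tower_word m n b @ tower_word m n a"
  shows "periodic m"
proof -
  from parse_commuting_periodic[of "tower_word m n", OF assms(5)
    tower_word_nonempty[OF assms(2)] tower_word_nonempty[OF assms(3)]]
  obtain h where h: "h \<ge> 1" and per: "\<forall>s g c. parse (tower_word m n) s g \<longrightarrow> ran g \<subseteq> {a, b} \<longrightarrow>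
      g c \<noteq> None \<longrightarrow> (\<forall>i\<ge>c. s (i + int h) = s i)"
    using assms(2,3) by blast
  have "idx m (itr (int h) x) = idx m x" if x: "x \<in> X" for x
  proof -
    obtain c where c: "c \<le> 0" "cut n x c \<noteq> None" using cut_before[OF x] by blast
    have "ran (cut n x) \<subseteq> {a, b}" using ran_cut[OF x] assms(4) by blast
    then have "\<forall>i\<ge>c. name m x (i + int h) = name m x i"
      using per parse_name[OF x assms(1)] c(2) by blast
    then have "name m x (0 + int h) = name m x 0" using c(1) by blast
    then show ?thesis by (simp add: name_def)
  qed
  then show ?thesis using h by (auto simp: periodic_def)
qed

lemma towers_pos: "0 < towers (P n)"
proof -
  obtain x where "x \<in> X" using nonempty by blast
  from idx_bounds[OF this, of n] show ?thesis by auto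
qed

text \<open>The commuting case with both labels equal.\<close>

lemma periodic_if_one_tower:
  assumes "towers (P n) \<le> 1"
  shows "periodic n"
proof -
  have "towers (P n) = 1" using assms towers_pos[of n] by simp
  then show ?thesis by (intro periodic_if_commuting[of n n 1 1]) auto
qed

lemma orbit_meets:
  assumes "x \<in> X" "openin M.mtopology U" "U \<noteq> {}"
  shows "\<exists>i. itr i x \<in> U"
proof -
  obtain y where y: "y \<in> U" using assms by blast
  then have "y \<in> X" using openin_subset[OF assms(2)] by auto
  then have "y \<in> M.mtopology closure_of orbit X T x"
    using minimal assms(1) by (simp add: minimal_system_def)
  then obtain z where "z \<in> orbit X T x" "z \<in> U"
    using y assms(2) by (auto simp: in_closure_of)
  then show ?thesis by (auto simp: orbit_def)
qed

lemma openin_name: "openin M.mtopology {x \<in> X. name m x i = p}"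
proof -
  have "openin M.mtopology {x \<in> topspace M.mtopology. itr i x \<in> {x \<in> X. idx m x = p}}"
    by (rule openin_continuous_map_preimage[OF itr_continuous openin_idx])
  then show ?thesis by (simp add: name_def cong: conj_cong)
qed

text \<open>By minimality the orbit of \<open>a\<close> visits the open set of points that have the
  same indices as \<open>x\<close> at the times \<open>0\<close> and \<open>q\<close>.\<close>

lemma period_spreads:
  assumes a: "a \<in> X" "\<And>i. name m a (i + q) = name m a i" and x: "x \<in> X"
  shows "idx m (itr q x) = idx m x"
proof -
  let ?U = "{y \<in> X. name m y 0 = idx m x} \<inter> {y \<in> X. name m y q = idx m (itr q x)}"
  have "openin M.mtopology ?U" by (intro openin_Int openin_name)
  moreover have "x \<in> ?U" using x by (simp add: name_def)
  ultimately obtain i where "itr i a \<in> ?U" using orbit_meets[OF a(1)] by blast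
  then have "name m a i = idx m x" "name m a (i + q) = idx m (itr q x)"
    using a(1) by (auto simp: name_itr add.commute)
  then show ?thesis using a(2) by simp
qed

end

section \<open>Rank one\<close>

locale periodic_system = kr_system X d T P
  for X :: "'x set" and d T P +
  fixes a :: 'x
  assumes all_periodic: "periodic m"
    and a: "a \<in> X"
begin

definition h :: "nat \<Rightarrow> nat" where
  "h m = (LEAST q. 1 \<le> q \<and> (\<forall>x\<in>X. idx m (itr (int q) x) = idx m x))"

lemma h: "1 \<le> h m" "x \<in> X \<Longrightarrow> idx m (itr (int (h m)) x) = idx m x"
proof -
  have "\<exists>q. 1 \<le> q \<and> (\<forall>x\<in>X. idx m (itr (int q) x) = idx m x)"
    using all_periodic[of m] by (auto simp: periodic_def)
  from LeastI_ex[OF this] show "1 \<le> h m" "x \<in> X \<Longrightarrow> idx m (itr (int (h m)) x) = idx m x"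
    unfolding h_def by blast+
qed

lemma h_le: "1 \<le> q \<Longrightarrow> (\<And>x. x \<in> X \<Longrightarrow> idx m (itr (int q) x) = idx m x) \<Longrightarrow> h m \<le> q"
  unfolding h_def by (rule Least_le) blast

lemma name_h: assumes "x \<in> X" shows "name m x (i + k * int (h m)) = name m x i"
proof (induction k rule: int_induct[where k = 0])
  case (step1 k)
  then show ?case
    using h(2)[of "itr (i + k * int (h m)) x" m] assms
    by (simp add: name_def itr_add[symmetric] algebra_simps)
next
  case (step2 k)
  then show ?case
    using h(2)[of "itr (i + (k - 1) * int (h m)) x" m] assms
    by (simp add: name_def itr_add[symmetric] algebra_simps)
qed simp

text \<open>The points in phase with \<open>a\<close>; they become the base of the single tower of
  height \<open>h m\<close>.\<close>

definition B :: "nat \<Rightarrow> 'x set" where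
  "B m = {x \<in> X. \<forall>i. name m x i = name m a i}"

lemma B_subset: "B m \<subseteq> X"
  by (auto simp: B_def)

lemma a_in_B: "a \<in> B m"
  using a by (simp add: B_def)

lemma B_shift: "x \<in> X \<Longrightarrow> itr (i + k * int (h m)) x \<in> B m \<longleftrightarrow> itr i x \<in> B m"
  using name_h[of x m] by (simp add: B_def name_itr add.assoc[symmetric])

lemma B_mod: "x \<in> X \<Longrightarrow> itr (i mod int (h m)) x \<in> B m \<longleftrightarrow> itr i x \<in> B m"
  using B_shift[of x "i mod int (h m)" "i div int (h m)" m] by simp

lemma B_mono: "m \<le> n \<Longrightarrow> B n \<subseteq> B m"
  using name_refine[OF _ _ a] by (auto simp: B_def)

text \<open>Periodicity reduces the conditions to those at the times of one period, and a finite
  intersection remains.\<close>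

lemma openin_B: "openin M.mtopology (B m)"
proof -
  have "B m = (\<Inter>i\<in>{..<h m}. {x \<in> X. name m x (int i) = name m a (int i)})"
  proof
    show "(\<Inter>i\<in>{..<h m}. {x \<in> X. name m x (int i) = name m a (int i)}) \<subseteq> B m"
    proof
      fix x assume x: "x \<in> (\<Inter>i\<in>{..<h m}. {x \<in> X. name m x (int i) = name m a (int i)})"
      have "0 \<in> {..<h m}" using h(1)[of m] by simp
      then have xX: "x \<in> X" using x by blast
      have "name m x i = name m a i" for i
      proof -
        have "nat (i mod int (h m)) \<in> {..<h m}"
          using h(1)[of m] by (simp add: nat_less_iff)
        then have "name m x (int (nat (i mod int (h m)))) = name m a (int (nat (i mod int (h m))))"
          using x by blast
        then have "name m x (i mod int (h m)) = name m a (i mod int (h m))"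
          using h(1)[of m] by simp
        then show ?thesis
          using name_h[OF xX, of m "i mod int (h m)" "i div int (h m)"]
            name_h[OF a, of m "i mod int (h m)" "i div int (h m)"] by simp
      qed
      then show "x \<in> B m" using xX by (simp add: B_def)
    qed
  qed (auto simp: B_def)
  moreover have "0 \<in> {..<h m}" using h(1)[of m] by simp
  then have "openin M.mtopology (\<Inter>i\<in>{..<h m}. {x \<in> X. name m x (int i) = name m a (int i)})"
    by (intro openin_INT2 openin_name) blast+
  ultimately show ?thesis by simp
qed

lemma closedin_B: "closedin M.mtopology (B m)"
proof -
  have "openin M.mtopology (\<Union>(i, p)\<in>{(i, p). p \<noteq> name m a i}. {x \<in> X. name m x i = p})"
    by (intro openin_Union) (auto intro: openin_name)
  moreover have "(\<Union>(i, p)\<in>{(i, p). p \<noteq> name m a i}. {x \<in> X. name m x i = p}) = X - B m"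
    by (auto simp: B_def)
  ultimately show ?thesis using B_subset by (simp add: closedin_def)
qed

lemma B_cover:
  assumes "x \<in> X"
  shows "\<exists>j<h m. itr (int j) x \<in> B m"
proof -
  obtain i where "itr i x \<in> B m"
    using orbit_meets[OF assms openin_B] a_in_B by blast
  then have "itr (int (nat (i mod int (h m)))) x \<in> B m" using B_mod[OF assms] h(1)[of m] by simp
  moreover have "nat (i mod int (h m)) < h m" using h(1)[of m] by (simp add: nat_less_iff)
  ultimately show ?thesis by blast
qed

text \<open>Two visits to \<open>B m\<close> within one period would give the name of
  \<open>a\<close> a smaller period, and \<open>period_spreads\<close> would extend it to all
  points, contrary to the choice of \<open>h m\<close>.\<close>

lemma B_disjoint:
  assumes x: "x \<in> X" and j: "j < h m" "j' < h m" "itr (int j) x \<in> B m" "itr (int j') x \<in> B m"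
  shows "j = j'"
proof -
  have *: "\<not> j < j'" if j: "j < h m" "j' < h m" "itr (int j) x \<in> B m" "itr (int j') x \<in> B m" for j j'
  proof
    assume jj: "j < j'"
    define q where "q = j' - j"
    have jq: "int j' = int j + int q" using jj by (simp add: q_def)
    have "name m a (i + int q) = name m a i" for i
    proof -
      have "name m a (i + int q) = name m x (i + int q + int j)"
        using j(3) x by (simp add: B_def name_itr)
      also have "\<dots> = name m x (i + int j')" by (simp add: jq algebra_simps)
      also have "\<dots> = name m a i" using j(4) x by (simp add: B_def name_itr)
      finally show ?thesis .
    qed
    then have "h m \<le> q"
      using jj period_spreads[OF a] by (intro h_le) (auto simp: q_def)
    then show False using j jj by (simp add: q_def)
  qed
  show ?thesis using *[OF j] *[OF j(2,1,4,3)] by simp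
qed

definition Q :: "nat \<Rightarrow> 'x kr" where
  "Q m = \<lparr>towers = 1, height = (\<lambda>_. h m), base = (\<lambda>_. B m)\<rparr>"

lemma Q_simps: "towers (Q m) = 1" "height (Q m) k = h m" "base (Q m) k = B m"
  by (simp_all add: Q_def)

lemma kr_base_Q: "kr_base (Q m) = B m"
  by (simp add: kr_base_def Q_simps)

lemma kr_index_Q: "kr_index (Q m) = {1} \<times> {..<h m}"
  by (simp add: kr_index_def Q_simps)

lemma kr_level_Q: "kr_level X T (Q m) (k, j) = {x \<in> X. itr (int j) x \<in> B m}"
  by (simp add: kr_level_def pull_def Q_simps itr_of_nat)

lemma kr_levels_Q: "kr_levels X T (Q m) = (\<lambda>j. {x \<in> X. itr (int j) x \<in> B m}) ` {..<h m}"
  by (auto simp: kr_levels_def kr_index_Q kr_level_Q image_iff)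

lemma ckr_Q: "ckr_partition X d T (Q m)"
proof -
  have df: "disjoint_family_on (kr_level X T (Q m)) (kr_index (Q m))"
    using B_disjoint by (auto simp: disjoint_family_on_def kr_index_Q kr_level_Q)
  have "{} \<notin> kr_levels X T (Q m)"
  proof
    assume "{} \<in> kr_levels X T (Q m)"
    then have "{} \<in> (\<lambda>j. {x \<in> X. itr (int j) x \<in> B m}) ` {..<h m}" by (simp only: kr_levels_Q)
    then obtain j where "{} = {x \<in> X. itr (int j) x \<in> B m}" by blast
    moreover have "itr (- int j) a \<in> {x \<in> X. itr (int j) x \<in> B m}"
      using a a_in_B by simp
    ultimately show False by blast
  qed
  moreover have "\<Union> (kr_levels X T (Q m)) = X"
    using B_cover by (auto simp: kr_levels_Q)
  moreover have "disjoint (kr_levels X T (Q m))"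
    unfolding kr_levels_def by (rule disjoint_family_on_disjoint_image[OF df])
  ultimately have "partition_on X (kr_levels X T (Q m))" by (simp add: partition_on_def)
  moreover have "pull X T (h m) (B m) = B m"
    using B_shift[of _ 0 1 m] B_subset by (auto simp: pull_def itr_of_nat)
  ultimately show ?thesis
    using df openin_B closedin_B h(1) by (simp add: ckr_partition_def kr_base_Q Q_simps)
qed

lemma levels_Q_0: "kr_levels X T (Q 0) = {X}"
proof -
  have P0: "kr_levels X T (P 0) = {X}" using nested by (simp add: nested_ckr_def)
  have idx: "idx 0 x = idx 0 a" if "x \<in> X" for x
  proof (rule idx_eqI)
    show "idx 0 a \<in> kr_index (P 0)" by (rule idx_in[OF a])
    then have "kr_level X T (P 0) (idx 0 a) \<in> kr_levels X T (P 0)" by (simp add: kr_levels_def)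
    then show "x \<in> kr_level X T (P 0) (idx 0 a)" using P0 that by simp
  qed
  have "idx 0 (itr (int 1) x) = idx 0 x" if "x \<in> X" for x
    using idx[of "itr (int 1) x"] idx[of x] that by simp
  then have "h 0 \<le> 1" by (intro h_le) simp_all
  then have "h 0 = 1" using h(1)[of 0] by simp
  moreover have "name 0 x i = name 0 a i" if "x \<in> X" for x i
    unfolding name_def using idx[of "itr i x"] idx[of "itr i a"] that a by simp
  then have "B 0 = X" by (auto simp: B_def)
  ultimately show ?thesis by (auto simp: kr_levels_Q)
qed

text \<open>Being in phase with \<open>a\<close> at level \<open>Suc n\<close> implies it at level
  \<open>n\<close>, where the phase counts only modulo \<open>h n\<close>.\<close>

lemma refines_Q: "refines X (kr_levels X T (Q (Suc n))) (kr_levels X T (Q n))"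
proof -
  have "\<exists>Z\<in>kr_levels X T (Q n). Y \<subseteq> Z" if "Y \<in> kr_levels X T (Q (Suc n))" for Y
  proof -
    from that have "Y \<in> (\<lambda>j. {x \<in> X. itr (int j) x \<in> B (Suc n)}) ` {..<h (Suc n)}"
      by (simp only: kr_levels_Q)
    then obtain j where j: "Y = {x \<in> X. itr (int j) x \<in> B (Suc n)}" by blast
    define j' where "j' = nat (int j mod int (h n))"
    have j': "int j' = int j mod int (h n)" using h(1)[of n] by (simp add: j'_def)
    have "j' < h n" using h(1)[of n] by (simp add: j'_def nat_less_iff)
    moreover have "Y \<subseteq> {x \<in> X. itr (int j') x \<in> B n}"
      using B_mono[of n "Suc n"] B_mod[of _ "int j" n] by (auto simp: j j')
    ultimately show ?thesis by (auto simp: kr_levels_Q)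
  qed
  moreover have "partition_on X (kr_levels X T (Q n))" for n
    using ckr_Q by (simp add: ckr_partition_def)
  ultimately show ?thesis by (simp add: refines_def)
qed

lemma Inter_B: "(\<Inter>n. B n) = {a}"
proof -
  have "x = a" if "x \<in> (\<Inter>n. B n)" for x
  proof (rule idx_separates)
    have xB: "x \<in> B n" for n using that by blast
    then show "x \<in> X" using B_subset by blast
    show "idx n x = idx n a" for n
      using xB[of n] by (auto simp: B_def name_def dest: spec[of _ 0])
  qed (rule a)
  then show ?thesis using a_in_B by blast
qed

text \<open>The level of \<open>Q n\<close> that contains a point fixes its phase relative to
  \<open>a\<close> and with it \<open>idx n\<close>; so each level of \<open>P n\<close> is a union
  of levels of \<open>Q n\<close>.\<close>

lemma topology_Q: "topology_generated_by (\<Union>n. kr_levels X T (Q n)) = M.mtopology"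
proof -
  let ?G = "topology_generated_by (\<Union>n. kr_levels X T (Q n))"
  have 1: "openin M.mtopology U" if "generate_topology_on (\<Union>n. kr_levels X T (Q n)) U" for U
  proof (rule generate_topology_on_coarsest[OF istopology_openin _ that])
    fix s assume "s \<in> (\<Union>n. kr_levels X T (Q n))"
    then obtain n j where s: "s = {x \<in> X. itr (int j) x \<in> B n}" by (auto simp: kr_levels_Q)
    have "openin M.mtopology {x \<in> topspace M.mtopology. itr (int j) x \<in> B n}"
      by (rule openin_continuous_map_preimage[OF itr_continuous openin_B])
    then show "openin M.mtopology s" by (simp add: s)
  qed
  have 2: "openin ?G U" if "generate_topology_on (\<Union>n. kr_levels X T (P n)) U" for U
  proof (rule generate_topology_on_coarsest[OF istopology_openin _ that])
    fix s assume "s \<in> (\<Union>n. kr_levels X T (P n))"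
    then obtain n p where s: "s = kr_level X T (P n) p" "p \<in> kr_index (P n)"
      by (auto simp: kr_levels_def)
    show "openin ?G s"
    proof (subst openin_subopen, intro ballI)
      fix x assume x: "x \<in> s"
      then have xX: "x \<in> X" by (auto simp: s kr_level_def pull_def split: prod.splits)
      obtain j where j: "j < h n" "itr (int j) x \<in> B n" using B_cover[OF xX] by blast
      let ?V = "{x \<in> X. itr (int j) x \<in> B n}"
      have idx: "idx n y = name n a (- int j)" if "y \<in> ?V" for y
      proof -
        have "name n (itr (int j) y) (- int j) = name n a (- int j)"
          using that unfolding B_def by blast
        then show ?thesis using that by (simp add: name_itr name_def)
      qed
      have "?V \<subseteq> s"
      proof
        fix y assume y: "y \<in> ?V"
        have "idx n y = idx n x" using idx[OF y] idx[of x] xX j by simp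
        also have "\<dots> = p" using idx_eqI[OF s(2)] x s(1) by blast
        finally show "y \<in> s" using idx_in(2)[of y n] y s(1) by simp
      qed
      moreover have "openin ?G ?V"
        by (rule topology_generated_by_Basis) (use j in \<open>auto simp: kr_levels_Q\<close>)
      ultimately show "\<exists>V. openin ?G V \<and> x \<in> V \<and> V \<subseteq> s" using xX j by blast
    qed
  qed
  show ?thesis
    unfolding topology_eq
    using 1 2 topology_levels by (metis openin_topology_generated_by_iff)
qed

text \<open>Since the bases are nested, a passage through the tower of \<open>Q (Suc n)\<close>
  begins with a passage through the tower of \<open>Q n\<close>, which is not higher. Hence the
  witness \<open>0\<close>.\<close>

lemma crosses_Q: "crosses X T (Q (Suc n)) k (Q n) l"
  unfolding crosses_def
proof
  fix x assume "x \<in> pull X T (height (Q (Suc n)) k - 1) (base (Q (Suc n)) k)"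
  then have x: "x \<in> X" "itr (int (h (Suc n) - 1)) x \<in> B (Suc n)"
    by (simp_all add: pull_def Q_simps itr_of_nat)
  \<comment> \<open>Entering at the top means coming from the base; this form does not mention the
    height, so it can be compared between the levels.\<close>
  then have "itr (- 1) x \<in> B (Suc n)"
    using B_shift[OF x(1), of "- 1" 1 "Suc n"] h(1)[of "Suc n"] by (simp add: of_nat_diff)
  then have "itr (- 1) x \<in> B n" using B_mono[of n "Suc n"] by auto
  then have Bn: "itr (int (h n - 1)) x \<in> B n"
    using B_shift[OF x(1), of "- 1" 1 n] h(1)[of n] by (simp add: of_nat_diff)
  have "h n \<le> h (Suc n)"
    using h(1)[of "Suc n"] h(2)[of _ "Suc n"] by (intro h_le idx_refine[of n "Suc n"]) auto
  moreover have "(T ^^ j) x \<in> pull X T (h n - 1 - j) (B n)" if "j < h n" for j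
  proof -
    have "(T ^^ (h n - 1 - j)) ((T ^^ j) x) = (T ^^ (h n - 1)) x"
      using that funpow_add[of "h n - 1 - j" j T] by simp
    then show ?thesis using Bn x(1) by (simp add: pull_def funpow_in itr_of_nat)
  qed
  ultimately show "\<exists>i. i + height (Q n) l \<le> height (Q (Suc n)) k \<and>
      (\<forall>j<height (Q n) l. (T ^^ (i + j)) x \<in> pull X T (height (Q n) l - 1 - j) (base (Q n) l))"
    by (intro exI[of _ 0]) (simp add: Q_simps)
qed

lemma rank_le_1: "topological_rank_le X d T 1"
proof -
  have "nested_ckr X d T Q"
    unfolding nested_ckr_def kr_base_Q
    using ckr_Q levels_Q_0 B_mono[of _ "Suc _"] refines_Q Inter_B topology_Q by auto
  moreover have "primitive_ckr X T Q"
    unfolding primitive_ckr_def using crosses_Q lessI by blast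
  ultimately show ?thesis unfolding topological_rank_le_def using Q_simps by auto
qed

end

section \<open>Rank two\<close>

locale rank_two_system = kr_system X d T P
  for X :: "'x set" and d T P +
  fixes m0 :: nat
  assumes towers_le: "towers (P n) \<le> 2"
    and not_periodic: "\<not> periodic m0"
begin

lemma towers_eq: "m0 \<le> n \<Longrightarrow> towers (P n) = 2"
  using not_periodic periodic_mono periodic_if_one_tower[of n] towers_le[of n] by fastforce

lemma labels_eq: "m0 \<le> n \<Longrightarrow> {1..towers (P n)} = {1, 2}"
  using towers_eq by auto

lemma ex_marks_tower_word:
  assumes "m0 \<le> m" "m \<le> n"
  shows "\<exists>z \<alpha> \<beta>. marks z \<alpha> \<beta> (tower_word m n 1) (tower_word m n 2)"
proof (rule ex_marks, rule notI)
  assume "tower_word m n 1 @ tower_word m n 2 = tower_word m n 2 @ tower_word m n 1"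
  then have "periodic m"
    using assms labels_eq[of n] by (intro periodic_if_commuting[of m n 1 2]) auto
  then show False using not_periodic periodic_mono assms by blast
qed

section \<open>Markers between levels and diverging pairs\<close>

definition marker :: "nat \<Rightarrow> nat \<Rightarrow> (nat \<times> nat) list" where
  "marker m n = (SOME z. \<exists>\<alpha> \<beta>. marks z \<alpha> \<beta> (tower_word m n 1) (tower_word m n 2))"

definition \<zeta> :: "nat \<Rightarrow> nat \<Rightarrow> nat" where
  "\<zeta> m n = length (marker m n)"

lemma marker_marks:
  assumes "m0 \<le> m" "m \<le> n"
  shows "\<exists>\<alpha> \<beta>. marks (marker m n) \<alpha> \<beta> (tower_word m n 1) (tower_word m n 2)"
  unfolding marker_def using someI_ex[OF ex_marks_tower_word[OF assms]] .

lemma name_marker: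
  assumes "m0 \<le> m" "m \<le> n" "x \<in> X" "cut n x c \<noteq> None" "j < \<zeta> m n"
  shows "name m x (c + int j) = marker m n ! j"
proof -
  obtain \<alpha> \<beta> where "marks (marker m n) \<alpha> \<beta> (tower_word m n 1) (tower_word m n 2)"
    using marker_marks[OF assms(1,2)] by blast
  from parse_marker(1)[OF parse_name[OF assms(3,2)] this _ assms(4)]
  show ?thesis using ran_cut[OF assms(3), of n] labels_eq[of n] assms by (simp add: \<zeta>_def)
qed

definition diverge :: "nat \<Rightarrow> 'x \<Rightarrow> 'x \<Rightarrow> int \<Rightarrow> bool" where
  "diverge n x y t \<longleftrightarrow> cut n x t \<noteq> None \<and> cut n y t \<noteq> None \<and> cut n x t \<noteq> cut n y t"

lemma diverge_names:
  assumes "m0 \<le> m" "m \<le> n" "x \<in> X" "y \<in> X" "diverge n x y t"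
  shows "name m x (t + int (\<zeta> m n)) \<noteq> name m y (t + int (\<zeta> m n))"
proof -
  obtain \<alpha> \<beta> where m: "marks (marker m n) \<alpha> \<beta> (tower_word m n 1) (tower_word m n 2)"
    using marker_marks[OF assms(1,2)] by blast
  have r: "ran (cut n z) \<subseteq> {1, 2}" if "z \<in> X" for z
    using ran_cut[OF that, of n] labels_eq[of n] assms by simp
  have c: "cut n x t \<noteq> None" "cut n y t \<noteq> None" "cut n x t \<noteq> cut n y t"
    using assms(5) by (auto simp: diverge_def)
  have "cut n z t \<in> {None, Some 1, Some 2}" if "z \<in> X" for z
    using r[OF that] by (cases "cut n z t") (auto simp: ran_def)
  from this[OF assms(3)] this[OF assms(4)]
  have "(cut n x t = Some 1) \<noteq> (cut n y t = Some 1)"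
    using c by (elim insertE emptyE) simp_all
  moreover have "\<alpha> \<noteq> \<beta>" using m by (simp add: marks_def)
  ultimately show ?thesis
    using parse_marker(2)[OF parse_name[OF assms(3,2)] m r[OF assms(3)] c(1)]
      parse_marker(2)[OF parse_name[OF assms(4,2)] m r[OF assms(4)] c(2)]
    by (auto simp: \<zeta>_def split: if_splits)
qed

text \<open>At a cut the name is a top level, which the tower alone determines.\<close>

lemma divergeI:
  assumes "x \<in> X" "y \<in> X" "cut m x t \<noteq> None" "cut m y t \<noteq> None" "name m x t \<noteq> name m y t"
  shows "diverge m x y t"
proof -
  obtain k l where kl: "cut m x t = Some k" "cut m y t = Some l" using assms by auto
  then have "name m x t = (k, height (P m) k - 1)" "name m y t = (l, height (P m) l - 1)"
    using cut_iff_top assms(1,2) by auto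
  then have "k \<noteq> l" using assms(5) by auto
  then show ?thesis using kl by (simp add: diverge_def)
qed

text \<open>Above the base an index determines the next one, so names can part only on leaving the
  base.\<close>

lemma diverge_first_difference:
  assumes X: "x \<in> X" "y \<in> X" and eq: "name m x (t - 1) = name m y (t - 1)"
    and ne: "name m x t \<noteq> name m y t"
  shows "diverge m x y t"
proof -
  obtain k j where kj: "name m x (t - 1) = (k, j)" by fastforce
  have "j = 0"
  proof (rule ccontr)
    assume "j \<noteq> 0"
    then obtain j' where j: "j = Suc j'" by (cases j) auto
    have "name m z t = (k, j')" if "z \<in> X" "name m z (t - 1) = (k, Suc j')" for z
      using idx_T[of "itr (t - 1) z" m k j'] T_itr[of z "t - 1"] that by (simp add: name_def)
    then have "name m x t = (k, j')" "name m y t = (k, j')" using X kj eq j by auto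
    then show False using ne by simp
  qed
  then have "cut m x t \<noteq> None" "cut m y t \<noteq> None"
    using cut_not_None_iff X kj eq by auto
  then show ?thesis using divergeI X ne by blast
qed

text \<open>The level-\<open>m\<close> names agree along the marker and differ right after it, so
  \<open>diverge_first_difference\<close> applies there.\<close>

lemma diverge_descend:
  assumes m: "m0 \<le> m" "m \<le> n" and X: "x \<in> X" "y \<in> X" and d: "diverge n x y t"
  shows "diverge m x y (t + int (\<zeta> m n))"
proof -
  have c: "cut n x t \<noteq> None" "cut n y t \<noteq> None" using d by (auto simp: diverge_def)
  note ne = diverge_names[OF m X d]
  show ?thesis
  proof (cases "\<zeta> m n")
    \<comment> \<open>With an empty marker there is no common letter to start from, but a cut of
      level \<open>n\<close> is itself a cut of level \<open>m\<close>.\<close>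
    case 0
    have "cut m x t \<noteq> None" "cut m y t \<noteq> None" using c cut_mono[OF m(2)] by blast+
    then show ?thesis using divergeI[OF X] ne 0 by simp
  next
    case (Suc z)
    have "name m x (t + int z) = name m y (t + int z)"
      using name_marker[OF m X(1) c(1), of z] name_marker[OF m X(2) c(2), of z] Suc by simp
    moreover have "t + int (\<zeta> m n) - 1 = t + int z" using Suc by simp
    ultimately have "name m x (t + int (\<zeta> m n) - 1) = name m y (t + int (\<zeta> m n) - 1)"
      by (simp only:)
    then show ?thesis using diverge_first_difference[OF X _ ne] by blast
  qed
qed

lemma ex_diverge:
  assumes "m0 \<le> n"
  shows "\<exists>x\<in>X. \<exists>y\<in>X. diverge n x y t"
proof -
  have "\<exists>x\<in>X. cut n x t = Some k" if k: "k \<in> {1..towers (P n)}" for k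
  proof -
    have i: "(k, height (P n) k - 1) \<in> kr_index (P n)"
      using k height_pos[OF k] by (simp add: kr_index_def)
    have "kr_level X T (P n) (k, height (P n) k - 1) \<noteq> {}"
      using ckr[of n] i unfolding ckr_partition_def partition_on_def kr_levels_def by (metis imageI)
    then obtain z where z: "z \<in> kr_level X T (P n) (k, height (P n) k - 1)" by blast
    then have "z \<in> X" by (simp add: kr_level_def pull_def)
    then have "cut n (itr (- t) z) t = Some k"
      using idx_eqI[OF i z] k by (subst cut_iff_top) (auto simp: name_itr, simp add: name_def)
    then show ?thesis using \<open>z \<in> X\<close> itr_in by blast
  qed
  moreover have "1 \<in> {1..towers (P n)}" "2 \<in> {1..towers (P n)}"
    using towers_eq[OF assms] by auto
  ultimately obtain x y where "x \<in> X" "y \<in> X" "cut n x t = Some 1" "cut n y t = Some 2"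
    by meson
  then show ?thesis by (intro bexI[of _ x] bexI[of _ y]) (auto simp: diverge_def)
qed

text \<open>Both sides are the first time from \<open>0\<close> on at which the
  level-\<open>m0\<close> names differ, for a pair that diverges at level \<open>n\<close> at time
  \<open>0\<close>: once directly, once through the divergence at level \<open>m\<close>.\<close>

lemma \<zeta>_add:
  assumes "m0 \<le> m" "m \<le> n"
  shows "\<zeta> m0 n = \<zeta> m n + \<zeta> m0 m"
proof -
  have m: "m0 \<le> n" using assms by simp
  obtain x y where X: "x \<in> X" "y \<in> X" and d: "diverge n x y 0" using ex_diverge[OF m] by blast
  have eq: "name p x (t + int j) = name p y (t + int j)"
    if "m0 \<le> p" "p \<le> q" "diverge q x y t" "j < \<zeta> p q" for p q t j
    using name_marker[OF that(1,2) X(1) _ that(4)] name_marker[OF that(1,2) X(2) _ that(4)] that(3)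
    by (simp add: diverge_def)
  note dm = diverge_descend[OF assms X d]
  have "name m0 x (int j) = name m0 y (int j)" if j: "j < \<zeta> m n + \<zeta> m0 m" for j
  proof (cases "j < \<zeta> m n")
    case True
    then show ?thesis using name_refine[OF assms(1) X] eq[OF assms d True] by simp
  next
    case False
    then show ?thesis using eq[OF order_refl assms(1) dm, of "j - \<zeta> m n"] j by (simp add: of_nat_diff)
  qed
  moreover have "name m0 x (int (\<zeta> m n + \<zeta> m0 m)) \<noteq> name m0 y (int (\<zeta> m n + \<zeta> m0 m))"
    using diverge_names[OF order_refl assms(1) X dm] by simp
  moreover have "name m0 x (int j) = name m0 y (int j)" if "j < \<zeta> m0 n" for j
    using eq[OF order_refl m d that] by simp
  moreover have "name m0 x (int (\<zeta> m0 n)) \<noteq> name m0 y (int (\<zeta> m0 n))"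
    using diverge_names[OF order_refl m X d] by simp
  ultimately show ?thesis by (metis linorder_neqE_nat)
qed

text \<open>
  Before the marker both points are near the base of level \<open>n\<close>, and bases shrink to a point;
  after it both show the marker.
\<close>

lemma past_determined:
  assumes m: "m0 \<le> m" and i: "i < - int (\<zeta> m0 m)"
  shows "\<exists>N. \<forall>n\<ge>N. \<forall>x\<in>X. \<forall>y\<in>X. cut n x (- int (\<zeta> m0 n)) \<noteq> None \<longrightarrow>
           cut n y (- int (\<zeta> m0 n)) \<noteq> None \<longrightarrow> name m x i = name m y i"
proof -
  obtain N where N: "\<And>n x y j. n \<ge> N \<Longrightarrow> x \<in> X \<inter> kr_base (P n) \<Longrightarrow> y \<in> X \<inter> kr_base (P n) \<Longrightarrow>
      \<bar>j\<bar> \<le> int (nat \<bar>i\<bar> + 1) \<Longrightarrow> name m x j = name m y j"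
    using bases_shrink_window[of "nat \<bar>i\<bar> + 1" m] by blast
  have "name m x i = name m y i"
    if n: "n \<ge> max N m" and X: "x \<in> X" "y \<in> X"
      and c: "cut n x (- int (\<zeta> m0 n)) \<noteq> None" "cut n y (- int (\<zeta> m0 n)) \<noteq> None" for n x y
  proof (cases "i < - int (\<zeta> m0 n)")
    case True
    let ?c = "- int (\<zeta> m0 n) - 1"
    have "itr ?c x \<in> X \<inter> kr_base (P n)" "itr ?c y \<in> X \<inter> kr_base (P n)"
      using c X by (auto simp: cut_def split: if_splits)
    \<comment> \<open>The base point is visited between the times \<open>i\<close> and
      \<open>0\<close>, so the size of the window does not depend on \<open>n\<close>.\<close>
    moreover have "\<bar>i - ?c\<bar> \<le> int (nat \<bar>i\<bar> + 1)" using True by auto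
    moreover have "n \<ge> N" using n by simp
    ultimately have "name m (itr ?c x) (i - ?c) = name m (itr ?c y) (i - ?c)"
      using N by blast
    then show ?thesis using X by (simp add: name_itr)
  next
    case False
    have mn: "m \<le> n" using n by simp
    define j where "j = nat (i + int (\<zeta> m0 n))"
    have j: "i = - int (\<zeta> m0 n) + int j" using False by (simp add: j_def)
    \<comment> \<open>By additivity the level-\<open>m\<close> marker after the cut reaches exactly
      up to \<open>- \<zeta> m0 m\<close>.\<close>
    have "j < \<zeta> m n" using i \<zeta>_add[OF m mn] by (simp add: j)
    then show ?thesis
      using name_marker[OF m mn X(1) c(1)] name_marker[OF m mn X(2) c(2)] by (simp add: j)
  qed
  then show ?thesis by blast
qed

lemma asymptotic_if_pasts:
  assumes X: "x \<in> X" "y \<in> X"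
    and eq: "\<And>m i. m0 \<le> m \<Longrightarrow> i < - int (\<zeta> m0 m) \<Longrightarrow> name m x i = name m y i"
  shows "asymptotic X d T x y"
proof (rule names_imp_asymptotic[OF X])
  fix n
  \<comment> \<open>Levels below \<open>m0\<close> inherit the agreement by refinement.\<close>
  have "name n x i = name n y i" if "i < - int (\<zeta> m0 (max n m0))" for i
    using name_refine[OF _ X eq[OF _ that], of n] by simp
  then show "\<exists>c. \<forall>i\<le>c. name n x i = name n y i"
    by (intro exI[of _ "- int (\<zeta> m0 (max n m0)) - 1"]) auto
qed

text \<open>The first level-\<open>n\<close> difference is a divergence at level \<open>n\<close>,
  and the marker carries it to the first level-\<open>m0\<close> difference. The latter does not
  depend on \<open>n\<close>; it is \<open>D\<close>.\<close>

lemma asymptotic_diverge: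
  assumes X: "x \<in> X" "y \<in> X" and as: "asymptotic X d T x y" and ne: "x \<noteq> y"
  shows "\<exists>D N. \<forall>n\<ge>N. diverge n x y (D - int (\<zeta> m0 n))"
proof -
  let ?fd = "\<lambda>n t. (\<forall>i<t. name n x i = name n y i) \<and> name n x t \<noteq> name n y t"
  obtain N where N: "idx N x \<noteq> idx N y" using idx_separates[OF X] ne by blast
  have fd: "\<exists>t. ?fd n t" if "n \<ge> N" for n
  proof -
    have n0: "name n x 0 \<noteq> name n y 0"
      using idx_refine[OF that X] N by (auto simp: name_def)
    obtain c where c: "\<And>i. i \<le> c \<Longrightarrow> name n x i = name n y i"
      using asymptotic_imp_names[OF X as] by blast
    have c0: "c < 0" using c[of 0] n0 by (meson not_le)
    let ?Q = "\<lambda>k. name n x (c + int k) \<noteq> name n y (c + int k)"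
    have "?Q (nat (- c))" using n0 c0 by simp
    then obtain k where k: "?Q k" "\<And>j. j < k \<Longrightarrow> \<not> ?Q j" using exists_least_iff[of ?Q] by blast
    have "name n x i = name n y i" if "i < c + int k" for i
      using c[of i] k(2)[of "nat (i - c)"] that by (cases "i \<le> c") auto
    then show ?thesis using k(1) by blast
  qed
  have down: "?fd m0 (t + int (\<zeta> m0 n))" and div: "diverge n x y t" if n: "m0 \<le> n" and t: "?fd n t" for n t
  proof -
    show div: "diverge n x y t" using t by (intro diverge_first_difference[OF X]) auto
    have c: "cut n x t \<noteq> None" "cut n y t \<noteq> None" using div by (auto simp: diverge_def)
    have "name m0 x i = name m0 y i" if i: "i < t + int (\<zeta> m0 n)" for i
    proof (cases "i < t")
      case True
      then show ?thesis using t name_refine[OF n X] by blast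
    next
      case False
      then have "nat (i - t) < \<zeta> m0 n" "i = t + int (nat (i - t))" using i by auto
      then show ?thesis
        using name_marker[OF order_refl n X(1) c(1)] name_marker[OF order_refl n X(2) c(2)] by metis
    qed
    then show "?fd m0 (t + int (\<zeta> m0 n))" using diverge_names[OF order_refl n X div] by blast
  qed
  define N' where "N' = max N m0"
  obtain t0 where t0: "?fd N' t0" using fd[of N'] by (auto simp: N'_def)
  define D where "D = t0 + int (\<zeta> m0 N')"
  have D: "?fd m0 D" using down[OF _ t0] by (simp add: D_def N'_def)
  have "diverge n x y (D - int (\<zeta> m0 n))" if n: "n \<ge> N'" for n
  proof -
    have n': "n \<ge> N" "m0 \<le> n" using n by (auto simp: N'_def)
    obtain t where t: "?fd n t" using fd[OF n'(1)] by blast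
    have "t + int (\<zeta> m0 n) = D" using down[OF n'(2) t] D by (metis linorder_neqE)
    then have "t = D - int (\<zeta> m0 n)" by simp
    then show ?thesis using div[OF n'(2) t] by simp
  qed
  then show ?thesis by blast
qed

text \<open>After shifts that move the level-\<open>m0\<close> differences to time \<open>0\<close>,
  both pairs have a cut at \<open>- \<zeta> m0 n\<close> for all large \<open>n\<close>, and these
  cuts determine the past.\<close>

lemma asymptotic_pairs_asymptotic:
  assumes x: "x \<in> X" "x' \<in> X" "asymptotic X d T x x'" "x \<noteq> x'"
    and y: "y \<in> X" "y' \<in> X" "asymptotic X d T y y'" "y \<noteq> y'"
  shows "\<exists>i j. asymptotic X d T (itr i x) (itr j y)"
proof -
  obtain D N where D: "\<And>n. n \<ge> N \<Longrightarrow> diverge n x x' (D - int (\<zeta> m0 n))"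
    using asymptotic_diverge[OF x] by blast
  obtain E M where E: "\<And>n. n \<ge> M \<Longrightarrow> diverge n y y' (E - int (\<zeta> m0 n))"
    using asymptotic_diverge[OF y] by blast
  have "asymptotic X d T (itr D x) (itr E y)"
  proof (rule asymptotic_if_pasts)
    fix m i assume m: "m0 \<le> m" "i < - int (\<zeta> m0 m)"
    obtain K where K: "\<And>n x y. n \<ge> K \<Longrightarrow> x \<in> X \<Longrightarrow> y \<in> X \<Longrightarrow> cut n x (- int (\<zeta> m0 n)) \<noteq> None \<Longrightarrow>
           cut n y (- int (\<zeta> m0 n)) \<noteq> None \<Longrightarrow> name m x i = name m y i"
      using past_determined[OF m] by blast
    define n where "n = max K (max N M)"
    have "cut n (itr D x) (- int (\<zeta> m0 n)) \<noteq> None" "cut n (itr E y) (- int (\<zeta> m0 n)) \<noteq> None"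
      using D[of n] E[of n] x(1) y(1) by (simp_all add: n_def diverge_def cut_itr)
    then show "name m (itr D x) i = name m (itr E y) i"
      using x y by (intro K[of n]) (auto simp: n_def)
  qed (use x y in auto)
  then show ?thesis by blast
qed

text \<open>A limit of pairs that diverge at ever higher levels, timed so that each shows a
  level-\<open>m0\<close> difference at time \<open>0\<close>. This difference survives in the
  limit, and the pasts agree there by \<open>past_determined\<close>.\<close>

lemma ex_asymptotic_pair:
  shows "\<exists>x\<in>X. \<exists>y\<in>X. asymptotic X d T x y \<and> name m0 x 0 \<noteq> name m0 y 0"
proof -
  have "\<exists>x y. x \<in> X \<and> y \<in> X \<and> diverge (m0 + n) x y (- int (\<zeta> m0 (m0 + n)))" for n
    using ex_diverge[of "m0 + n" "- int (\<zeta> m0 (m0 + n))"] by auto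
  then obtain x y where xy: "\<And>n. x n \<in> X" "\<And>n. y n \<in> X"
    "\<And>n. diverge (m0 + n) (x n) (y n) (- int (\<zeta> m0 (m0 + n)))" by metis
  obtain a r where a: "a \<in> X" "strict_mono r" "limitin M.mtopology (x \<circ> r) a sequentially"
    using convergent_subsequence[of x] xy(1) by blast
  obtain b r' where b: "b \<in> X" "strict_mono r'" "limitin M.mtopology ((y \<circ> r) \<circ> r') b sequentially"
    using convergent_subsequence[of "y \<circ> r"] xy(2) by auto
  let ?r = "\<lambda>k. r (r' k)"
  have la: "limitin M.mtopology (\<lambda>k. x (?r k)) a sequentially"
    using limitin_subsequence[OF b(2) a(3)] by (simp add: o_def)
  have lb: "limitin M.mtopology (\<lambda>k. y (?r k)) b sequentially"
    using b(3) by (simp add: o_def)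
  have rk: "k \<le> ?r k" for k
    using strict_mono_imp_increasing[OF a(2), of "r' k"] strict_mono_imp_increasing[OF b(2), of k]
    by linarith
  have "asymptotic X d T a b"
  proof (rule asymptotic_if_pasts[OF a(1) b(1)])
    fix m i assume m: "m0 \<le> m" "i < - int (\<zeta> m0 m)"
    obtain K where K: "\<And>n x y. n \<ge> K \<Longrightarrow> x \<in> X \<Longrightarrow> y \<in> X \<Longrightarrow> cut n x (- int (\<zeta> m0 n)) \<noteq> None \<Longrightarrow>
           cut n y (- int (\<zeta> m0 n)) \<noteq> None \<Longrightarrow> name m x i = name m y i"
      using past_determined[OF m] by blast
    have "\<forall>\<^sub>F k in sequentially. name m (x (?r k)) i = name m (y (?r k)) i"
      using eventually_ge_at_top[of K]
    proof eventually_elim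
      case (elim k)
      then have "K \<le> m0 + ?r k" using rk[of k] by linarith
      then show ?case using xy(3)[of "?r k"] xy(1,2) by (intro K) (auto simp: diverge_def)
    qed
    with idx_limit[OF la, of m i] idx_limit[OF lb, of m i]
    have "\<forall>\<^sub>F k in sequentially. name m a i = name m b i"
      by eventually_elim (simp add: name_def)
    then show "name m a i = name m b i" by simp
  qed
  moreover have "name m0 a 0 \<noteq> name m0 b 0"
  proof -
    have ne: "name m0 (x k) 0 \<noteq> name m0 (y k) 0" for k
      using diverge_names[OF order_refl _ xy(1,2) xy(3), of k] by simp
    from idx_limit[OF la, of m0 0] idx_limit[OF lb, of m0 0]
    have "\<forall>\<^sub>F k in sequentially. name m0 a 0 \<noteq> name m0 b 0"
    proof eventually_elim
      case (elim k)
      then show ?case using ne[of "?r k"] by (simp add: name_def)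
    qed
    then show ?thesis by simp
  qed
  ultimately show ?thesis using a b by blast
qed

text \<open>A periodic point has a periodic level-\<open>m0\<close> name, and
  \<open>period_spreads\<close> would make the whole level periodic.\<close>

lemma itr_fixed_imp:
  assumes "a \<in> X" "itr k a = a"
  shows "k = 0"
proof (rule ccontr)
  assume "k \<noteq> 0"
  have *: "\<exists>q\<ge>1. itr (int q) a = a"
  proof (cases "k > 0")
    case True
    then show ?thesis using assms by (intro exI[of _ "nat k"]) auto
  next
    case False
    have "itr (- k) a = a" using assms itr_minus_itr[of a k] by simp
    then show ?thesis using False \<open>k \<noteq> 0\<close> by (intro exI[of _ "nat (- k)"]) auto
  qed
  then obtain q where q: "q \<ge> 1" "itr (int q) a = a" by blast
  have "name m0 a (i + int q) = name m0 a i" for i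
    using assms(1) q by (simp add: name_def itr_add)
  then have "periodic m0"
    using period_spreads[OF assms(1)] q(1) by (auto simp: periodic_def)
  then show False using not_periodic by simp
qed

text \<open>An accumulation point of the backward orbit of \<open>x\<close> is fixed by
  \<open>itr k\<close>. This is what puts the two points of the limit pair into different
  orbits.\<close>

lemma asymptotic_same_orbit:
  assumes x: "x \<in> X" and as: "asymptotic X d T x (itr k x)"
  shows "k = 0"
proof -
  obtain a r where a: "a \<in> X" "strict_mono r"
    "limitin M.mtopology ((\<lambda>n. itr (- int n) x) \<circ> r) a sequentially"
    using convergent_subsequence[of "\<lambda>n. itr (- int n) x"] x by auto
  have "idx m a = idx m (itr k a)" for m
  proof -
    obtain c where c: "\<And>i. i \<le> c \<Longrightarrow> name m x i = name m (itr k x) i"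
      using asymptotic_imp_names[OF x _ as] x by auto
    have "\<forall>\<^sub>F n in sequentially. name m x (- int (r n)) = name m x (- int (r n) + k)"
      using eventually_ge_at_top[of "nat (- c)"]
    proof eventually_elim
      case (elim n)
      then have "- int (r n) \<le> c" using strict_mono_imp_increasing[OF a(2), of n] by linarith
      then show ?case using c name_itr[OF x] by metis
    qed
    with idx_limit[OF a(3), of m 0] idx_limit[OF a(3), of m k]
    have "\<forall>\<^sub>F n in sequentially. idx m a = idx m (itr k a)"
    proof eventually_elim
      case (elim n)
      then show ?case using itr_add[OF x, of k "- int (r n)"] by (simp add: name_def add.commute)
    qed
    then show ?thesis by simp
  qed
  then have "a = itr k a" using a(1) by (intro idx_separates) auto
  then show ?thesis using itr_fixed_imp[OF a(1)] by metis
qed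

lemma unique_component: "\<exists>!C. C \<in> asymptotic_components X d T"
proof (rule ex_ex1I)
  obtain x y where xy: "x \<in> X" "y \<in> X" "asymptotic X d T x y" "name m0 x 0 \<noteq> name m0 y 0"
    using ex_asymptotic_pair by blast
  have "orbit X T x \<noteq> orbit X T y"
  proof
    assume "orbit X T x = orbit X T y"
    then have "y \<in> orbit X T x" using self_in_orbit by metis
    then obtain k where k: "y = itr k x" by (auto simp: orbit_def)
    then show False using asymptotic_same_orbit[OF xy(1), of k] xy(3,4) by simp
  qed
  then show "\<exists>C. C \<in> asymptotic_components X d T"
    using asymptotic_componentI[OF xy(1-3)] by blast
next
  fix C D assume C: "C \<in> asymptotic_components X d T" and D: "D \<in> asymptotic_components X d T"
  obtain x x' where x: "x \<in> X" "x' \<in> X" "x \<noteq> x'" "asymptotic X d T x x'" "orbit X T x \<in> C"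
    using asymptotic_componentE[OF C] by blast
  obtain y y' where y: "y \<in> X" "y' \<in> X" "y \<noteq> y'" "asymptotic X d T y y'" "orbit X T y \<in> D"
    using asymptotic_componentE[OF D] by blast
  obtain i j where "asymptotic X d T (itr i x) (itr j y)"
    using asymptotic_pairs_asymptotic[OF x(1,2,4,3) y(1,2,4,3)] by blast
  then show "C = D" by (rule asymptotic_component_eqI[OF C D x(1,5) y(1,5)])
qed

end

theorem corollary7p4:
  shows
    "(\<forall>\<tau> :: nat \<Rightarrow> 'a::finite list \<Rightarrow> 'a list.
        CARD('a) = 2 \<longrightarrow>
        (\<forall>n. nonerasing_morphism (\<tau> n)) \<longrightarrow>
        aperiodic_system (sadic_subshift \<tau>) shift \<longrightarrow>
        minimal_system (sadic_subshift \<tau>) shift_dist shift \<longrightarrow>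
        finite (asymptotic_components (sadic_subshift \<tau>) shift_dist shift) \<and>
        card (asymptotic_components (sadic_subshift \<tau>) shift_dist shift) \<le> 2) \<and>
     (\<forall>(X :: 'x set) d T.
        minimal_cantor_system X d T \<longrightarrow>
        topological_rank X d T = 2 \<longrightarrow>
        (\<exists>!C. C \<in> asymptotic_components X d T))"
proof (intro conjI allI impI)
  fix \<tau> :: "nat \<Rightarrow> 'a::finite list \<Rightarrow> 'a list"
  assume card: "CARD('a) = 2" and "\<forall>n. nonerasing_morphism (\<tau> n)"
    and "aperiodic_system (sadic_subshift \<tau>) shift"
  moreover obtain a b :: 'a where "a \<noteq> b" "UNIV = {a, b}"
    using card by (metis card_2_iff)
  ultimately interpret binary_sadic \<tau> a b
    by unfold_locales
  show "finite (asymptotic_components (sadic_subshift \<tau>) shift_dist shift)"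
    and "card (asymptotic_components (sadic_subshift \<tau>) shift_dist shift) \<le> 2"
    using card_components by blast+
next
  fix X :: "'x set" and d T
  assume mc: "minimal_cantor_system X d T" and rank: "topological_rank X d T = 2"
  let ?R = "{enat r | r. topological_rank_le X d T r}"
  \<comment> \<open>The infimum of the empty set is infinite; so rank \<open>2\<close> makes the set
    nonempty, and its infimum is attained.\<close>
  have "?R \<noteq> {}"
    using rank unfolding topological_rank_def Inf_enat_def by (metis infinity_ne_i0 numeral_ne_infinity)
  then obtain q where "q \<in> ?R" by blast
  then have "Inf ?R \<in> ?R" by (rule wellorder_InfI)
  then have le2: "topological_rank_le X d T 2"
    using rank unfolding topological_rank_def by (auto simp: numeral_eq_enat)
  have not_le1: "\<not> topological_rank_le X d T 1"
  proof
    assume "topological_rank_le X d T 1"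
    then have "Inf ?R \<le> enat 1" by (intro Inf_lower) blast
    then show False using rank unfolding topological_rank_def by (simp add: numeral_eq_enat)
  qed
  have comp: "compact_system X d T" and min: "minimal_system X d T"
    and cantor: "cantor_space (Metric_space.mtopology X d)"
    using mc by (simp_all add: minimal_cantor_system_def)
  interpret ms: Metric_space X d using comp by (simp add: compact_system_def)
  obtain P where P: "nested_ckr X d T P" "\<And>n. towers (P n) \<le> 2"
    using le2 by (auto simp: topological_rank_le_def)
  have "X \<noteq> {}"
  proof
    assume "X = {}"
    then have "topspace (product_topology (\<lambda>_ :: nat. discrete_topology (UNIV :: bool set)) UNIV) = {}"
      using cantor homeomorphic_empty_space[of ms.mtopology] unfolding cantor_space_def
      by (metis ms.topspace_mtopology null_topspace_iff_trivial)
    then show False by simp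
  qed
  then interpret kr_system X d T P
    using comp min P(1) by unfold_locales
  obtain a where a: "a \<in> X" using \<open>X \<noteq> {}\<close> by blast
  \<comment> \<open>Otherwise the one-tower partitions would bound the rank by
    \<open>1\<close>.\<close>
  have "\<exists>m. \<not> periodic m"
  proof (rule ccontr)
    assume "\<not> ?thesis"
    then interpret periodic_system X d T P a
      using a by unfold_locales blast+
    show False using rank_le_1 not_le1 by contradiction
  qed
  then obtain m where "\<not> periodic m" by blast
  then interpret rank_two_system X d T P m
    using P(2) by unfold_locales
  show "\<exists>!C. C \<in> asymptotic_components X d T" by (rule unique_component)
qed

end
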